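(* Let $W\subset \mathrm{GL}(V)$ be a complex reflection group with braid group $B$ and pure braid group $P$. For each $\mathcal{C}\in\mathscr{H}/W$ choose $H_{\mathcal{C}}\in\mathcal{C}$ and let $N_{\mathcal{C}}$ be the stabilizer of $H_{\mathcal{C}}$ in $W$. Under the isomorphism $$H^2(W,\mathbb{Z}\mathscr{H})\;\cong\;\bigoplus_{\mathcal{C}\in\mathscr{H}/W}\mathrm{Hom}_{\mathrm{gr.}}(N_{\mathcal{C}},\mathbb{Q}/\mathbb{Z})$$ described in the context, the class of the extension $$1\longrightarrow P/[P,P]\longrightarrow B/[P,P]\stackrel{p}{\longrightarrow} W\longrightarrow 1$$ corresponds to the family of morphisms $(r_{\mathcal{C}}:N_{\mathcal{C}}\to\mathbb{Q}/\mathbb{Z})_{\mathcal{C}\in\mathscr{H}/W}$, where $r_{\mathcal{C}}$ is the natural linear character of $N_{\mathcal{C}}=N_{H_{\mathcal{C}}}$, with $\mathbb{U}_{f_{H_{\mathcal{C}}}}$ identified with a subgroup of $\mathbb{Q}/\mathbb{Z}$ via the exponential map $x\mapsto\exp(2i\pi x)$.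
   Context: $V$ is a finite-dimensional complex vector space. A reflection is a nontrivial finite-order element of $\mathrm{GL}(V)$ fixing a hyperplane pointwise; a (complex) reflection group $W\subset\mathrm{GL}(V)$ is a finite group generated by reflections. $\mathscr{H}$ is the set of hyperplanes of the reflections of $W$. $V^{\mathrm{reg}}=V\setminus\bigcup_{H\in\mathscr{H}}H$, on which $W$ acts freely. Fix $x_0\in V^{\mathrm{reg}}$; $P=\pi_1(V^{\mathrm{reg}},x_0)$ and $B=\pi_1(V^{\mathrm{reg}}/W,\overline{x_0})$, with exact sequence $1\to P\to B\stackrel{p}{\to}W\to1$ (a loop lifted to a path starting at $x_0$ ends at $p(b)x_0$; in a product of paths the first factor is travelled first). $[P,P]$ is normal in $B$, and conjugation makes $P/[P,P]$ a $W$-module. Fix a $W$-invariant hermitian product on $V$. For $H\in\mathscr{H}$: $D=H^\perp$; $W_H$ is the pointwise fixator of $H$ in $W$, cyclic of order $e_H$, and $s_H$ is its generator of determinant $\exp(2i\pi/e_H)$; $N_H=\{w\in W:wH=H\}$; the natural linear character $r:N_H\to\mathbb{C}^\times$ is given by the action of $N_H$ on the line $D$, and $f_H$ is defined by $r(N_H)=\mathbb{U}_{f_H}$ (group of $f_H$-th roots of unity). Generator of the monodromy around $H$: $s_{H,\gamma}\in B$ is the class of the image of the path from $x_0$ to $s_H(x_0)$ composed of: a path $\gamma$ in $V^{\mathrm{reg}}$ from $x_0$ to a point $x_H=h+d$ near $H$ and far from the other hyperplanes ($h\in H$ on no other hyperplane, $d\in D\setminus\{0\}$ small); the path $t\in[0,1]\mapsto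 h+\exp(2i\pi t/e_H)d$; and the path $s_H(\gamma^{-1})$. It is a known fact that the class of $s_{H,\gamma}^{e_H}$ in $P/[P,P]$ depends only on $H$ and that sending $H$ to this class identifies the permutation module $\mathbb{Z}\mathscr{H}$ with the $W$-module $P/[P,P]$; this identification is used. The isomorphism is the composite of: (1) $H^2(W,\mathbb{Z}\mathscr{H})=\bigoplus_{\mathcal{C}\in\mathscr{H}/W}H^2(W,\mathbb{Z}\mathcal{C})$, induced by the projections $\mathbb{Z}\mathscr{H}\to\mathbb{Z}\mathcal{C}$; (2) for each $\mathcal{C}$, Shapiro's isomorphism $H^2(W,\mathbb{Z}\mathcal{C})\cong H^2(N_{\mathcal{C}},\mathbb{Z})$ (as $\mathbb{Z}\mathcal{C}=\mathrm{Ind}_{N_{\mathcal{C}}}^W\mathbb{Z}$), given on $2$-cocycles by restricting to $N_{\mathcal{C}}^2$ and composing with the projection $\mathbb{Z}\mathcal{C}\to\mathbb{Z}$ onto the $H_{\mathcal{C}}$-component; (3) the inverse of the connecting isomorphism $\mathrm{Hom}_{\mathrm{gr.}}(N_{\mathcal{C}},\mathbb{Q}/\mathbb{Z})=H^1(N_{\mathcal{C}},\mathbb{Q}/\mathbb{Z})\to H^2(N_{\mathcal{C}},\mathbb{Z})$ of the exact sequence of trivial modules $0\to\mathbb{Z}\to\mathbb{Q}\to\mathbb{Q}/\mathbb{Z}\to0$. The class of an extension $0\to X\stackrel{u}{\to} E\to G\to1$ is that of the $2$-cocycle $\varphi$ with $u(\varphi(g,g'))=s(g)s(g')s(gg')^{-1}$,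 for a set-theoretic section $s$ of $E\to G$. *)

theory Defs
  imports "HOL-Analysis.Analysis" "HOL-Algebra.Generated_Groups" "HOL-Algebra.Free_Abelian_Groups"
begin

section \<open>Second cohomology of groups\<close>

text \<open>
  Modules are written multiplicatively, as commutative groups \<open>M\<close> of \<^theory>\<open>HOL-Algebra.Group\<close>
  together with an action map \<open>act\<close>; cochains are the inhomogeneous ones.
\<close>

definition cochains2 :: "('g, 'a) monoid_scheme \<Rightarrow> ('m, 'b) monoid_scheme \<Rightarrow> ('g \<times> 'g \<Rightarrow> 'm) monoid" where
  "cochains2 G M =
     \<lparr>carrier = (carrier G \<times> carrier G) \<rightarrow>\<^sub>E carrier M,
      mult = (\<lambda>\<phi> \<psi>. \<lambda>x\<in>carrier G \<times> carrier G. \<phi> x \<otimes>\<^bsub>M\<^esub> \<psi> x),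
      one = (\<lambda>x\<in>carrier G \<times> carrier G. \<one>\<^bsub>M\<^esub>)\<rparr>"

definition cocycles2 ::
    "('g, 'a) monoid_scheme \<Rightarrow> ('m, 'b) monoid_scheme \<Rightarrow> ('g \<Rightarrow> 'm \<Rightarrow> 'm) \<Rightarrow> ('g \<times> 'g \<Rightarrow> 'm) set" where
  "cocycles2 G M act =
     {\<phi> \<in> carrier (cochains2 G M).
        \<forall>a\<in>carrier G. \<forall>b\<in>carrier G. \<forall>c\<in>carrier G.
          act a (\<phi> (b, c)) \<otimes>\<^bsub>M\<^esub> \<phi> (a, b \<otimes>\<^bsub>G\<^esub> c) = \<phi> (a \<otimes>\<^bsub>G\<^esub> b, c) \<otimes>\<^bsub>M\<^esub> \<phi> (a, b)}"

definition coboundaries2 ::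
    "('g, 'a) monoid_scheme \<Rightarrow> ('m, 'b) monoid_scheme \<Rightarrow> ('g \<Rightarrow> 'm \<Rightarrow> 'm) \<Rightarrow> ('g \<times> 'g \<Rightarrow> 'm) set" where
  "coboundaries2 G M act =
     (\<lambda>\<eta>. \<lambda>(a, b)\<in>carrier G \<times> carrier G. act a (\<eta> b) \<otimes>\<^bsub>M\<^esub> inv\<^bsub>M\<^esub> (\<eta> (a \<otimes>\<^bsub>G\<^esub> b)) \<otimes>\<^bsub>M\<^esub> \<eta> a)
       ` (carrier G \<rightarrow> carrier M)"

definition H2_group ::
    "('g, 'a) monoid_scheme \<Rightarrow> ('m, 'b) monoid_scheme \<Rightarrow> ('g \<Rightarrow> 'm \<Rightarrow> 'm) \<Rightarrow> ('g \<times> 'g \<Rightarrow> 'm) set monoid" where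
  "H2_group G M act = (cochains2 G M)\<lparr>carrier := cocycles2 G M act\<rparr> Mod coboundaries2 G M act"

definition H2_class ::
    "('g, 'a) monoid_scheme \<Rightarrow> ('m, 'b) monoid_scheme \<Rightarrow> ('g \<Rightarrow> 'm \<Rightarrow> 'm) \<Rightarrow> ('g \<times> 'g \<Rightarrow> 'm)
      \<Rightarrow> ('g \<times> 'g \<Rightarrow> 'm) set" where
  "H2_class G M act \<phi> = coboundaries2 G M act #>\<^bsub>cochains2 G M\<^esub> \<phi>"

lemma H2_class_in_H2_group:
  "\<phi> \<in> cocycles2 G M act \<Longrightarrow> H2_class G M act \<phi> \<in> carrier (H2_group G M act)"
  by (auto simp: H2_class_def H2_group_def FactGroup_def RCOSETS_def r_coset_def)

text \<open>
  The map induced on classes by a map \<open>F\<close> of cochains which sends cohomologous cocycles to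
  cohomologous cocycles; the arguments \<open>G\<close>, \<open>M\<close>, \<open>act\<close> are those of the target.
\<close>

definition H2_induced ::
    "('g, 'a) monoid_scheme \<Rightarrow> ('m, 'b) monoid_scheme \<Rightarrow> ('g \<Rightarrow> 'm \<Rightarrow> 'm)
      \<Rightarrow> ('c \<Rightarrow> 'g \<times> 'g \<Rightarrow> 'm) \<Rightarrow> 'c set \<Rightarrow> ('g \<times> 'g \<Rightarrow> 'm) set" where
  "H2_induced G M act F \<kappa> = the_elem ((\<lambda>\<phi>. H2_class G M act (F \<phi>)) ` \<kappa>)"

text \<open>
  \<open>\<kappa>\<close> is the class of the extension of \<open>G\<close> by the module \<open>X\<close> given by \<open>u : X \<rightarrow> E\<close> and \<open>p : E \<rightarrow> G\<close>.
\<close>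

definition extension_class ::
    "('g, 'a) monoid_scheme \<Rightarrow> ('m, 'b) monoid_scheme \<Rightarrow> ('g \<Rightarrow> 'm \<Rightarrow> 'm)
      \<Rightarrow> ('e, 'c) monoid_scheme \<Rightarrow> ('m \<Rightarrow> 'e) \<Rightarrow> ('e \<Rightarrow> 'g) \<Rightarrow> ('g \<times> 'g \<Rightarrow> 'm) set \<Rightarrow> bool" where
  "extension_class G X act E u p \<kappa> \<longleftrightarrow>
     (\<exists>s \<phi>. s \<in> carrier G \<rightarrow> carrier E \<and> (\<forall>g\<in>carrier G. p (s g) = g) \<and>
        \<phi> \<in> cocycles2 G X act \<and>
        (\<forall>g\<in>carrier G. \<forall>g'\<in>carrier G.
           u (\<phi> (g, g')) = s g \<otimes>\<^bsub>E\<^esub> s g' \<otimes>\<^bsub>E\<^esub> inv\<^bsub>E\<^esub> (s (g \<otimes>\<^bsub>G\<^esub> g'))) \<and>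
        \<kappa> = H2_class G X act \<phi>)"

definition trivial_act :: "'g \<Rightarrow> 'm \<Rightarrow> 'm" where
  "trivial_act g m = m"

definition rat_group :: "rat monoid" where
  "rat_group = \<lparr>carrier = UNIV, mult = (+), one = 0\<rparr>"

definition rat_mod_int :: "rat set monoid" where
  "rat_mod_int = rat_group Mod \<int>"

definition Hom_gr :: "('g, 'a) monoid_scheme \<Rightarrow> ('m, 'b) monoid_scheme \<Rightarrow> ('g \<Rightarrow> 'm) set" where
  "Hom_gr G A = hom G A \<inter> extensional (carrier G)"

text \<open>
  The connecting map of \<open>0 \<rightarrow> \<int> \<rightarrow> \<rat> \<rightarrow> \<rat>/\<int> \<rightarrow> 0\<close> in degree 1: lift a homomorphism to a
  \<open>\<rat>\<close>-valued 1-cochain \<open>l\<close>, whose coboundary is integer-valued.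
\<close>

definition connecting_hom :: "('g, 'a) monoid_scheme \<Rightarrow> ('g \<Rightarrow> rat set) \<Rightarrow> ('g \<times> 'g \<Rightarrow> int) set" where
  "connecting_hom G f =
     (let l = (\<lambda>g. SOME q. q \<in> f g) in
      H2_class G integer_group trivial_act
        (\<lambda>(a, b)\<in>carrier G \<times> carrier G. THE k. of_int k = l b - l (a \<otimes>\<^bsub>G\<^esub> b) + l a))"


section \<open>Fundamental groups\<close>

definition join_path :: "(real \<Rightarrow> 'a) \<Rightarrow> (real \<Rightarrow> 'a) \<Rightarrow> real \<Rightarrow> 'a" where
  "join_path f g = (\<lambda>t. if t \<le> 1/2 then f (2 * t) else g (2 * t - 1))"

definition path_class :: "'a topology \<Rightarrow> (real \<Rightarrow> 'a) \<Rightarrow> (real \<Rightarrow> 'a) set" where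
  "path_class X f =
     {g. homotopic_with (\<lambda>r. r 0 = f 0 \<and> r 1 = f 1) (top_of_set {0..1}) X f g}"

definition pi1 :: "'a topology \<Rightarrow> 'a \<Rightarrow> (real \<Rightarrow> 'a) set monoid" where
  "pi1 X x =
     \<lparr>carrier = path_class X ` {f. pathin X f \<and> f 0 = x \<and> f 1 = x},
      mult = (\<lambda>a b. the_elem {path_class X (join_path f g) | f g. f \<in> a \<and> g \<in> b}),
      one = path_class X (\<lambda>_. x)\<rparr>"

definition pi1_map :: "'b topology \<Rightarrow> ('a \<Rightarrow> 'b) \<Rightarrow> (real \<Rightarrow> 'a) set \<Rightarrow> (real \<Rightarrow> 'b) set" where
  "pi1_map Y q a = the_elem ((\<lambda>f. path_class Y (q \<circ> f)) ` a)"


section \<open>Complex reflection groups\<close>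

definition GL :: "(complex^'n^'n) monoid" where
  "GL = \<lparr>carrier = {A. invertible A}, mult = (**), one = mat 1\<rparr>"

definition hyperplane :: "(complex^'n) set \<Rightarrow> bool" where
  "hyperplane H \<longleftrightarrow> vec.subspace H \<and> vec.dim H + 1 = CARD('n)"

definition is_reflection :: "complex^'n^'n \<Rightarrow> bool" where
  "is_reflection s \<longleftrightarrow>
     s \<in> carrier GL \<and> s \<noteq> mat 1 \<and> (\<exists>k::nat. k > 0 \<and> s [^]\<^bsub>GL\<^esub> k = mat 1) \<and>
     (\<exists>H. hyperplane H \<and> (\<forall>v\<in>H. s *v v = v))"

definition reflection_group :: "(complex^'n^'n) set \<Rightarrow> bool" where
  "reflection_group W \<longleftrightarrow> finite W \<and> (\<exists>S. (\<forall>s\<in>S. is_reflection s) \<and> W = generate GL S)"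

abbreviation group_of :: "(complex^'n^'n) set \<Rightarrow> (complex^'n^'n) monoid" where
  "group_of W \<equiv> GL\<lparr>carrier := W\<rparr>"

definition hyperplanes :: "(complex^'n^'n) set \<Rightarrow> (complex^'n) set set" where
  "hyperplanes W = {H. hyperplane H \<and> (\<exists>s\<in>W. is_reflection s \<and> (\<forall>v\<in>H. s *v v = v))}"

definition act_hyp :: "complex^'n^'n \<Rightarrow> (complex^'n) set \<Rightarrow> (complex^'n) set" where
  "act_hyp w H = (*v) w ` H"

definition hyperplane_orbits :: "(complex^'n^'n) set \<Rightarrow> (complex^'n) set set set" where
  "hyperplane_orbits W = (\<lambda>H. (\<lambda>w. act_hyp w H) ` W) ` hyperplanes W"

definition Vreg :: "(complex^'n^'n) set \<Rightarrow> (complex^'n) set" where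
  "Vreg W = UNIV - \<Union>(hyperplanes W)"

definition fixator :: "(complex^'n^'n) set \<Rightarrow> (complex^'n) set \<Rightarrow> (complex^'n^'n) set" where
  "fixator W H = {w \<in> W. \<forall>v\<in>H. w *v v = v}"

definition stabilizer :: "(complex^'n^'n) set \<Rightarrow> (complex^'n) set \<Rightarrow> (complex^'n^'n) set" where
  "stabilizer W H = {w \<in> W. act_hyp w H = H}"

definition e_H :: "(complex^'n^'n) set \<Rightarrow> (complex^'n) set \<Rightarrow> nat" where
  "e_H W H = card (fixator W H)"

definition s_H :: "(complex^'n^'n) set \<Rightarrow> (complex^'n) set \<Rightarrow> complex^'n^'n" where
  "s_H W H = (THE s. s \<in> fixator W H \<and> generate GL {s} = fixator W H \<and>
                det s = exp (2 * \<i> * of_real pi / of_nat (e_H W H)))"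

definition invariant_hermitian_product ::
    "(complex^'n^'n) set \<Rightarrow> (complex^'n \<Rightarrow> complex^'n \<Rightarrow> complex) \<Rightarrow> bool" where
  "invariant_hermitian_product W ip \<longleftrightarrow>
     (\<forall>u v w. ip (u + v) w = ip u w + ip v w) \<and>
     (\<forall>c u v. ip (c *s u) v = c * ip u v) \<and>
     (\<forall>u v. ip v u = cnj (ip u v)) \<and>
     (\<forall>v. v \<noteq> 0 \<longrightarrow> Re (ip v v) > 0) \<and>
     (\<forall>w\<in>W. \<forall>u v. ip (w *v u) (w *v v) = ip u v)"

definition ortho :: "(complex^'n \<Rightarrow> complex^'n \<Rightarrow> complex) \<Rightarrow> (complex^'n) set \<Rightarrow> (complex^'n) set" where
  "ortho ip H = {v. \<forall>u\<in>H. ip v u = 0}"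

definition natural_char ::
    "(complex^'n \<Rightarrow> complex^'n \<Rightarrow> complex) \<Rightarrow> (complex^'n) set \<Rightarrow> complex^'n^'n \<Rightarrow> complex" where
  "natural_char ip H w = (THE z. \<forall>v\<in>ortho ip H. w *v v = z *s v)"

definition exp_rat_mod_int :: "rat set \<Rightarrow> complex" where
  "exp_rat_mod_int x = the_elem ((\<lambda>q. exp (2 * \<i> * of_real pi * of_rat q)) ` x)"

definition natural_char_rat ::
    "(complex^'n^'n) set \<Rightarrow> (complex^'n \<Rightarrow> complex^'n \<Rightarrow> complex) \<Rightarrow> (complex^'n) set
      \<Rightarrow> complex^'n^'n \<Rightarrow> rat set" where
  "natural_char_rat W ip H =
     (\<lambda>w\<in>stabilizer W H.
        inv_into (carrier rat_mod_int) exp_rat_mod_int (natural_char ip H w))"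


section \<open>Braid groups\<close>

definition orbit :: "(complex^'n^'n) set \<Rightarrow> complex^'n \<Rightarrow> (complex^'n) set" where
  "orbit W v = (\<lambda>w. w *v v) ` W"

definition Vreg_mod :: "(complex^'n^'n) set \<Rightarrow> (complex^'n) set topology" where
  "Vreg_mod W =
     topology (\<lambda>U. U \<subseteq> orbit W ` Vreg W \<and>
                   openin (top_of_set (Vreg W)) {v \<in> Vreg W. orbit W v \<in> U})"

lemma openin_Vreg_mod:
  "openin (Vreg_mod W) U \<longleftrightarrow>
     U \<subseteq> orbit W ` Vreg W \<and> openin (top_of_set (Vreg W)) {v \<in> Vreg W. orbit W v \<in> U}"
proof -
  let ?Q = "\<lambda>U. U \<subseteq> orbit W ` Vreg W \<and>
                openin (top_of_set (Vreg W)) {v \<in> Vreg W. orbit W v \<in> U}"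
  have "istopology ?Q"
    unfolding istopology_def
  proof (intro conjI allI impI)
    fix S T assume S: "?Q S" and T: "?Q T"
    show "S \<inter> T \<subseteq> orbit W ` Vreg W" using S by blast
    have "{v \<in> Vreg W. orbit W v \<in> S \<inter> T} =
          {v \<in> Vreg W. orbit W v \<in> S} \<inter> {v \<in> Vreg W. orbit W v \<in> T}" by blast
    then show "openin (top_of_set (Vreg W)) {v \<in> Vreg W. orbit W v \<in> S \<inter> T}"
      using S T by (metis (no_types, lifting) openin_Int)
  next
    fix \<K> assume K: "\<forall>K\<in>\<K>. ?Q K"
    show "\<Union>\<K> \<subseteq> orbit W ` Vreg W" using K by blast
    have "{v \<in> Vreg W. orbit W v \<in> \<Union>\<K>} = (\<Union>K\<in>\<K>. {v \<in> Vreg W. orbit W v \<in> K})" by blast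
    moreover have "openin (top_of_set (Vreg W)) (\<Union>K\<in>\<K>. {v \<in> Vreg W. orbit W v \<in> K})"
      using K by (intro openin_Union) auto
    ultimately show "openin (top_of_set (Vreg W)) {v \<in> Vreg W. orbit W v \<in> \<Union>\<K>}" by simp
  qed
  then show ?thesis by (simp add: Vreg_mod_def topology_inverse')
qed

definition braid_group ::
    "(complex^'n^'n) set \<Rightarrow> complex^'n \<Rightarrow> (real \<Rightarrow> (complex^'n) set) set monoid" where
  "braid_group W x0 = pi1 (Vreg_mod W) (orbit W x0)"

text \<open>The pure braid group is regarded as a subgroup of the braid group.\<close>

definition pure_braids ::
    "(complex^'n^'n) set \<Rightarrow> complex^'n \<Rightarrow> (real \<Rightarrow> (complex^'n) set) set set" where
  "pure_braids W x0 =
     pi1_map (Vreg_mod W) (orbit W) ` carrier (pi1 (top_of_set (Vreg W)) x0)"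

definition braid_proj ::
    "(complex^'n^'n) set \<Rightarrow> complex^'n \<Rightarrow> (real \<Rightarrow> (complex^'n) set) set \<Rightarrow> complex^'n^'n" where
  "braid_proj W x0 b =
     (THE w. w \<in> W \<and> (\<exists>g. path g \<and> path_image g \<subseteq> Vreg W \<and>
                         pathstart g = x0 \<and> pathfinish g = w *v x0 \<and> orbit W \<circ> g \<in> b))"

abbreviation pure_commutators ::
    "(complex^'n^'n) set \<Rightarrow> complex^'n \<Rightarrow> (real \<Rightarrow> (complex^'n) set) set set" where
  "pure_commutators W x0 \<equiv> derived (braid_group W x0) (pure_braids W x0)"

definition braid_ab ::
    "(complex^'n^'n) set \<Rightarrow> complex^'n \<Rightarrow> (real \<Rightarrow> (complex^'n) set) set set monoid" where
  "braid_ab W x0 = braid_group W x0 Mod pure_commutators W x0"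

definition pure_braid_ab ::
    "(complex^'n^'n) set \<Rightarrow> complex^'n \<Rightarrow> (real \<Rightarrow> (complex^'n) set) set set monoid" where
  "pure_braid_ab W x0 =
     (braid_group W x0)\<lparr>carrier := pure_braids W x0\<rparr> Mod pure_commutators W x0"

definition braid_ab_proj ::
    "(complex^'n^'n) set \<Rightarrow> complex^'n \<Rightarrow> (real \<Rightarrow> (complex^'n) set) set set \<Rightarrow> complex^'n^'n" where
  "braid_ab_proj W x0 X = the_elem (braid_proj W x0 ` X)"

text \<open>
  ``Near \<open>H\<close> and far from the other hyperplanes'' is made precise by asking that the closed disc of
  centre \<open>h\<close> through \<open>h + d\<close> in \<open>h + \<complex>d\<close> meets no hyperplane other than \<open>H\<close>.
\<close>

definition monodromy_data ::
    "(complex^'n^'n) set \<Rightarrow> (complex^'n \<Rightarrow> complex^'n \<Rightarrow> complex) \<Rightarrow> complex^'n \<Rightarrow> (complex^'n) set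
      \<Rightarrow> complex^'n \<Rightarrow> complex^'n \<Rightarrow> (real \<Rightarrow> complex^'n) \<Rightarrow> bool" where
  "monodromy_data W ip x0 H h d \<gamma> \<longleftrightarrow>
     h \<in> H \<and> d \<in> ortho ip H - {0} \<and>
     (\<forall>H'\<in>hyperplanes W - {H}. \<forall>z. norm z \<le> 1 \<longrightarrow> h + z *s d \<notin> H') \<and>
     path \<gamma> \<and> path_image \<gamma> \<subseteq> Vreg W \<and> pathstart \<gamma> = x0 \<and> pathfinish \<gamma> = h + d"

definition monodromy_path ::
    "(complex^'n^'n) set \<Rightarrow> (complex^'n) set \<Rightarrow> complex^'n \<Rightarrow> complex^'n \<Rightarrow> (real \<Rightarrow> complex^'n)
      \<Rightarrow> real \<Rightarrow> complex^'n" where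
  "monodromy_path W H h d \<gamma> =
     \<gamma> +++ (\<lambda>t. h + exp (2 * \<i> * of_real pi * of_real t / of_nat (e_H W H)) *s d)
       +++ (\<lambda>t. s_H W H *v reversepath \<gamma> t)"

definition monodromy_generator ::
    "(complex^'n^'n) set \<Rightarrow> (complex^'n) set \<Rightarrow> complex^'n \<Rightarrow> complex^'n \<Rightarrow> (real \<Rightarrow> complex^'n)
      \<Rightarrow> (real \<Rightarrow> (complex^'n) set) set" where
  "monodromy_generator W H h d \<gamma> =
     path_class (Vreg_mod W) (orbit W \<circ> monodromy_path W H h d \<gamma>)"

text \<open>
  The homomorphism from the free abelian group on the hyperplanes to the abelianised pure braid
  group (a subgroup of \<^const>\<open>braid_ab\<close>) that sends each \<open>H\<close> to the class of the \<open>e_H\<close>-th power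
  of the generator of the monodromy around \<open>H\<close>.
\<close>

definition meridian_map ::
    "(complex^'n^'n) set \<Rightarrow> complex^'n \<Rightarrow> ((complex^'n) set \<Rightarrow> complex^'n)
      \<Rightarrow> ((complex^'n) set \<Rightarrow> complex^'n) \<Rightarrow> ((complex^'n) set \<Rightarrow> real \<Rightarrow> complex^'n)
      \<Rightarrow> ((complex^'n) set \<Rightarrow>\<^sub>0 int) \<Rightarrow> (real \<Rightarrow> (complex^'n) set) set set" where
  "meridian_map W x0 h d \<gamma> c =
     finprod (pure_braid_ab W x0)
       (\<lambda>H. (pure_commutators W x0 #>\<^bsub>braid_group W x0\<^esub>
               (monodromy_generator W H (h H) (d H) (\<gamma> H) [^]\<^bsub>braid_group W x0\<^esub> e_H W H))
            [^]\<^bsub>pure_braid_ab W x0\<^esub> Poly_Mapping.lookup c H)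
       (hyperplanes W)"


section \<open>The isomorphism of cohomology groups\<close>

definition perm_act :: "complex^'n^'n \<Rightarrow> ((complex^'n) set \<Rightarrow>\<^sub>0 int) \<Rightarrow> ((complex^'n) set \<Rightarrow>\<^sub>0 int)" where
  "perm_act w = frag_extend (\<lambda>H. frag_of (act_hyp w H))"

definition orbit_projection :: "'h set \<Rightarrow> ('h \<Rightarrow>\<^sub>0 int) \<Rightarrow> ('h \<Rightarrow>\<^sub>0 int)" where
  "orbit_projection C = frag_extend (\<lambda>H. if H \<in> C then frag_of H else 0)"

definition H2_orbit_component ::
    "(complex^'n^'n) set \<Rightarrow> (complex^'n) set set
      \<Rightarrow> ((complex^'n^'n) \<times> (complex^'n^'n) \<Rightarrow> (complex^'n) set \<Rightarrow>\<^sub>0 int) set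
      \<Rightarrow> ((complex^'n^'n) \<times> (complex^'n^'n) \<Rightarrow> (complex^'n) set \<Rightarrow>\<^sub>0 int) set" where
  "H2_orbit_component W C =
     H2_induced (group_of W) (free_Abelian_group C) perm_act
       (\<lambda>\<phi>. \<lambda>x\<in>W \<times> W. orbit_projection C (\<phi> x))"

definition shapiro ::
    "(complex^'n^'n) set \<Rightarrow> (complex^'n) set
      \<Rightarrow> ((complex^'n^'n) \<times> (complex^'n^'n) \<Rightarrow> (complex^'n) set \<Rightarrow>\<^sub>0 int) set
      \<Rightarrow> ((complex^'n^'n) \<times> (complex^'n^'n) \<Rightarrow> int) set" where
  "shapiro W H =
     H2_induced (group_of (stabilizer W H)) integer_group trivial_act
       (\<lambda>\<phi>. \<lambda>x\<in>stabilizer W H \<times> stabilizer W H. Poly_Mapping.lookup (\<phi> x) H)"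

definition cohomology_iso ::
    "(complex^'n^'n) set \<Rightarrow> ((complex^'n) set set \<Rightarrow> (complex^'n) set)
      \<Rightarrow> ((complex^'n^'n) \<times> (complex^'n^'n) \<Rightarrow> (complex^'n) set \<Rightarrow>\<^sub>0 int) set
      \<Rightarrow> (complex^'n) set set \<Rightarrow> complex^'n^'n \<Rightarrow> rat set" where
  "cohomology_iso W HC \<kappa> =
     (\<lambda>C\<in>hyperplane_orbits W.
        inv_into (Hom_gr (group_of (stabilizer W (HC C))) rat_mod_int)
          (connecting_hom (group_of (stabilizer W (HC C))))
          (shapiro W (HC C) (H2_orbit_component W C \<kappa>)))"

end

theory Submission
  imports Defs "HOL-Complex_Analysis.Riemann_Mapping" "HOL-Algebra.Multiplicative_Group"
begin

text \<open>
  Let \<open>\<alpha>\<close> be a linear form with kernel \<open>H\<close>. Since \<open>\<alpha> \<circ> n = r(n) \<alpha>\<close> for \<open>n \<in> N\<^sub>H\<close>, the winding number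
  \<open>\<theta>(b)\<close> around \<open>0\<close> of \<open>\<alpha>\<close> along the lift of a braid \<open>b\<close> is additive on \<open>p\<^sup>-\<^sup>1(N\<^sub>H)\<close>, satisfies
  \<open>exp(2\<pi>i \<theta>(b)) = r(p(b))\<close>, vanishes on \<open>[P,P]\<close>, and on \<open>P/[P,P]\<close> it reads off the coefficient of \<open>H\<close>, because
  it is \<open>1\<close> on the meridian of \<open>H\<close> and \<open>0\<close> on the others. Applied to the equation which defines the cocycle \<open>\<phi>\<close>
  of a section \<open>s\<close>, this says that the \<open>H\<close>-component of \<open>\<phi>\<close> is the coboundary of the rational cochain
  \<open>\<theta> \<circ> s\<close>, which lifts \<open>r\<close>; that \<open>P/[P,P]\<close> is free on the meridians is not needed.

  Unique lifting of braids requires that \<open>W\<close> act freely on the regular points (Steinberg). If \<open>v\<close> is regular,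
  Chevalley's divided difference argument shows that the polynomials vanishing on the orbit of \<open>v\<close> form the
  ideal generated by the invariants vanishing at \<open>v\<close>. Their differentials at \<open>v\<close> are thus fixed by the
  stabilizer of \<open>v\<close>; as these differentials exhaust the dual space, the stabilizer is trivial.
\<close>

section \<open>Linear algebra of reflections\<close>

text \<open>Regularity of the point enters Steinberg's theorem through \<open>discr_Vreg\<close>: in
  the one degree where the skew part of a leading form can be a nonzero constant times
  \<open>discr\<close>, evaluation at the point kills that constant. Polynomials are plain functions
  here, so division, coprimality and leading forms are handled by cancelling linear forms along
  lines and by the predicates \<open>hpoly\<close> and \<open>lowdeg\<close>. Paths are lifted along
  a covering between subsets of normed spaces, which is why the abstract quotient topology is
  compared with a concrete model of the orbit space. A winding number of an open path is a complex
  number; over the stabilizer it is rational because the natural character has finite order. The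
  maps of the statement are built from \<open>the_elem\<close> and \<open>inv_into\<close>. Each is
  therefore shown to be independent of representatives on the class at hand, and the final inverse
  is evaluated by exhibiting the natural character as a preimage under an injective map.\<close>

lemma GL_group: "group (GL :: (complex^'n^'n) monoid)"
proof (rule groupI)
  fix x :: "complex^'n^'n" assume "x \<in> carrier GL"
  then show "\<exists>y\<in>carrier GL. y \<otimes>\<^bsub>GL\<^esub> x = \<one>\<^bsub>GL\<^esub>"
    by (auto simp: GL_def invertible_def)
qed (auto simp: GL_def invertible_mult matrix_mul_assoc invertible_def[of "mat 1"] intro: exI[of _ "mat 1"])

text \<open>By Lagrange the order of \<open>a\<close> divides \<open>card G\<close>.
  Multiplicativity is asked on \<open>G\<close> alone because the natural character is
  multiplicative on a stabilizer and not on all matrices.\<close>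

lemma character_power_card:
  fixes \<theta> :: "complex^'n^'n \<Rightarrow> complex"
  assumes G: "subgroup G GL" "finite G" and a: "a \<in> G"
    and \<theta>: "\<theta> (mat 1) = 1" "\<And>x y. x \<in> G \<Longrightarrow> y \<in> G \<Longrightarrow> \<theta> (x ** y) = \<theta> x * \<theta> y"
  shows "\<theta> a ^ card G = 1"
proof -
  interpret g: group "GL\<lparr>carrier := G\<rparr>" using subgroup.subgroup_is_group[OF G(1) GL_group] .
  have p: "\<theta> (a [^]\<^bsub>GL\<lparr>carrier := G\<rparr>\<^esub> k) = \<theta> a ^ k \<and> a [^]\<^bsub>GL\<lparr>carrier := G\<rparr>\<^esub> k \<in> G" for k :: nat
  proof (induction k)
    case 0 show ?case using g.one_closed by (simp add: \<theta>(1) GL_def g.nat_pow_0)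
  next
    case (Suc k)
    have "a [^]\<^bsub>GL\<lparr>carrier := G\<rparr>\<^esub> Suc k = (a [^]\<^bsub>GL\<lparr>carrier := G\<rparr>\<^esub> k) ** a"
      by (simp add: g.nat_pow_Suc) (simp add: GL_def)
    moreover have "a [^]\<^bsub>GL\<lparr>carrier := G\<rparr>\<^esub> Suc k \<in> G" using g.nat_pow_closed[of a "Suc k"] a by simp
    ultimately show ?case using Suc \<theta>(2) a by simp
  qed
  have "a [^]\<^bsub>GL\<lparr>carrier := G\<rparr>\<^esub> order (GL\<lparr>carrier := G\<rparr>) = mat 1"
    using g.pow_order_eq_1[of a] a by (simp add: GL_def)
  then show ?thesis using p[of "card G"] \<theta>(1) by (simp add: order_def)
qed

text \<open>A change of basis sending a basis vector to \<open>u\<close> turns \<open>w\<close> into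
  a matrix that differs from the identity in one row; its determinant is a diagonal entry.\<close>

lemma det_rank_one_update:
  fixes u :: "complex^'n" and f :: "complex^'n \<Rightarrow> complex"
  assumes f: "\<And>x y. f (x + y) = f x + f y" "\<And>c x. f (c *s x) = c * f x"
    and w: "\<And>x. w *v x = x + (c * f x) *s u"
  shows "det w = 1 + c * f u"
proof (cases "u = 0")
  case True
  then have "w = mat 1" by (intro matrix_eq[THEN iffD2]) (simp add: w)
  moreover have "f 0 = 0" using f(2)[of 0 0] by simp
  ultimately show ?thesis using True by simp
next
  case False
  then obtain k where k: "u $ k \<noteq> 0" by (metis vec_eq_iff zero_index)
  \<comment> \<open>The identity with column \<open>k\<close> replaced by \<open>u\<close>; the
    choice of \<open>k\<close> makes its determinant \<open>u $ k\<close> nonzero.\<close>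
  define P :: "complex^'n^'n" where
    "P = (\<chi> i j. if j = k then (mat 1 *v u)$i else (mat 1 :: complex^'n^'n)$i$j)"
  have detP: "det P = u $ k" unfolding P_def by (subst cramer_lemma) simp
  have col: "(A *v axis j 1) $ i = A $ i $ j" for A :: "complex^'n^'n" and i j
    by (simp add: matrix_vector_mult_def axis_def if_distrib cong: if_cong)
  have Pk: "P *v axis k 1 = u"
    by (simp add: vec_eq_iff col) (simp add: P_def)
  have f0: "f 0 = 0" using f(2)[of 0 0] by simp
  define Q where "Q = matrix (\<lambda>x. x + (c * f (P *v x)) *s axis k 1 :: complex^'n)"
  have linQ: "Vector_Spaces.linear (*s) (*s) (\<lambda>x. x + (c * f (P *v x)) *s axis k 1 :: complex^'n)"
    by unfold_locales
      (simp_all add: f vec.add algebra_simps vector_scalar_commute matrix_vector_right_distrib)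
  have Qx: "Q *v x = x + (c * f (P *v x)) *s axis k 1" for x
    unfolding Q_def using matrix_works[OF linQ] by simp
  have "w ** P = P ** Q"
  proof (intro matrix_eq[THEN iffD2] allI)
    fix x
    show "(w ** P) *v x = (P ** Q) *v x"
      by (simp add: w Qx Pk matrix_vector_right_distrib vector_scalar_commute flip: matrix_vector_mul_assoc)
  qed
  then have "det w * det P = det P * det Q" by (metis det_mul)
  then have wQ: "det w = det Q" using detP k by simp
  define a where "a = (\<chi> j. f (P *v axis j 1))"
  have Qij: "Q $ i $ j = (if i = j then 1 else 0) + (if i = k then c * f (P *v axis j 1) else 0)" for i j
  proof -
    have "Q $ i $ j = (Q *v axis j 1) $ i"
      by (simp add: col)
    also have "\<dots> = (if i = j then 1 else 0) + (if i = k then c * f (P *v axis j 1) else 0)"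
      by (simp add: Qx axis_def)
    finally show ?thesis .
  qed
  \<comment> \<open>Only row \<open>k\<close> of \<open>Q\<close> differs from the identity.
    Transposing makes it a column, the shape evaluated by \<open>cramer_lemma\<close>.\<close>
  have "transpose Q = (\<chi> i j. if j = k then (axis k 1 + c *s a)$i else (mat 1 :: complex^'n^'n)$i$j)"
    by (auto simp: vec_eq_iff transpose_def Qij a_def mat_def axis_def)
  then have "det (transpose Q) = (axis k 1 + c *s a) $ k"
    using cramer_lemma[of k "mat 1 :: complex^'n^'n" "axis k 1 + c *s a"]
    unfolding matrix_vector_mul_lid by simp
  then show ?thesis by (simp add: wQ a_def Pk)
qed

lemma hyperplane_decomp:
  fixes H :: "(complex^'n) set"
  assumes H: "hyperplane H" and x: "x \<notin> H"
  shows "\<exists>h\<in>H. \<exists>c. v = h + c *s x"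
proof -
  have sub: "vec.subspace H" and dim: "vec.dim H + 1 = CARD('n)"
    using H by (auto simp: hyperplane_def)
  have "x \<notin> vec.span H" using x sub by (metis vec.span_eq_iff)
  then have "vec.dim (insert x H) = CARD('n)" using dim by (simp add: vec.dim_insert)
  then have "vec.span (insert x H) = UNIV"
    by (metis vec.dim_eq_full vec.span_UNIV vec_dim_card)
  then have "v \<in> vec.span (insert x H)" by simp
  then obtain c where "v - c *s x \<in> vec.span H" by (auto simp: vec.span_insert)
  then have "v - c *s x \<in> H" using sub by (metis vec.span_eq_iff)
  then show ?thesis by (intro bexI[of _ "v - c *s x"] exI[of _ c]) auto
qed

text \<open>\<open>root\<close> is any choice of nonzero normal vectors; leaving it open lets the
  final proof use the vectors of the monodromy data.\<close>

locale hermitian_reflection_group =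
  fixes W :: "(complex^'n^'n) set" and ip and root :: "(complex^'n) set \<Rightarrow> complex^'n"
  assumes refl: "reflection_group W"
    and herm: "invariant_hermitian_product W ip"
    and root: "\<And>H. H \<in> hyperplanes W \<Longrightarrow> root H \<in> ortho ip H - {0}"
begin

lemma finite_W: "finite W" using refl by (simp add: reflection_group_def)

lemma subgroup_W: "subgroup W GL"
proof -
  obtain S where S: "\<forall>s\<in>S. is_reflection s" "W = generate GL S"
    using refl by (auto simp: reflection_group_def)
  then have "S \<subseteq> carrier GL" by (auto simp: is_reflection_def)
  then show ?thesis using S(2) group.generate_is_subgroup[OF GL_group] by auto
qed

lemma group_W: "group (group_of W)"
  using subgroup.subgroup_is_group[OF subgroup_W GL_group] .

lemma W_one: "mat 1 \<in> W" using subgroup.one_closed[OF subgroup_W] by (simp add: GL_def)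

lemma W_mult: "a \<in> W \<Longrightarrow> b \<in> W \<Longrightarrow> a ** b \<in> W"
  using subgroup.m_closed[OF subgroup_W] by (simp add: GL_def)

lemma W_inverse:
  assumes "a \<in> W" shows "\<exists>b\<in>W. a ** b = mat 1 \<and> b ** a = mat 1"
  using group.l_inv[OF group_W] group.r_inv[OF group_W] group.inv_closed[OF group_W] assms
  by (intro bexI[of _ "inv\<^bsub>group_of W\<^esub> a"]) (auto simp: GL_def)

lemma subgroup_GLI:
  assumes A: "A \<subseteq> W" "mat 1 \<in> A" "\<And>a b. a \<in> A \<Longrightarrow> b \<in> A \<Longrightarrow> a ** b \<in> A"
    and inverse: "\<And>a b. a \<in> A \<Longrightarrow> b \<in> W \<Longrightarrow> a ** b = mat 1 \<Longrightarrow> b ** a = mat 1 \<Longrightarrow> b \<in> A"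
  shows "subgroup A GL"
proof (rule group.subgroupI[OF GL_group])
  show "A \<subseteq> carrier GL" using subgroup.subset[OF subgroup_W] A(1) by blast
  show "A \<noteq> {}" using A(2) by blast
  fix a assume a: "a \<in> A"
  then obtain b where b: "b \<in> W" "a ** b = mat 1" "b ** a = mat 1" using W_inverse A(1) by blast
  have "a \<in> carrier GL" "b \<in> carrier GL" using a b A(1) subgroup.subset[OF subgroup_W] by blast+
  then have "inv\<^bsub>GL\<^esub> a = b" using b group.inv_equality[OF GL_group, of b a] by (auto simp: GL_def)
  then show "inv\<^bsub>GL\<^esub> a \<in> A" using inverse a b by simp
qed (use A(3) in \<open>simp add: GL_def\<close>)

section \<open>Linear forms of the hyperplanes and natural characters\<close>

lemma ip_add: "ip (u + v) w = ip u w + ip v w"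
  and ip_scale: "ip (c *s u) v = c * ip u v"
  and ip_cnj: "ip v u = cnj (ip u v)"
  and ip_pos: "v \<noteq> 0 \<Longrightarrow> Re (ip v v) > 0"
  and ip_inv: "g \<in> W \<Longrightarrow> ip (g *v u) (g *v v) = ip u v"
  using herm unfolding invariant_hermitian_product_def by blast+

lemma ip_self_nonzero: "v \<noteq> 0 \<Longrightarrow> ip v v \<noteq> 0" using ip_pos[of v] by auto

lemma ip_zero: "ip 0 v = 0" using ip_scale[of 0 0 v] by simp

definition form :: "(complex^'n) set \<Rightarrow> complex^'n \<Rightarrow> complex" where
  "form H x = ip x (root H)"

lemma form_add: "form H (x + y) = form H x + form H y"
  and form_scale: "form H (c *s x) = c * form H x"
  and form_zero: "form H 0 = 0"
  by (simp_all add: form_def ip_add ip_scale ip_zero)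

lemma form_uminus: "form H (- x) = - form H x"
  using form_scale[of H "-1" x] by simp

lemma form_diff: "form H (x - y) = form H x - form H y"
  using form_add[of H x "- y"] by (simp add: form_uminus)

lemma hyperplanesD: "H \<in> hyperplanes W \<Longrightarrow> hyperplane H" by (simp add: hyperplanes_def)

lemma form_root: "H \<in> hyperplanes W \<Longrightarrow> form H (root H) \<noteq> 0"
  using root ip_self_nonzero by (auto simp: form_def)

lemma form_on: "H \<in> hyperplanes W \<Longrightarrow> x \<in> H \<Longrightarrow> form H x = 0"
  using root[of H] ip_cnj[of x "root H"] by (auto simp: form_def ortho_def)

lemma root_notin: "H \<in> hyperplanes W \<Longrightarrow> root H \<notin> H"
  using form_on form_root by blast

lemma decomp:
  assumes "H \<in> hyperplanes W" obtains h c where "h \<in> H" "x = h + c *s root H"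
  using hyperplane_decomp[OF hyperplanesD[OF assms] root_notin[OF assms]] by blast

lemma form_iff:
  assumes "H \<in> hyperplanes W" shows "x \<in> H \<longleftrightarrow> form H x = 0"
proof
  assume "form H x = 0"
  obtain h c where hc: "h \<in> H" "x = h + c *s root H" using decomp[OF assms] .
  then have "c = 0" using \<open>form H x = 0\<close> form_on[OF assms hc(1)] form_root[OF assms]
    by (simp add: form_add form_scale)
  then show "x \<in> H" using hc by simp
qed (rule form_on[OF assms])

lemma decomp_form:
  assumes "H \<in> hyperplanes W" shows "x - (form H x / form H (root H)) *s root H \<in> H"
  using form_root[OF assms] by (simp add: form_iff[OF assms] form_diff form_scale)

text \<open>Both \<open>v\<close> and the root are orthogonal to the component of \<open>v\<close>
  in \<open>H\<close>, so this component is orthogonal to itself and vanishes by positivity.\<close>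

lemma ortho_multiple:
  assumes H: "H \<in> hyperplanes W" and v: "v \<in> ortho ip H"
  shows "\<exists>c. v = c *s root H"
proof -
  obtain h c where hc: "h \<in> H" "v = h + c *s root H" using decomp[OF H] .
  have "ip v h = 0" "ip (root H) h = 0" using v root[OF H] hc(1) by (auto simp: ortho_def)
  then have "ip h h = 0" using hc(2) by (simp add: ip_add ip_scale)
  then have "h = 0" using ip_self_nonzero by blast
  then show ?thesis using hc by auto
qed

text \<open>Invariance of \<open>ip\<close> makes the normal line of \<open>H\<close> stable under
  \<open>w\<close>; as the root spans this line, the description in \<open>natural_char\<close> has
  exactly one candidate.\<close>

lemma natural_char_root:
  assumes H: "H \<in> hyperplanes W" and w: "w \<in> stabilizer W H"
  shows "w *v root H = natural_char ip H w *s root H"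
proof -
  have wW: "w \<in> W" and wH: "(*v) w ` H = H" using w by (auto simp: stabilizer_def act_hyp_def)
  have sc: "w *v (c *s v) = c *s (w *v v)" for c v by (simp add: vector_scalar_commute)
  have "w *v root H \<in> ortho ip H"
    unfolding ortho_def
  proof (intro CollectI ballI)
    fix u assume "u \<in> H"
    then obtain u' where "u' \<in> H" "u = w *v u'" using wH by blast
    then show "ip (w *v root H) u = 0" using root[OF H] ip_inv[OF wW] by (auto simp: ortho_def)
  qed
  then obtain z where z: "w *v root H = z *s root H" using ortho_multiple[OF H] by blast
  have "natural_char ip H w = z"
    unfolding natural_char_def
  proof (rule the_equality)
    show "\<forall>v\<in>ortho ip H. w *v v = z *s v"
      using ortho_multiple[OF H] by (metis sc z vector_smult_assoc mult.commute)
  next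
    fix z' assume "\<forall>v\<in>ortho ip H. w *v v = z' *s v"
    then have "z' *s root H = z *s root H" using root[OF H] z by auto
    then show "z' = z" using root[OF H] by (auto simp: vector_mul_rcancel)
  qed
  then show ?thesis using z by simp
qed

lemma form_char:
  assumes H: "H \<in> hyperplanes W" and w: "w \<in> stabilizer W H"
  shows "form H (w *v x) = natural_char ip H w * form H x"
proof -
  obtain h c where hc: "h \<in> H" "x = h + c *s root H" using decomp[OF H] .
  have "w *v h \<in> H" using w hc(1) by (auto simp: stabilizer_def act_hyp_def)
  then show ?thesis using hc form_on[OF H]
    by (simp add: vec.add form_add form_scale natural_char_root[OF H w] vector_scalar_commute matrix_vector_right_distrib)
qed

lemma act_hyp_mult: "act_hyp (a ** b) H = act_hyp a (act_hyp b H)"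
  by (simp add: act_hyp_def image_image matrix_vector_mul_assoc)

lemma act_hyp_one: "act_hyp (mat 1) H = H" by (simp add: act_hyp_def)

lemma stabilizer_one: "mat 1 \<in> stabilizer W H"
  by (simp add: stabilizer_def W_one act_hyp_one)

lemma stabilizer_mult: "a \<in> stabilizer W H \<Longrightarrow> b \<in> stabilizer W H \<Longrightarrow> a ** b \<in> stabilizer W H"
  by (simp add: stabilizer_def W_mult act_hyp_mult)

lemma stabilizer_subgroup: "subgroup (stabilizer W H) GL"
proof (rule subgroup_GLI)
  fix a b assume "a \<in> stabilizer W H" "b \<in> W" "b ** a = mat 1"
  then show "b \<in> stabilizer W H" unfolding stabilizer_def
    by (metis (mono_tags, lifting) act_hyp_mult act_hyp_one mem_Collect_eq)
qed (use stabilizer_one stabilizer_mult in \<open>auto simp: stabilizer_def\<close>)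

lemma natural_char_mult:
  assumes H: "H \<in> hyperplanes W" and "a \<in> stabilizer W H" "b \<in> stabilizer W H"
  shows "natural_char ip H (a ** b) = natural_char ip H a * natural_char ip H b"
  using form_char[OF H stabilizer_mult[OF assms(2,3)], of "root H"] form_char[OF H assms(2), of "b *v root H"]
    form_char[OF H assms(3), of "root H"] form_root[OF H] by (simp add: matrix_vector_mul_assoc)

lemma natural_char_one: "H \<in> hyperplanes W \<Longrightarrow> natural_char ip H (mat 1) = 1"
  using form_char[OF _ stabilizer_one, of H "root H"] form_root[of H] by simp

lemma natural_char_root_of_unity:
  assumes H: "H \<in> hyperplanes W" and "w \<in> stabilizer W H"
  shows "natural_char ip H w ^ card (stabilizer W H) = 1"
proof (rule character_power_card[OF stabilizer_subgroup _ assms(2)])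
  show "finite (stabilizer W H)" using finite_W by (simp add: stabilizer_def)
qed (use natural_char_one[OF H] natural_char_mult[OF H] in auto)

lemma natural_char_nonzero:
  assumes "H \<in> hyperplanes W" "w \<in> stabilizer W H" shows "natural_char ip H w \<noteq> 0"
proof
  assume "natural_char ip H w = 0"
  moreover have "card (stabilizer W H) > 0"
    using finite_W stabilizer_one by (auto simp: stabilizer_def card_gt_0_iff)
  ultimately show False using natural_char_root_of_unity[OF assms] by (simp add: power_0_left)
qed


section \<open>Fixators of hyperplanes and the distinguished generator\<close>

lemma fixator_stabilizer: "s \<in> fixator W H \<Longrightarrow> s \<in> stabilizer W H"
  by (force simp: fixator_def stabilizer_def act_hyp_def image_def)

text \<open>Subtracting the multiple of the root that moves \<open>x\<close> into \<open>H\<close>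
  leaves a vector fixed by \<open>s\<close>. The resulting formula involves \<open>s\<close> only
  through its character, so the determinant will separate the elements of a fixator.\<close>

lemma fixator_apply:
  assumes H: "H \<in> hyperplanes W" and s: "s \<in> fixator W H"
  shows "s *v x = x + ((natural_char ip H s - 1) / form H (root H) * form H x) *s root H"
proof -
  define c where "c = form H x / form H (root H)"
  have "x - c *s root H \<in> H" using decomp_form[OF H] by (simp add: c_def)
  then have "s *v (x - c *s root H) = x - c *s root H" using s by (simp add: fixator_def)
  then have "s *v x - c *s (natural_char ip H s *s root H) = x - c *s root H"
    by (simp add: matrix_vector_mult_diff_distrib vector_scalar_commute
        natural_char_root[OF H fixator_stabilizer[OF s]])
  then have "s *v x = x + (c * natural_char ip H s - c) *s root H"
    by (simp add: vector_sub_rdistrib vector_smult_assoc algebra_simps)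
  moreover have "c * natural_char ip H s - c = (natural_char ip H s - 1) / form H (root H) * form H x"
    by (simp add: c_def diff_divide_distrib left_diff_distrib)
  ultimately show ?thesis by simp
qed

lemma det_fixator:
  assumes H: "H \<in> hyperplanes W" and s: "s \<in> fixator W H"
  shows "det s = natural_char ip H s"
proof -
  have "det s = 1 + (natural_char ip H s - 1) / form H (root H) * form H (root H)"
    by (rule det_rank_one_update[OF form_add form_scale fixator_apply[OF H s]])
  then show ?thesis using form_root[OF H] by simp
qed

lemma fixator_eqI:
  assumes H: "H \<in> hyperplanes W" and s: "s \<in> fixator W H" and t: "t \<in> fixator W H"
    and "det s = det t"
  shows "s = t"
  using assms by (intro matrix_eq[THEN iffD2] allI) (simp add: fixator_apply[OF H] det_fixator[OF H])

lemma fixator_subset: "fixator W H \<subseteq> W" by (auto simp: fixator_def)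

lemma fixator_one: "mat 1 \<in> fixator W H" by (simp add: fixator_def W_one)

lemma fixator_subgroup: "subgroup (fixator W H) GL"
proof (rule subgroup_GLI)
  fix a b assume "a \<in> fixator W H" "b \<in> W" "b ** a = mat 1"
  then show "b \<in> fixator W H" unfolding fixator_def
    by simp (metis matrix_vector_mul_assoc matrix_vector_mul_lid)
qed (auto simp: fixator_def W_one W_mult simp flip: matrix_vector_mul_assoc)

lemma finite_fixator: "finite (fixator W H)" using finite_W fixator_subset finite_subset by blast

lemma e_H_pos: "e_H W H > 0"
  using finite_fixator fixator_one by (auto simp: e_H_def card_gt_0_iff)

lemma det_fixator_power: "s \<in> fixator W H \<Longrightarrow> det s ^ e_H W H = 1"
  unfolding e_H_def by (rule character_power_card[OF fixator_subgroup finite_fixator]) (simp_all add: det_mul)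

text \<open>The determinant is injective on the fixator, and its values lie in a set of the same
  size; hence all roots of unity occur.\<close>

lemma det_fixator_image:
  assumes H: "H \<in> hyperplanes W" shows "det ` fixator W H = {z. z ^ e_H W H = 1}"
proof (rule card_subset_eq)
  show "finite {z::complex. z ^ e_H W H = 1}" using e_H_pos[of H] by (intro finite_roots_unity) simp
  show "det ` fixator W H \<subseteq> {z. z ^ e_H W H = 1}" using det_fixator_power by auto
  have "card (det ` fixator W H) = e_H W H"
    unfolding e_H_def using fixator_eqI[OF H] by (intro card_image inj_onI) auto
  then show "card (det ` fixator W H) = card {z::complex. z ^ e_H W H = 1}"
    using e_H_pos by (simp add: card_roots_unity_eq)
qed

lemma W_power_one: "a \<in> W \<Longrightarrow> a [^]\<^bsub>GL\<^esub> card W = mat 1"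
  using group.pow_order_eq_1[OF group_W, of a] monoid.nat_pow_consistent[OF group.is_monoid[OF GL_group], of a "card W" W]
  by (simp add: GL_def order_def)

lemma is_reflectionI:
  assumes "s \<in> W" "s \<noteq> mat 1" "hyperplane H" "\<And>v. v \<in> H \<Longrightarrow> s *v v = v"
  shows "is_reflection s"
  unfolding is_reflection_def
  using assms W_power_one[of s] subgroup.subset[OF subgroup_W] finite_W W_one
  by (auto intro!: exI[of _ "card W"] simp: card_gt_0_iff)

lemma reflection_fixator:
  assumes "is_reflection s" "s \<in> W" shows "\<exists>H\<in>hyperplanes W. s \<in> fixator W H"
  using assms unfolding is_reflection_def hyperplanes_def fixator_def by blast

lemma nontrivial_fixator:
  assumes "H \<in> hyperplanes W" obtains s where "s \<in> fixator W H" "s \<noteq> mat 1"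
  using assms unfolding hyperplanes_def fixator_def is_reflection_def by blast

lemma fixed_space:
  assumes H: "H \<in> hyperplanes W" and s: "s \<in> fixator W H" "s \<noteq> mat 1"
  shows "{x. s *v x = x} = H"
proof -
  have "natural_char ip H s \<noteq> 1"
    using fixator_eqI[OF H s(1) fixator_one] s(2) det_fixator[OF H s(1)] by auto
  then show ?thesis using root[OF H] form_root[OF H]
    by (auto simp: fixator_apply[OF H s(1)] form_iff[OF H] vec_eq_iff)
qed

text \<open>A nontrivial element of a fixator determines the hyperplane as its space of fixed
  points, so \<open>W\<close> bounds the number of hyperplanes.\<close>

lemma finite_hyperplanes: "finite (hyperplanes W)"
proof (rule finite_subset)
  show "hyperplanes W \<subseteq> (\<lambda>s. {x. s *v x = x}) ` W"
  proof
    fix H assume H: "H \<in> hyperplanes W"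
    obtain s where "s \<in> fixator W H" "s \<noteq> mat 1" using nontrivial_fixator[OF H] .
    then show "H \<in> (\<lambda>s. {x. s *v x = x}) ` W"
      using fixed_space[OF H] fixator_subset by (intro image_eqI[of _ _ s]) auto
  qed
qed (simp add: finite_W)

text \<open>The powers of the element of determinant \<open>exp (2\<pi>i/e)\<close> realise all \<open>e\<close>-th roots of unity.\<close>

lemma s_H_props:
  assumes H: "H \<in> hyperplanes W"
  shows "s_H W H \<in> fixator W H" "det (s_H W H) = exp (2 * \<i> * of_real pi / of_nat (e_H W H))"
proof -
  define e where "e = e_H W H"
  define z where "z = exp (2 * \<i> * of_real pi / of_nat e)"
  have e: "e > 0" using e_H_pos by (simp add: e_def)
  have "z ^ e = exp (of_nat e * (2 * \<i> * of_real pi / of_nat e))"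
    unfolding z_def by (rule exp_of_nat_mult[symmetric])
  also have "\<dots> = 1" using e exp_two_pi_i by (simp add: mult.commute mult.left_commute)
  finally have "z \<in> det ` fixator W H" using det_fixator_image[OF H] by (simp add: e_def)
  then obtain s where s: "s \<in> fixator W H" "det s = z" by auto
  have gen: "generate GL {s} = fixator W H"
  proof
    show "generate GL {s} \<subseteq> fixator W H"
      using group.generate_subgroup_incl[OF GL_group _ fixator_subgroup] s(1) by auto
    have pw: "\<exists>p\<in>generate GL {s}. det p = z ^ k" for k :: nat
    proof (induction k)
      case 0 show ?case by (rule bexI[OF _ generate.one]) (simp add: GL_def)
    next
      case (Suc k)
      then obtain p where "p \<in> generate GL {s}" "det p = z ^ k" by blast
      then show ?case using generate.eng[OF generate.incl[of s "{s}" GL], of p] s(2)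
        by (intro bexI[of _ "s \<otimes>\<^bsub>GL\<^esub> p"]) (auto simp: GL_def det_mul)
    qed
    show "fixator W H \<subseteq> generate GL {s}"
    proof
      fix t assume t: "t \<in> fixator W H"
      then have "det t ^ e = 1" by (simp add: e_def det_fixator_power)
      then obtain k where k: "det t = exp (2 * of_real pi * \<i> * of_nat k / of_nat e)"
        using complex_roots_unity[of e] e by fastforce
      have "det t = z ^ k" unfolding k z_def exp_of_nat_mult[symmetric]
        by (rule arg_cong[of _ _ exp]) (simp add: mult_ac)
      then obtain p where p: "p \<in> generate GL {s}" "det p = det t" using pw[of k] by auto
      then have "p \<in> fixator W H" using \<open>generate GL {s} \<subseteq> fixator W H\<close> by blast
      then have "p = t" using fixator_eqI[OF H _ t] p by blast
      then show "t \<in> generate GL {s}" using p by simp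
    qed
  qed
  have "s_H W H \<in> fixator W H \<and> generate GL {s_H W H} = fixator W H \<and> det (s_H W H) = z"
    unfolding s_H_def z_def e_def
  proof (rule theI)
    show "s \<in> fixator W H \<and> generate GL {s} = fixator W H \<and>
        det s = exp (2 * \<i> * of_real pi / of_nat (e_H W H))"
      using s gen by (simp add: z_def e_def)
  qed (use fixator_eqI[OF H] s in \<open>auto simp: z_def e_def\<close>)
  then show "s_H W H \<in> fixator W H" "det (s_H W H) = exp (2 * \<i> * of_real pi / of_nat (e_H W H))"
    by (simp_all add: z_def e_def)
qed

text \<open>Taking whole fixators as the base case absorbs the inverses of the generating
  reflections.\<close>

lemma W_induct [consumes 1, case_names one mult reflection]:
  assumes "w \<in> W" "P (mat 1)" "\<And>a b. a \<in> W \<Longrightarrow> b \<in> W \<Longrightarrow> P a \<Longrightarrow> P b \<Longrightarrow> P (a ** b)"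
    "\<And>H s. H \<in> hyperplanes W \<Longrightarrow> s \<in> fixator W H \<Longrightarrow> P s"
  shows "P w"
proof -
  obtain S where S: "\<forall>s\<in>S. is_reflection s" "W = generate GL S"
    using refl by (auto simp: reflection_group_def)
  have ref: "\<exists>H\<in>hyperplanes W. s \<in> fixator W H" if "s \<in> S" for s
    using S that by (intro reflection_fixator) (auto intro: generate.incl)
  have "w \<in> generate GL S" using assms(1) S by simp
  then show ?thesis
  proof induction
    case one show ?case using assms(2) by (simp add: GL_def)
  next
    case (incl s) then show ?case using ref assms(4) by blast
  next
    case (inv s)
    then obtain H where "H \<in> hyperplanes W" "s \<in> fixator W H" using ref by blast
    then show ?case using assms(4) subgroup.m_inv_closed[OF fixator_subgroup] by blast
  next
    case (eng a b) then show ?case using assms(3) S(2) by (simp add: GL_def)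
  qed
qed

text \<open>Conjugation by \<open>w\<close> turns a reflection along \<open>H\<close> into one along
  its image.\<close>

lemma act_hyp_hyperplanes:
  assumes w: "w \<in> W" and H: "H \<in> hyperplanes W" shows "act_hyp w H \<in> hyperplanes W"
proof -
  obtain v where v: "v \<in> W" "w ** v = mat 1" "v ** w = mat 1" using W_inverse[OF w] by blast
  have inj: "inj ((*v) w)" using v(3) by (metis injI matrix_vector_mul_assoc matrix_vector_mul_lid)
  have sub: "vec.subspace H" and dim: "vec.dim H + 1 = CARD('n)"
    using hyperplanesD[OF H] by (auto simp: hyperplane_def)
  have hyp: "hyperplane (act_hyp w H)"
    unfolding hyperplane_def act_hyp_def
    using sub dim inj by (simp add: vec.subspace_image vec.dim_image_eq inj_on_subset)
  obtain s where s: "s \<in> fixator W H" "s \<noteq> mat 1" using nontrivial_fixator[OF H] .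
  define t where "t = w ** s ** v"
  have tW: "t \<in> W" using w v s fixator_subset by (auto simp: t_def intro!: W_mult)
  have "t \<noteq> mat 1"
  proof
    assume "t = mat 1"
    then have "v ** t ** w = mat 1" using v by simp
    then have "(v ** w) ** s ** (v ** w) = mat 1" by (simp add: t_def matrix_mul_assoc)
    then show False using v s by simp
  qed
  moreover have fixes_x: "t *v x = x" if x: "x \<in> act_hyp w H" for x
  proof -
    obtain y where y: "y \<in> H" "x = w *v y" using x by (auto simp: act_hyp_def)
    have "t *v x = w *v (s *v ((v ** w) *v y))" by (simp add: t_def y matrix_vector_mul_assoc matrix_mul_assoc)
    then show ?thesis using v y s by (simp add: fixator_def)
  qed
  ultimately have "is_reflection t" using is_reflectionI[OF tW _ hyp] by blast
  then show ?thesis using tW fixes_x hyp by (auto simp: hyperplanes_def)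
qed

lemma Vreg_invariant: assumes "w \<in> W" "x \<in> Vreg W" shows "w *v x \<in> Vreg W"
proof (rule ccontr)
  assume "w *v x \<notin> Vreg W"
  then obtain H where H: "H \<in> hyperplanes W" "w *v x \<in> H" by (auto simp: Vreg_def)
  obtain v where v: "v \<in> W" "v ** w = mat 1" using W_inverse[OF assms(1)] by blast
  have "v *v (w *v x) \<in> act_hyp v H" using H by (auto simp: act_hyp_def)
  then have "x \<in> act_hyp v H" using v by (simp add: matrix_vector_mul_assoc)
  then show False using act_hyp_hyperplanes[OF v(1) H(1)] assms by (auto simp: Vreg_def)
qed

lemma form_Vreg: "H \<in> hyperplanes W \<Longrightarrow> x \<in> Vreg W \<Longrightarrow> form H x \<noteq> 0"
  using form_iff by (auto simp: Vreg_def)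

lemma Vreg_iff: "x \<in> Vreg W \<longleftrightarrow> (\<forall>H\<in>hyperplanes W. form H x \<noteq> 0)"
  using form_iff by (auto simp: Vreg_def)

lemma orbit_eq_iff: "orbit W x = orbit W y \<longleftrightarrow> (\<exists>w\<in>W. y = w *v x)"
proof
  assume "orbit W x = orbit W y"
  moreover have "y \<in> orbit W y" using W_one by (force simp: orbit_def)
  ultimately show "\<exists>w\<in>W. y = w *v x" by (auto simp: orbit_def)
next
  assume "\<exists>w\<in>W. y = w *v x"
  then obtain w where w: "w \<in> W" "y = w *v x" by blast
  obtain v where v: "v \<in> W" "v ** w = mat 1" using W_inverse[OF w(1)] by blast
  have "u *v x \<in> (\<lambda>w. w *v y) ` W" if "u \<in> W" for u
    using w v that W_mult by (intro image_eqI[of _ _ "u ** v"])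
      (simp_all add: matrix_vector_mul_assoc flip: matrix_mul_assoc)
  moreover have "u *v y \<in> (\<lambda>w. w *v x) ` W" if "u \<in> W" for u
    using w that W_mult by (intro image_eqI[of _ _ "u ** w"]) (simp_all add: matrix_vector_mul_assoc)
  ultimately show "orbit W x = orbit W y" unfolding orbit_def by blast
qed

end

section \<open>Homogeneous polynomial functions\<close>

text \<open>Degrees are integers, so that quotients need no case distinction: in negative degree only \<open>0\<close> is
  homogeneous.\<close>

inductive hpoly :: "int \<Rightarrow> (complex^'n \<Rightarrow> complex) \<Rightarrow> bool" where
  const: "hpoly 0 (\<lambda>x. c)"
| coord: "hpoly k f \<Longrightarrow> hpoly (k + 1) (\<lambda>x. x $ i * f x)"
| zero: "hpoly k (\<lambda>x. 0)"
| add: "hpoly k f \<Longrightarrow> hpoly k g \<Longrightarrow> hpoly k (\<lambda>x. f x + g x)"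

lemma hpoly_mult:
  assumes "hpoly j f" "hpoly k g" shows "hpoly (j + k) (\<lambda>x. f x * g x)"
  using assms(1)
proof induction
  case (const c)
  show ?case using assms(2)
  proof induction
    case (coord k f i)
    have "hpoly (0 + k + 1) (\<lambda>x. x $ i * (c * f x))" using coord by (intro hpoly.coord) simp
    then show ?case by (simp add: algebra_simps)
  next
    case (add k f g)
    then have "hpoly (0 + k) (\<lambda>x. c * f x + c * g x)" by (intro hpoly.add) simp_all
    then show ?case by (simp add: algebra_simps)
  qed (use hpoly.const hpoly.zero in auto)
next
  case (coord j f i)
  have "hpoly (j + k + 1) (\<lambda>x. x $ i * (f x * g x))" using coord by (intro hpoly.coord) simp
  then show ?case by (simp add: algebra_simps)
next
  case zero show ?case by (simp add: hpoly.zero)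
next
  case (add j f h)
  then have "hpoly (j + k) (\<lambda>x. f x * g x + h x * g x)" by (intro hpoly.add) simp_all
  then show ?case by (simp add: algebra_simps)
qed

lemma hpoly_scale: "hpoly k f \<Longrightarrow> hpoly k (\<lambda>x. c * f x)"
  using hpoly_mult[OF hpoly.const[of c]] by simp

lemma hpoly_diff: "hpoly k f \<Longrightarrow> hpoly k g \<Longrightarrow> hpoly k (\<lambda>x. f x - g x)"
  using hpoly.add[of k f "\<lambda>x. -1 * g x"] hpoly_scale[of k g "-1"] by simp

lemma hpoly_sum: "(\<And>i. i \<in> A \<Longrightarrow> hpoly k (f i)) \<Longrightarrow> hpoly k (\<lambda>x. \<Sum>i\<in>A. f i x)"
  by (induction A rule: infinite_finite_induct) (simp_all add: hpoly.zero hpoly.add)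

lemma hpoly_power: "hpoly k f \<Longrightarrow> hpoly (int m * k) (\<lambda>x. f x ^ m)"
proof (induction m)
  case (Suc m)
  then have "hpoly (k + int m * k) (\<lambda>x. f x * f x ^ m)" by (intro hpoly_mult) simp_all
  then show ?case by (simp add: algebra_simps)
qed (use hpoly.const[of 1] in simp)

lemma hpoly_prod: "finite A \<Longrightarrow> (\<And>i. i \<in> A \<Longrightarrow> hpoly (k i) (f i)) \<Longrightarrow> hpoly (sum k A) (\<lambda>x. \<Prod>i\<in>A. f i x)"
  by (induction A rule: finite_induct) (simp_all add: hpoly_mult hpoly.const[of 1])

lemma hpoly_coord: "hpoly 1 (\<lambda>x. x $ i)"
  using hpoly.coord[OF hpoly.const[of 1], of i] by simp

lemma hpoly_linear:
  fixes f :: "complex^'n \<Rightarrow> complex"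
  assumes "\<And>x y. f (x + y) = f x + f y" "\<And>c x. f (c *s x) = c * f x"
  shows "hpoly 1 f"
proof -
  have f0: "f 0 = 0" using assms(2)[of 0 0] by simp
  have "f (\<Sum>i\<in>A. x $ i *s axis i 1) = (\<Sum>i\<in>A. x $ i * f (axis i 1))" if "finite A" for x and A :: "'n set"
    using that by induction (simp_all add: f0 assms)
  then have "f x = (\<Sum>i\<in>UNIV. f (axis i 1) * x $ i)" for x
    using basis_expansion[of x] by (metis (no_types, lifting) finite_class.finite_UNIV mult.commute sum.cong)
  then have f_eq: "f = (\<lambda>x. \<Sum>i\<in>UNIV. f (axis i 1) * x $ i)" by blast
  have "hpoly 1 (\<lambda>x. \<Sum>i\<in>UNIV. f (axis i 1) * x $ i)"
    by (intro hpoly_sum hpoly_scale hpoly_coord)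
  then show ?thesis by (subst f_eq)
qed

lemma hpoly_compose:
  assumes "hpoly k f" "\<And>i. hpoly 1 (\<lambda>x. T x $ i)" shows "hpoly k (\<lambda>x. f (T x))"
  using assms(1)
proof induction
  case (coord k f i)
  then show ?case using hpoly_mult[OF assms(2)[of i] coord.IH] by (simp add: add.commute)
qed (simp_all add: hpoly.const hpoly.zero hpoly.add)

lemma hpoly_matrix: "hpoly k f \<Longrightarrow> hpoly k (\<lambda>x. f (w *v x))"
  by (erule hpoly_compose)
    (auto simp: matrix_vector_mult_def intro!: hpoly_sum hpoly_scale hpoly_coord)

lemma hpoly_negative: "hpoly k f \<Longrightarrow> k < 0 \<Longrightarrow> f x = 0"
  by (induction rule: hpoly.induct) auto

lemma hpoly_degree_0: assumes "hpoly 0 f" shows "\<exists>c. \<forall>x. f x = c"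
proof -
  have "hpoly k f \<Longrightarrow> k = 0 \<Longrightarrow> \<exists>c. \<forall>x. f x = c" for k
    by (induction rule: hpoly.induct) (use hpoly_negative in fastforce)+
  then show ?thesis using assms by blast
qed

lemma hpoly_differentiable: "hpoly k f \<Longrightarrow> (\<lambda>t. f (x + t *s y)) field_differentiable (at t)"
proof (induction rule: hpoly.induct)
  case (coord k f i)
  have "(\<lambda>t. (x + t *s y) $ i) field_differentiable (at t)"
    by (auto intro!: derivative_intros)
  then show ?case using coord by (intro field_differentiable_mult)
qed (auto intro: field_differentiable_add)

lemma hpoly_isCont: "hpoly k f \<Longrightarrow> isCont (\<lambda>t. f (x + t *s y)) t"
  by (rule field_differentiable_imp_continuous_at[OF hpoly_differentiable])

text \<open>On the line \<open>x + t v\<close> the factor \<open>\<beta>\<close> has at most one zero, so \<open>q\<close> vanishes by continuity.\<close>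

lemma line_cancel:
  fixes q \<beta> :: "complex^'n \<Rightarrow> complex"
  assumes q: "isCont (\<lambda>t. q (x + t *s v)) 0" and b: "\<And>x y. \<beta> (x + y) = \<beta> x + \<beta> y" "\<And>c x. \<beta> (c *s x) = c * \<beta> x"
    and v: "\<beta> v \<noteq> 0" and z: "\<And>t. \<beta> (x + t *s v) * q (x + t *s v) = 0"
  shows "q x = 0"
proof -
  have "(\<lambda>t. q (x + t *s v)) \<midarrow>0\<rightarrow> q (x + 0 *s v)"
    using q by (simp only: isCont_def)
  moreover have "\<forall>\<^sub>F t in at 0. q (x + t *s v) = 0"
  proof -
    have *: "q (x + t *s v) = 0" if "t \<noteq> - \<beta> x / \<beta> v" for t
    proof -
      have "\<beta> (x + t *s v) \<noteq> 0" using that v by (auto simp: b field_simps eq_neg_iff_add_eq_0)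
      then show ?thesis using z[of t] by simp
    qed
    show ?thesis
    proof (cases "\<beta> x = 0")
      case True then show ?thesis using * by (auto simp: eventually_at_filter)
    next
      case False
      then have "0 \<noteq> - \<beta> x / \<beta> v" using v by simp
      then have "\<forall>\<^sub>F t in nhds 0. t \<noteq> - \<beta> x / \<beta> v" by (rule t1_space_nhds)
      then show ?thesis using * by (auto simp: eventually_at_filter elim: eventually_mono)
    qed
  qed
  ultimately have "((\<lambda>t::complex. 0) \<longlongrightarrow> q (x + 0 *s v)) (at 0)"
    by (rule Lim_transform_eventually)
  then have "0 = q (x + 0 *s v)" by (rule LIM_const_eq)
  then show ?thesis by simp
qed

text \<open>Stands in for the absence of zero divisors in a polynomial ring. \<open>S\<close> will
  be the whole space or a hyperplane; the factors, linear forms not identically zero on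
  \<open>S\<close>, are removed one at a time.\<close>

lemma line_cancel_prod:
  fixes \<beta> :: "'i \<Rightarrow> complex^'n \<Rightarrow> complex"
  assumes "finite A"
    and S: "\<And>x y t. x \<in> S \<Longrightarrow> y \<in> S \<Longrightarrow> x + t *s y \<in> S"
    and b: "\<And>i x y. \<beta> i (x + y) = \<beta> i x + \<beta> i y" "\<And>i c x. \<beta> i (c *s x) = c * \<beta> i x"
    and v: "\<And>i. i \<in> A \<Longrightarrow> \<exists>v\<in>S. \<beta> i v \<noteq> 0"
    and q: "hpoly k q" and z: "\<And>x. x \<in> S \<Longrightarrow> (\<Prod>i\<in>A. \<beta> i x ^ m i) * q x = 0" and x: "x \<in> S"
  shows "q x = 0"
proof -
  have lin: "hpoly 1 (\<beta> i)" for i by (rule hpoly_linear) (simp_all add: b)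
  have *: "\<forall>x\<in>S. r x = 0" if "i \<in> A" "hpoly j r" "\<forall>x\<in>S. \<beta> i x ^ n * r x = 0" for i j r n
    using that(2,3)
  proof (induction n arbitrary: j r)
    case (Suc n)
    have "\<forall>x\<in>S. \<beta> i x * r x = 0"
      using Suc.prems(2) by (intro Suc.IH[OF hpoly_mult[OF lin Suc.prems(1)]]) (simp add: mult_ac)
    then show ?case using v[OF that(1)] S by (auto intro!: line_cancel[OF hpoly_isCont[OF Suc.prems(1)] b])
  qed simp
  have "\<forall>x\<in>S. q x = 0"
    if "finite B" "B \<subseteq> A" "hpoly k q" "\<forall>x\<in>S. (\<Prod>i\<in>B. \<beta> i x ^ m i) * q x = 0" for B k q
    using that
  proof (induction B arbitrary: k q)
    case (insert i B)
    have "hpoly (int (m i) * 1 + k) (\<lambda>x. \<beta> i x ^ m i * q x)"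
      by (rule hpoly_mult[OF hpoly_power[OF lin] insert.prems(2)])
    moreover have "\<forall>x\<in>S. (\<Prod>i\<in>B. \<beta> i x ^ m i) * (\<beta> i x ^ m i * q x) = 0"
      using insert.prems(3) insert.hyps by (simp add: mult_ac)
    ultimately have "\<forall>x\<in>S. \<beta> i x ^ m i * q x = 0"
      using insert.IH[of "int (m i) * 1 + k" "\<lambda>x. \<beta> i x ^ m i * q x"] insert.prems(1) by blast
    then show ?case using *[of i k q "m i"] insert.prems(1,2) by blast
  qed simp
  from this[of A k q] show ?thesis using \<open>finite A\<close> q z x by blast
qed

text \<open>\<open>hpoly\<close> multiplies by one coordinate at a time, whereas the pigeonhole
  argument of \<open>inv_ideal_high_degree\<close> needs the exponent vectors of whole
  monomials.\<close>

inductive mono_span :: "int \<Rightarrow> (complex^'n \<Rightarrow> complex) \<Rightarrow> bool" where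
  mono: "mono_span (int (\<Sum>i\<in>UNIV. a i)) (\<lambda>x. c * (\<Prod>i\<in>UNIV. x $ i ^ a i))"
| zero: "mono_span k (\<lambda>x. 0)"
| add: "mono_span k f \<Longrightarrow> mono_span k g \<Longrightarrow> mono_span k (\<lambda>x. f x + g x)"

lemma mono_span_coord: "mono_span k f \<Longrightarrow> mono_span (k + 1) (\<lambda>x. x $ i * f x)"
proof (induction rule: mono_span.induct)
  case (mono a c)
  define b where "b = a(i := Suc (a i))"
  have "(\<Sum>j\<in>UNIV. b j) = Suc (\<Sum>j\<in>UNIV. a j)"
    unfolding b_def by (subst (1 2) sum.remove[of UNIV i]) auto
  moreover have "(\<Prod>j\<in>UNIV. x $ j ^ b j) = x $ i * (\<Prod>j\<in>UNIV. x $ j ^ a j)" for x :: "complex^'a"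
    unfolding b_def by (subst (1 2) prod.remove[of UNIV i]) auto
  ultimately show ?case using mono_span.mono[of b c] by (simp add: mult_ac add.commute)
next
  case (add k f g)
  then show ?case using mono_span.add by (fastforce simp: distrib_left)
qed (simp add: mono_span.zero)

lemma hpoly_mono_span: "hpoly k f \<Longrightarrow> mono_span k f"
proof (induction rule: hpoly.induct)
  case (const c) then show ?case using mono_span.mono[of "\<lambda>_. 0" c] by simp
qed (simp_all add: mono_span.zero mono_span.add mono_span_coord)

text \<open>Polynomials, possibly inhomogeneous, of degree strictly below \<open>k\<close>. With the
  strict bound, \<open>f\<close> is the part of degree \<open>k\<close> of \<open>f + F\<close>
  whenever \<open>hpoly k f\<close> and \<open>lowdeg k F\<close>.\<close>

inductive lowdeg :: "int \<Rightarrow> (complex^'n \<Rightarrow> complex) \<Rightarrow> bool" where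
  hpoly: "hpoly j f \<Longrightarrow> j < k \<Longrightarrow> lowdeg k f"
| zero: "lowdeg k (\<lambda>x. 0)"
| add: "lowdeg k f \<Longrightarrow> lowdeg k g \<Longrightarrow> lowdeg k (\<lambda>x. f x + g x)"

lemma lowdeg_mult_hpoly: "lowdeg k f \<Longrightarrow> hpoly j g \<Longrightarrow> lowdeg (j + k) (\<lambda>x. g x * f x)"
proof (induction rule: lowdeg.induct)
  case (hpoly i f k) then show ?case by (intro lowdeg.hpoly[OF hpoly_mult]) auto
next
  case (add k f g) then show ?case using lowdeg.add by (fastforce simp: distrib_left)
qed (auto intro: lowdeg.zero)

lemma lowdeg_mult: "lowdeg j f \<Longrightarrow> lowdeg k g \<Longrightarrow> lowdeg (j + k) (\<lambda>x. f x * g x)"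
proof (induction rule: lowdeg.induct)
  case (hpoly i f j)
  have "lowdeg k g \<Longrightarrow> lowdeg (j + k) (\<lambda>x. f x * g x)"
  proof (induction rule: lowdeg.induct)
    case (hpoly i' g k) then show ?case using \<open>hpoly i f\<close> \<open>i < j\<close> by (intro lowdeg.hpoly[OF hpoly_mult]) auto
  next
    case (add k f g) then show ?case using lowdeg.add by (fastforce simp: distrib_left)
  qed (auto intro: lowdeg.zero)
  then show ?case using hpoly by blast
next
  case (add k f g) then show ?case using lowdeg.add by (fastforce simp: distrib_right)
qed (auto intro: lowdeg.zero)

lemma lowdeg_prod: "finite A \<Longrightarrow> (\<And>i. i \<in> A \<Longrightarrow> \<exists>k. lowdeg k (f i)) \<Longrightarrow> \<exists>k. lowdeg k (\<lambda>x. \<Prod>i\<in>A. f i x)"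
proof (induction A rule: finite_induct)
  case empty then show ?case using lowdeg.hpoly[OF hpoly.const[of 1], of 1] by auto
next
  case (insert i A)
  then obtain j k where "lowdeg j (f i)" "lowdeg k (\<lambda>x. \<Prod>i\<in>A. f i x)" by blast
  then show ?case using lowdeg_mult insert by fastforce
qed

lemma lowdeg_nonpos: "lowdeg k f \<Longrightarrow> k \<le> 0 \<Longrightarrow> f = (\<lambda>x. 0)"
  by (induction rule: lowdeg.induct) (auto simp: hpoly_negative fun_eq_iff)

lemma lowdeg_Suc:
  "lowdeg k F \<Longrightarrow> \<exists>f G. hpoly (k - 1) f \<and> lowdeg (k - 1) G \<and> F = (\<lambda>x. f x + G x)"
proof (induction rule: lowdeg.induct)
  case (hpoly j f k)
  show ?case
  proof (cases "j = k - 1")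
    case True then show ?thesis using hpoly lowdeg.zero[of "k-1"] by (intro exI[of _ f] exI[of _ "\<lambda>x. 0"]) auto
  next
    case False then show ?thesis using hpoly lowdeg.hpoly[of j f "k-1"] hpoly.zero[of "k - 1"]
      by (intro exI[of _ "\<lambda>x. 0"] exI[of _ f]) auto
  qed
next
  case zero show ?case by (intro exI[of _ "\<lambda>x. 0"]) (auto intro: hpoly.zero lowdeg.zero)
next
  case (add k f g)
  then obtain f1 f2 g1 g2 where "hpoly (k - 1) f1" "lowdeg (k - 1) f2" "f = (\<lambda>x. f1 x + f2 x)"
    "hpoly (k - 1) g1" "lowdeg (k - 1) g2" "g = (\<lambda>x. g1 x + g2 x)" by blast
  then show ?case
    by (intro exI[of _ "\<lambda>x. f1 x + g1 x"] exI[of _ "\<lambda>x. f2 x + g2 x"])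
      (simp add: hpoly.add lowdeg.add fun_eq_iff add_ac)
qed

section \<open>Steinberg's theorem: freeness of the action on the regular points\<close>

context hermitian_reflection_group
begin

text \<open>The graded pieces of the Hilbert ideal, whose quotient is the coinvariant
  algebra.\<close>

inductive inv_ideal :: "int \<Rightarrow> (complex^'n \<Rightarrow> complex) \<Rightarrow> bool" where
  gen: "hpoly j i \<Longrightarrow> j > 0 \<Longrightarrow> (\<And>w x. w \<in> W \<Longrightarrow> i (w *v x) = i x) \<Longrightarrow> hpoly k g
          \<Longrightarrow> inv_ideal (j + k) (\<lambda>x. i x * g x)"
| zero: "inv_ideal k (\<lambda>x. 0)"
| add: "inv_ideal k f \<Longrightarrow> inv_ideal k g \<Longrightarrow> inv_ideal k (\<lambda>x. f x + g x)"

lemma inv_ideal_hpoly: "inv_ideal k f \<Longrightarrow> hpoly k f"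
  by (induction rule: inv_ideal.induct) (simp_all add: hpoly_mult hpoly.zero hpoly.add)

lemma inv_ideal_mult: "inv_ideal k f \<Longrightarrow> hpoly l h \<Longrightarrow> inv_ideal (k + l) (\<lambda>x. f x * h x)"
proof (induction rule: inv_ideal.induct)
  case (gen j i k g)
  have "inv_ideal (j + (k + l)) (\<lambda>x. i x * (g x * h x))"
    using gen by (intro inv_ideal.gen hpoly_mult) simp_all
  then show ?case by (simp add: algebra_simps)
next
  case (add k f g)
  then have "inv_ideal (k + l) (\<lambda>x. f x * h x + g x * h x)" by (intro inv_ideal.add) simp_all
  then show ?case by (simp add: algebra_simps)
qed (simp add: inv_ideal.zero)

lemma inv_ideal_scale: "inv_ideal k f \<Longrightarrow> inv_ideal k (\<lambda>x. c * f x)"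
  using inv_ideal_mult[OF _ hpoly.const[of c]] by (simp add: mult.commute)

lemma inv_ideal_sum: "(\<And>i. i \<in> A \<Longrightarrow> inv_ideal k (f i)) \<Longrightarrow> inv_ideal k (\<lambda>x. \<Sum>i\<in>A. f i x)"
  by (induction A rule: infinite_finite_induct) (simp_all add: inv_ideal.zero inv_ideal.add)

lemma inv_ideal_matrix: "inv_ideal k f \<Longrightarrow> w \<in> W \<Longrightarrow> inv_ideal k (\<lambda>x. f (w *v x))"
proof (induction rule: inv_ideal.induct)
  case (gen j i k g)
  then have "inv_ideal (j + k) (\<lambda>x. i x * g (w *v x))"
    by (intro inv_ideal.gen hpoly_matrix)
  then show ?case using gen by simp
qed (simp_all add: inv_ideal.zero inv_ideal.add)

section \<open>Division by a linear form and divided differences\<close>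

lemma form_hpoly: "hpoly 1 (form H)"
  by (rule hpoly_linear) (simp_all add: form_add form_scale)

lemma form_cancel:
  assumes H: "H \<in> hyperplanes W" and f: "hpoly k f" and g: "hpoly l g"
    and "\<And>x. form H x * f x = form H x * g x"
  shows "f x = g x"
proof -
  have "form H y * (f y - g y) = 0" for y using assms(4) by (simp add: right_diff_distrib)
  then have "f x - g x = 0"
    by (intro line_cancel[OF continuous_diff[OF hpoly_isCont[OF f] hpoly_isCont[OF g]]
          form_add form_scale form_root[OF H]])
  then show ?thesis by simp
qed

text \<open>\<open>p\<close> is the projection onto \<open>H\<close> along the root. The difference
  of \<open>f\<close> and \<open>f \<circ> p\<close> is always divisible by the form, by induction
  on the construction of \<open>f\<close>, and here \<open>f \<circ> p\<close> is zero.\<close>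

lemma hpoly_divide:
  assumes H: "H \<in> hyperplanes W" and f: "hpoly k f" and z: "\<And>x. x \<in> H \<Longrightarrow> f x = 0"
  shows "\<exists>g. hpoly (k - 1) g \<and> (\<forall>x. f x = form H x * g x)"
proof -
  define p where "p x = x - (form H x / form H (root H)) *s root H" for x
  have p1: "hpoly 1 (\<lambda>x. p x $ i)" for i
  proof -
    have "hpoly 1 (\<lambda>x. x $ i - (root H $ i / form H (root H)) * form H x)"
      by (intro hpoly_diff hpoly_scale hpoly_coord form_hpoly)
    then show ?thesis by (simp add: p_def mult.commute)
  qed
  have "\<exists>g. hpoly (k - 1) g \<and> (\<forall>x. f x - f (p x) = form H x * g x)"
    using f
  proof induction
    case (const c) show ?case by (intro exI[of _ "\<lambda>x. 0"]) (simp add: hpoly.zero)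
  next
    case (coord k f i)
    then obtain g where g: "hpoly (k - 1) g" "\<And>x. f x - f (p x) = form H x * g x" by blast
    \<comment> \<open>The second summand accounts for the change of the coordinate:
      \<open>x $ i - p x $ i\<close> is a constant multiple of the form.\<close>
    have "hpoly k (\<lambda>x. x $ i * g x + (root H $ i / form H (root H)) * f (p x))"
      using hpoly.coord[OF g(1), of i] hpoly_compose[OF coord.hyps p1]
      by (intro hpoly.add hpoly_scale) simp_all
    moreover have "x $ i * f x - p x $ i * f (p x) =
        form H x * (x $ i * g x + (root H $ i / form H (root H)) * f (p x))" for x
    proof -
      have "x $ i * f x - p x $ i * f (p x) = x $ i * (f x - f (p x)) + (x $ i - p x $ i) * f (p x)"
        by (simp add: algebra_simps)
      also have "\<dots> = form H x * (x $ i * g x + (root H $ i / form H (root H)) * f (p x))"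
        unfolding g(2) by (simp add: p_def algebra_simps)
      finally show ?thesis .
    qed
    ultimately show ?case by (intro exI[of _ "\<lambda>x. x $ i * g x + (root H $ i / form H (root H)) * f (p x)"]) simp
  next
    case zero show ?case by (intro exI[of _ "\<lambda>x. 0"]) (simp add: hpoly.zero)
  next
    case (add k f g)
    then obtain a b where "hpoly (k - 1) a" "\<And>x. f x - f (p x) = form H x * a x"
      "hpoly (k - 1) b" "\<And>x. g x - g (p x) = form H x * b x" by blast
    then show ?case by (intro exI[of _ "\<lambda>x. a x + b x"]) (simp add: hpoly.add distrib_left add_diff_add)
  qed
  moreover have "f (p x) = 0" for x using z decomp_form[OF H] by (simp add: p_def)
  ultimately show ?thesis by simp
qed

lemma form_fixator:
  assumes "H \<in> hyperplanes W" "s \<in> fixator W H" shows "form H (s *v x) = det s * form H x"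
  using form_char[OF assms(1) fixator_stabilizer[OF assms(2)]] det_fixator[OF assms] by simp

text \<open>The invariant factor of a generator is unchanged by \<open>s\<close> and comes out of
  the difference, so the division takes place in the cofactor.\<close>

lemma inv_ideal_divided_difference:
  assumes H: "H \<in> hyperplanes W" and s: "s \<in> fixator W H" and f: "inv_ideal k f"
  shows "\<exists>g. inv_ideal (k - 1) g \<and> (\<forall>x. f x - f (s *v x) = form H x * g x)"
  using f
proof induction
  case (gen j i k g)
  obtain h where h: "hpoly (k - 1) h" "\<And>x. g x - g (s *v x) = form H x * h x"
    using hpoly_divide[OF H hpoly_diff[OF gen(4) hpoly_matrix[OF gen(4), of s]]] s by (auto simp: fixator_def)
  have "inv_ideal (j + (k - 1)) (\<lambda>x. i x * h x)" using gen h by (intro inv_ideal.gen)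
  moreover have "i x * g x - i (s *v x) * g (s *v x) = form H x * (i x * h x)" for x
  proof -
    have "i (s *v x) = i x" using gen(3) s fixator_subset by blast
    then show ?thesis using h(2)[of x] by (metis mult.left_commute right_diff_distrib)
  qed
  ultimately show ?case by (intro exI[of _ "\<lambda>x. i x * h x"]) (simp add: add_diff_eq)
next
  case zero show ?case by (intro exI[of _ "\<lambda>x. 0"]) (simp add: inv_ideal.zero)
next
  case (add k f g)
  then obtain a b where "inv_ideal (k - 1) a" "\<And>x. f x - f (s *v x) = form H x * a x"
    "inv_ideal (k - 1) b" "\<And>x. g x - g (s *v x) = form H x * b x" by blast
  then show ?case by (intro exI[of _ "\<lambda>x. a x + b x"]) (simp add: inv_ideal.add distrib_left add_diff_add)
qed

text \<open>As \<open>s\<close> scales the form by \<open>det s\<close>, the divided difference of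
  \<open>form H\<close> times \<open>f\<close> is exactly this twisted difference of
  \<open>f\<close>, once the form is cancelled.\<close>

lemma inv_ideal_semi_invariant:
  assumes H: "H \<in> hyperplanes W" and s: "s \<in> fixator W H" and f: "hpoly k f"
    and af: "inv_ideal (k + 1) (\<lambda>x. form H x * f x)"
  shows "inv_ideal k (\<lambda>x. f x - det s * f (s *v x))"
proof -
  obtain g where g: "inv_ideal k g" "\<And>x. form H x * f x - form H (s *v x) * f (s *v x) = form H x * g x"
    using inv_ideal_divided_difference[OF H s af] by auto
  have "f x - det s * f (s *v x) = g x" for x
  proof (rule form_cancel[OF H _ inv_ideal_hpoly[OF g(1)]])
    show "hpoly k (\<lambda>x. f x - det s * f (s *v x))"
      by (intro hpoly_diff hpoly_scale hpoly_matrix f)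
    show "form H x * (f x - det s * f (s *v x)) = form H x * g x" for x
      using g(2)[of x] by (simp add: form_fixator[OF H s] algebra_simps)
  qed
  then show ?thesis using g(1) by simp
qed

section \<open>Skew symmetrisation over the group\<close>

definition skew_proj :: "(complex^'n \<Rightarrow> complex) \<Rightarrow> complex^'n \<Rightarrow> complex" where
  "skew_proj f x = (\<Sum>w\<in>W. det w * f (w *v x))"

lemma card_W_pos: "card W > 0" using finite_W W_one by (auto simp: card_gt_0_iff)

lemma skew_proj_hpoly: "hpoly k f \<Longrightarrow> hpoly k (skew_proj f)"
  unfolding skew_proj_def by (intro hpoly_sum hpoly_scale hpoly_matrix)

lemma W_translate: "u \<in> W \<Longrightarrow> bij_betw (\<lambda>w. w ** u) W W"
proof -
  assume u: "u \<in> W"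
  obtain v where v: "v \<in> W" "u ** v = mat 1" "v ** u = mat 1" using W_inverse[OF u] by blast
  show ?thesis
    by (rule bij_betw_byWitness[where f' = "\<lambda>w. w ** v"])
      (use u v W_mult in \<open>auto simp flip: matrix_mul_assoc\<close>)
qed

lemma skew_proj_skew:
  assumes u: "u \<in> W" shows "det u * skew_proj f (u *v x) = skew_proj f x"
proof -
  have "skew_proj f x = (\<Sum>w\<in>W. det (w ** u) * f ((w ** u) *v x))"
    unfolding skew_proj_def by (rule sum.reindex_bij_betw[OF W_translate[OF u], symmetric])
  also have "\<dots> = det u * skew_proj f (u *v x)"
    by (simp add: skew_proj_def det_mul matrix_vector_mul_assoc sum_distrib_left mult_ac)
  finally show ?thesis by simp
qed

text \<open>Modulo the ideal, \<open>f\<close> agrees with \<open>det w\<close> times its translate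
  by \<open>w\<close>: for elements of fixators this is \<open>inv_ideal_semi_invariant\<close>, and
  products follow by chaining. Summing over \<open>W\<close> produces
  \<open>skew_proj\<close>.\<close>

lemma inv_ideal_skew_proj:
  assumes f: "hpoly k f"
    and af: "\<And>H. H \<in> hyperplanes W \<Longrightarrow> inv_ideal (k + 1) (\<lambda>x. form H x * f x)"
  shows "inv_ideal k (\<lambda>x. of_nat (card W) * f x - skew_proj f x)"
proof -
  have "inv_ideal k (\<lambda>x. f x - det w * f (w *v x))" if "w \<in> W" for w
    using that
  proof (induction rule: W_induct)
    case (mult a b)
    have "inv_ideal k (\<lambda>x. (f x - det b * f (b *v x)) + det b * (f (b *v x) - det a * f (a *v (b *v x))))"
      using inv_ideal_matrix[OF mult.IH(1) mult.hyps(2)]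
      by (intro inv_ideal.add mult.IH inv_ideal_scale)
    then show ?case by (simp add: det_mul matrix_vector_mul_assoc algebra_simps)
  next
    case (reflection H s)
    then show ?case using inv_ideal_semi_invariant[OF _ _ f af] by blast
  qed (simp add: inv_ideal.zero)
  then have "inv_ideal k (\<lambda>x. \<Sum>w\<in>W. f x - det w * f (w *v x))" by (rule inv_ideal_sum)
  then show ?thesis by (simp add: sum_subtractf skew_proj_def)
qed

text \<open>The linear form \<open>x\<^sub>i\<close> is a root of \<open>\<Prod>(T - x\<^sub>i \<circ> w)\<close>, whose lower coefficients are invariants of
  positive degree.\<close>

lemma inv_ideal_coord_power: "inv_ideal (int (card W)) (\<lambda>x. x $ i ^ card W)"
proof -
  define p where "p A x = (\<Prod>w\<in>A. [:- ((w *v x) $ i), 1:])" for A :: "(complex^'n^'n) set" and x :: "complex^'n"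
  \<comment> \<open>Subsets \<open>A\<close> are allowed for the sake of the induction. For
    \<open>m > card A\<close> the degree is negative, in agreement with a vanishing
    coefficient.\<close>
  have hp: "hpoly (int (card A) - int m) (\<lambda>x. Polynomial.coeff (p A x) m)" if "finite A" for A m
    using that
  proof (induction A arbitrary: m)
    case empty
    show ?case
    proof (cases "m = 0")
      case True then show ?thesis using hpoly.const[of 1] by (simp add: p_def)
    next
      case False then show ?thesis using hpoly.zero by (simp add: p_def)
    qed
  next
    case (insert w A)
    have 1: "hpoly (1 + (int (card A) - int m)) (\<lambda>x. (- ((w *v x) $ i)) * Polynomial.coeff (p A x) m)" for m
      using hpoly_scale[OF hpoly_matrix[OF hpoly_coord[of i], of w], of "-1"]
      by (intro hpoly_mult insert.IH) simp
    have c: "Polynomial.coeff (p (insert w A) x) m = (- ((w *v x) $ i)) * Polynomial.coeff (p A x) m + (case m of 0 \<Rightarrow> 0 | Suc n \<Rightarrow> Polynomial.coeff (p A x) n)" for x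
      using insert.hyps by (simp add: p_def coeff_pCons split: nat.split)
    have d: "hpoly (int (card (insert w A)) - int m) (\<lambda>x. case m of 0 \<Rightarrow> 0 | Suc n \<Rightarrow> Polynomial.coeff (p A x) n)"
      using insert.IH insert.hyps by (cases m) (simp_all add: hpoly.zero)
    have e: "1 + (int (card A) - int m) = int (card (insert w A)) - int m"
      using insert.hyps by simp
    show ?case unfolding c by (rule hpoly.add[OF 1[of m, unfolded e] d])
  qed
  have inv: "p W (u *v x) = p W x" if u: "u \<in> W" for u x
  proof -
    have "p W x = (\<Prod>w\<in>W. [:- (((w ** u) *v x) $ i), 1:])"
      unfolding p_def by (rule prod.reindex_bij_betw[OF W_translate[OF u], symmetric])
    then show ?thesis by (simp add: p_def matrix_vector_mul_assoc)
  qed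
  have deg: "degree (p W x) = card W" for x
    unfolding p_def by (subst degree_prod_eq_sum_degree) auto
  have lead: "Polynomial.coeff (p W x) (card W) = 1" for x
    using lead_coeff_prod[of "\<lambda>w. [:- ((w *v x) $ i), 1:]" W] deg[of x] by (simp add: p_def)
  have "poly (p W x) (x $ i) = 0" for x
    unfolding p_def poly_prod using finite_W W_one by (intro prod_zero bexI[of _ "mat 1"]) auto
  then have eq: "(\<Sum>m<card W. Polynomial.coeff (p W x) m * x $ i ^ m) + x $ i ^ card W = 0" for x
    by (simp add: poly_altdef deg lead lessThan_Suc_atMost[symmetric])
  have "inv_ideal (int (card W)) (\<lambda>x. Polynomial.coeff (p W x) m * x $ i ^ m)" if "m < card W" for m
  proof -
    have "inv_ideal ((int (card W) - int m) + int m * 1) (\<lambda>x. Polynomial.coeff (p W x) m * x $ i ^ m)"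
      using that inv by (intro inv_ideal.gen hp finite_W hpoly_power hpoly_coord) simp_all
    then show ?thesis by simp
  qed
  then have "inv_ideal (int (card W)) (\<lambda>x. -1 * (\<Sum>m<card W. Polynomial.coeff (p W x) m * x $ i ^ m))"
    by (intro inv_ideal_scale inv_ideal_sum) simp
  moreover have "-1 * (\<Sum>m<card W. Polynomial.coeff (p W x) m * x $ i ^ m) = x $ i ^ card W" for x
    using eq[of x] by (simp add: add_eq_0_iff)
  ultimately show ?thesis by simp
qed

text \<open>Pigeonhole: a monomial of this degree in \<open>CARD('n)\<close> variables contains some
  coordinate to a power of at least \<open>card W\<close>, and that power already lies in the
  ideal.\<close>

lemma inv_ideal_high_degree:
  assumes "hpoly k f" "k \<ge> int (CARD('n) * card W)" shows "inv_ideal k f"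
  using hpoly_mono_span[OF assms(1)] assms(2)
proof induction
  case (mono a c)
  have "\<exists>i. a i \<ge> card W"
  proof (rule ccontr)
    assume "\<nexists>i. a i \<ge> card W"
    then have "sum a UNIV < sum (\<lambda>i. card W) (UNIV :: 'n set)" by (intro sum_strict_mono) (auto simp: not_le)
    then show False using mono by simp
  qed
  then obtain i where i: "a i \<ge> card W" by blast
  define b where "b = a(i := a i - card W)"
  have s: "sum a UNIV = card W + sum b UNIV"
    unfolding b_def using i by (subst (1 2) sum.remove[of UNIV i]) auto
  have "(\<Prod>j\<in>UNIV. x $ j ^ a j) = x $ i ^ card W * (\<Prod>j\<in>UNIV. x $ j ^ b j)" for x :: "complex^'n"
    unfolding b_def using i by (subst (1 2) prod.remove[of UNIV i]) (auto simp flip: power_add mult.assoc)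
  moreover have "hpoly (\<Sum>j\<in>UNIV. int (b j) * 1) (\<lambda>x. \<Prod>j\<in>(UNIV :: 'n set). x $ j ^ b j)"
    by (intro hpoly_prod hpoly_power hpoly_coord) simp
  then have "inv_ideal (int (card W) + (\<Sum>j\<in>UNIV. int (b j) * 1))
      (\<lambda>x. x $ i ^ card W * (c * (\<Prod>j\<in>(UNIV :: 'n set). x $ j ^ b j)))"
    by (intro inv_ideal_mult inv_ideal_coord_power hpoly_scale)
  ultimately show ?case by (simp add: s mult_ac)
qed (simp_all add: inv_ideal.zero inv_ideal.add)

section \<open>The product of the forms and the divisibility of skew polynomials\<close>

definition disc_exponent :: "(complex^'n) set \<Rightarrow> nat" where
  "disc_exponent H = e_H W H - 1"

text \<open>Each form occurs as often as there are reflections along its hyperplane, so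
  \<open>discr_degree\<close> counts the reflections of \<open>W\<close>. Up to a scalar this is the
  Jacobian of the basic invariants, whereas the usual discriminant has exponents
  \<open>e_H\<close>.\<close>

definition discr :: "complex^'n \<Rightarrow> complex" where
  "discr x = (\<Prod>H\<in>hyperplanes W. form H x ^ disc_exponent H)"

definition discr_degree :: int where
  "discr_degree = (\<Sum>H\<in>hyperplanes W. int (disc_exponent H))"

lemma discr_hpoly: "hpoly discr_degree discr"
proof -
  have "hpoly (\<Sum>H\<in>hyperplanes W. int (disc_exponent H) * 1) (\<lambda>x. \<Prod>H\<in>hyperplanes W. form H x ^ disc_exponent H)"
    by (intro hpoly_prod finite_hyperplanes hpoly_power form_hpoly)
  then show ?thesis by (simp add: discr_def[abs_def] discr_degree_def)
qed

lemma discr_Vreg: "x \<in> Vreg W \<Longrightarrow> discr x \<noteq> 0"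
  using finite_hyperplanes by (simp add: discr_def form_Vreg)

lemma hyperplane_line: "H \<in> hyperplanes W \<Longrightarrow> x \<in> H \<Longrightarrow> y \<in> H \<Longrightarrow> x + t *s y \<in> H"
  by (simp add: form_iff form_add form_scale)

text \<open>If \<open>H\<close> were contained in \<open>H'\<close>, then \<open>H\<close> and one
  further vector of \<open>H'\<close> would span the whole space inside \<open>H'\<close>, including
  the root of \<open>H'\<close>.\<close>

lemma hyperplanes_distinct:
  assumes H: "H \<in> hyperplanes W" and H': "H' \<in> hyperplanes W" and "H \<noteq> H'"
  shows "\<exists>v\<in>H. form H' v \<noteq> 0"
proof (rule ccontr)
  assume "\<not> ?thesis"
  then have sub: "H \<subseteq> H'" using form_iff[OF H'] by blast
  then obtain y where y: "y \<in> H'" "y \<notin> H" using \<open>H \<noteq> H'\<close> by blast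
  obtain h c where hc: "h \<in> H" "root H' = h + c *s y"
    using hyperplane_decomp[OF hyperplanesD[OF H] y(2)] by blast
  then have "form H' (root H') = 0" using sub y form_on[OF H'] by (auto simp: form_add form_scale)
  then show False using form_root[OF H'] by blast
qed

lemma cancel_on_hyperplane:
  assumes H: "H \<in> hyperplanes W" and A: "A \<subseteq> hyperplanes W" "H \<notin> A" and q: "hpoly k q"
    and z: "\<And>x. x \<in> H \<Longrightarrow> (\<Prod>K\<in>A. form K x ^ m K) * q x = 0" and x: "x \<in> H"
  shows "q x = 0"
  by (rule line_cancel_prod[OF finite_subset[OF A(1) finite_hyperplanes] hyperplane_line[OF H]
        form_add form_scale _ q z x])
    (use hyperplanes_distinct[OF H] A in auto)

lemma cancel_forms:
  assumes A: "A \<subseteq> hyperplanes W" and p: "hpoly k p" and q: "hpoly k q"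
    and z: "\<And>x. (\<Prod>K\<in>A. form K x ^ m K) * p x = (\<Prod>K\<in>A. form K x ^ m K) * q x"
  shows "p x = q x"
proof -
  have ne: "\<exists>v\<in>UNIV. form K v \<noteq> 0" if "K \<in> A" for K
    using form_root that A by blast
  have z': "(\<Prod>K\<in>A. form K y ^ m K) * (p y - q y) = 0" for y
    using z[of y] by (simp add: right_diff_distrib)
  have "p x - q x = 0"
    by (rule line_cancel_prod[where S = UNIV, OF finite_subset[OF A finite_hyperplanes] _ form_add form_scale
          ne hpoly_diff[OF p q] z']) auto
  then show ?thesis by simp
qed

lemma form_act:
  assumes w: "w \<in> W" "v \<in> W" "w ** v = mat 1" "v ** w = mat 1" and H: "H \<in> hyperplanes W"
  shows "\<exists>c. \<forall>x. form H (w *v x) = c * form (act_hyp v H) x"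
proof -
  let ?K = "act_hyp v H"
  have K: "?K \<in> hyperplanes W" by (rule act_hyp_hyperplanes[OF w(2) H])
  define c where "c = form H (w *v root ?K) / form ?K (root ?K)"
  have "form H (w *v x) = c * form ?K x" for x
  proof -
    obtain k b where kb: "k \<in> ?K" "x = k + b *s root ?K" using decomp[OF K] .
    then obtain h where h: "h \<in> H" "k = v *v h" by (auto simp: act_hyp_def)
    have "form H (w *v k) = 0" using h w form_on[OF H] by (simp add: matrix_vector_mul_assoc)
    then show ?thesis using form_on[OF K kb(1)] form_root[OF K]
      by (simp add: kb matrix_vector_right_distrib vector_scalar_commute form_add form_scale c_def)
  qed
  then show ?thesis by blast
qed

lemma e_H_act_le:
  assumes w: "w \<in> W" "v \<in> W" "w ** v = mat 1" "v ** w = mat 1"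
  shows "e_H W (act_hyp v H) \<le> e_H W H"
  unfolding e_H_def
proof (rule card_inj_on_le[OF _ _ finite_fixator])
  show "inj_on (\<lambda>s. w ** s ** v) (fixator W (act_hyp v H))"
  proof (rule inj_onI)
    fix s t assume "w ** s ** v = w ** t ** v"
    then have "v ** (w ** s ** v) ** w = v ** (w ** t ** v) ** w" by simp
    then have "(v ** w) ** s ** (v ** w) = (v ** w) ** t ** (v ** w)" by (simp only: matrix_mul_assoc)
    then show "s = t" using w by simp
  qed
  show "(\<lambda>s. w ** s ** v) ` fixator W (act_hyp v H) \<subseteq> fixator W H"
    using w by (auto simp: fixator_def act_hyp_def matrix_vector_mul_assoc[symmetric] intro!: W_mult)
      (simp add: matrix_vector_mul_assoc)
qed

lemma e_H_act:
  assumes w: "w \<in> W" "v \<in> W" "w ** v = mat 1" "v ** w = mat 1"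
  shows "e_H W (act_hyp v H) = e_H W H"
  using e_H_act_le[OF w, of H] e_H_act_le[OF w(2,1,4,3), of "act_hyp v H"] w(3)
  by (simp add: act_hyp_one flip: act_hyp_mult)

text \<open>The group permutes the forms up to scalars, and conjugate hyperplanes carry the same
  exponent.\<close>

lemma discr_semi_invariant:
  assumes w: "w \<in> W" shows "\<exists>c. \<forall>x. discr (w *v x) = c * discr x"
proof -
  obtain v where v: "v \<in> W" "w ** v = mat 1" "v ** w = mat 1" using W_inverse[OF w] by blast
  obtain c where c: "\<And>H x. H \<in> hyperplanes W \<Longrightarrow> form H (w *v x) = c H * form (act_hyp v H) x"
    using form_act[OF w v] by metis
  have bij: "bij_betw (act_hyp v) (hyperplanes W) (hyperplanes W)"
    by (rule bij_betw_byWitness[where f' = "act_hyp w"])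
      (use act_hyp_hyperplanes w v in \<open>auto simp: act_hyp_one simp flip: act_hyp_mult\<close>)
  have "discr (w *v x) = (\<Prod>H\<in>hyperplanes W. c H ^ disc_exponent H) * discr x" for x
  proof -
    have "discr (w *v x) = (\<Prod>H\<in>hyperplanes W. c H ^ disc_exponent H) *
        (\<Prod>H\<in>hyperplanes W. form (act_hyp v H) x ^ disc_exponent (act_hyp v H))"
      by (simp add: discr_def c power_mult_distrib prod.distrib disc_exponent_def e_H_act[OF w v])
    also have "(\<Prod>H\<in>hyperplanes W. form (act_hyp v H) x ^ disc_exponent (act_hyp v H)) = discr x"
      unfolding discr_def by (rule prod.reindex_bij_betw[OF bij])
    finally show ?thesis .
  qed
  then show ?thesis by blast
qed

text \<open>On the reflecting hyperplane of \<open>s\<close> the product of the other forms does not vanish identically;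
  comparing values there determines the factor by which \<open>s\<close> scales \<open>discr\<close>.\<close>

lemma discr_reflection:
  assumes H: "H \<in> hyperplanes W" and s: "s \<in> fixator W H"
  shows "det s * discr (s *v x) = discr x"
proof -
  define A where "A = hyperplanes W - {H}"
  define q where "q x = (\<Prod>K\<in>A. form K x ^ disc_exponent K)" for x
  let ?m = "disc_exponent H"
  have A: "A \<subseteq> hyperplanes W" "H \<notin> A" "finite A" using finite_hyperplanes by (auto simp: A_def)
  have dq: "discr x = form H x ^ ?m * q x" for x
    unfolding discr_def q_def A_def by (rule prod.remove[OF finite_hyperplanes H])
  have qh: "hpoly (\<Sum>K\<in>A. int (disc_exponent K) * 1) q"
    unfolding q_def by (intro hpoly_prod A hpoly_power form_hpoly)
  obtain c where c: "\<And>x. discr (s *v x) = c * discr x"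
    using discr_semi_invariant s fixator_subset by blast
  define r where "r x = det s ^ ?m * q (s *v x) - c * q x" for x
  have rh: "hpoly (\<Sum>K\<in>A. int (disc_exponent K) * 1) r"
    unfolding r_def by (intro hpoly_diff hpoly_scale hpoly_matrix qh)
  have "form H x ^ ?m * r x = 0" for x
    using c[of x] by (simp add: r_def dq form_fixator[OF H s] power_mult_distrib algebra_simps)
  then have r0: "r x = 0" for x
    using cancel_forms[of "{H}" _ r "\<lambda>x. 0" "\<lambda>_. ?m" x] H rh hpoly.zero by auto
  have "det s ^ ?m = c"
  proof (rule ccontr)
    assume ne: "det s ^ ?m \<noteq> c"
    have q0: "q x = 0" if "x \<in> H" for x
    proof -
      have "s *v x = x" using s that by (simp add: fixator_def)
      then show ?thesis using r0[of x] ne by (simp add: r_def algebra_simps)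
    qed
    have "0 \<in> H" by (simp add: form_iff[OF H] form_zero)
    \<comment> \<open>The factor 1 is the polynomial left over after cancelling the other forms on
      \<open>H\<close>; the conclusion would be \<open>1 = 0\<close>.\<close>
    moreover have "(\<Prod>K\<in>A. form K x ^ disc_exponent K) * 1 = 0" if "x \<in> H" for x
      using q0[OF that] by (simp add: q_def)
    ultimately have "(1::complex) = 0"
      using cancel_on_hyperplane[OF H A(1,2) hpoly.const[of 1], of disc_exponent 0] by blast
    then show False by simp
  qed
  \<comment> \<open>\<open>c\<close> is the power of \<open>det s\<close> with exponent
    \<open>e_H - 1\<close>, and \<open>det s\<close> is an \<open>e_H\<close>-th root of
    unity.\<close>
  then have "det s * c = 1"
    using det_fixator_power[OF s] e_H_pos[of H] by (simp add: disc_exponent_def power_eq_if split: if_splits)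
  then show ?thesis using c[of x] by (simp add: mult.assoc[symmetric])
qed


text \<open>Once \<open>form H ^ m\<close> is split off, the quotient satisfies
  \<open>z ^ Suc m * q (s *v x) = q x\<close>, where \<open>z\<close> has exact order
  \<open>e_H\<close>. Points of \<open>H\<close> are fixed by \<open>s\<close>, so \<open>q\<close>
  vanishes on \<open>H\<close> as long as \<open>Suc m < e_H\<close>, and a further factor comes
  out.\<close>

lemma divide_form_power:
  assumes H: "H \<in> hyperplanes W" and g: "hpoly k g"
    and skew: "\<And>s x. s \<in> fixator W H \<Longrightarrow> det s * g (s *v x) = g x"
  shows "m \<le> disc_exponent H \<Longrightarrow> \<exists>q. hpoly (k - int m) q \<and> (\<forall>x. g x = form H x ^ m * q x)"
proof (induction m)
  case 0 then show ?case using g by auto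
next
  case (Suc m)
  then obtain q where q: "hpoly (k - int m) q" "\<And>x. g x = form H x ^ m * q x" by auto
  define s z where "s = s_H W H" and "z = det s"
  have s: "s \<in> fixator W H" using s_H_props[OF H] by (simp add: s_def)
  have "z ^ Suc m \<noteq> 1"
  proof -
    have "Suc m < e_H W H" "e_H W H \<noteq> 0" using Suc.prems by (auto simp: disc_exponent_def)
    have "z ^ Suc m = exp (2 * of_real pi * \<i> * of_nat (Suc m) / of_nat (e_H W H))"
      unfolding z_def s_def s_H_props(2)[OF H] exp_of_nat_mult[symmetric]
      by (rule arg_cong[of _ _ exp]) (simp add: mult_ac)
    also have "\<dots> \<noteq> exp (2 * of_real pi * \<i> * of_nat 0 / of_nat (e_H W H))"
      using \<open>Suc m < e_H W H\<close> by (subst complex_root_unity_eq) auto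
    finally show ?thesis by simp
  qed
  have "z ^ Suc m * q (s *v x) = q x" for x
  proof (rule cancel_forms[of "{H}" _ _ _ "\<lambda>_. m"])
    show "hpoly (k - int m) (\<lambda>x. z ^ Suc m * q (s *v x))" by (intro hpoly_scale hpoly_matrix q(1))
    show "(\<Prod>K\<in>{H}. form K x ^ m) * (z ^ Suc m * q (s *v x)) = (\<Prod>K\<in>{H}. form K x ^ m) * q x" for x
      using skew[OF s, of x] by (simp add: q(2) form_fixator[OF H s] z_def power_mult_distrib mult_ac)
  qed (use H q in auto)
  moreover have "s *v x = x" if "x \<in> H" for x using s that by (simp add: fixator_def)
  ultimately have "q x = 0" if "x \<in> H" for x
    using \<open>z ^ Suc m \<noteq> 1\<close> that by (metis mult_cancel_right1)
  then obtain q' where "hpoly (k - int m - 1) q'" "\<And>x. q x = form H x * q' x"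
    using hpoly_divide[OF H q(1)] by blast
  then show ?case using q(2) by (intro exI[of _ q']) (simp add: mult_ac diff_diff_eq add.commute)
qed

text \<open>Replaces unique factorisation: no other form vanishes identically on \<open>H\<close>,
  so \<open>i\<close> vanishes there, and one factor \<open>form H\<close> can be cancelled on both
  sides.\<close>

lemma divide_forms_coprime:
  assumes H: "H \<in> hyperplanes W" and A: "A \<subseteq> hyperplanes W" "H \<notin> A"
  shows "hpoly l i \<Longrightarrow> hpoly k q \<Longrightarrow> (\<And>x. (\<Prod>K\<in>A. form K x ^ m K) * i x = form H x ^ n * q x)
    \<Longrightarrow> \<exists>j. hpoly (l - int n) j \<and> (\<forall>x. i x = form H x ^ n * j x)"
proof (induction n arbitrary: l i k)
  case 0 then show ?case by auto
next
  case (Suc n)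
  have Af: "finite A" using A finite_hyperplanes finite_subset by blast
  have "i x = 0" if "x \<in> H" for x
    by (rule cancel_on_hyperplane[where m = m, OF H A Suc.prems(1) _ that])
      (use Suc.prems(3) form_on[OF H] in simp)
  then obtain i' where i': "hpoly (l - 1) i'" "\<And>x. i x = form H x * i' x"
    using hpoly_divide[OF H Suc.prems(1)] by blast
  define P where "P x = (\<Prod>K\<in>A. form K x ^ m K)" for x
  have P: "hpoly (\<Sum>K\<in>A. int (m K) * 1) P"
    unfolding P_def by (intro hpoly_prod hpoly_power form_hpoly Af)
  define d where "d = (\<Sum>K\<in>A. int (m K) * 1) + (l - 1)"
  have 1: "hpoly d (\<lambda>x. P x * i' x)" unfolding d_def by (intro hpoly_mult P i')
  have 2: "hpoly (int n * 1 + k) (\<lambda>x. form H x ^ n * q x)"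
    by (intro hpoly_mult hpoly_power form_hpoly Suc.prems)
  have eq: "form H x * (P x * i' x) = form H x * (form H x ^ n * q x)" for x
    using Suc.prems(3)[of x] by (simp add: P_def i'(2) mult_ac)
  have "P x * i' x = form H x ^ n * q x" for x
    by (rule form_cancel[OF H 1 2 eq])
  then obtain j where "hpoly (l - 1 - int n) j" "\<And>x. i' x = form H x ^ n * j x"
    using Suc.IH[OF i'(1) Suc.prems(2)] by (auto simp: P_def)
  then show ?case using i'(2) by (intro exI[of _ j]) (simp add: mult_ac diff_diff_eq add.commute)
qed

text \<open>Each fixator forces the full power of its own form, and different forms are coprime. The
  quotient is invariant because \<open>g\<close> and \<open>discr\<close> change by the same factor
  under each reflection.\<close>

lemma skew_divisible:
  assumes g: "hpoly k g"
    and skew: "\<And>H s x. H \<in> hyperplanes W \<Longrightarrow> s \<in> fixator W H \<Longrightarrow> det s * g (s *v x) = g x"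
  shows "\<exists>i. hpoly (k - discr_degree) i \<and> (\<forall>x. g x = discr x * i x) \<and> (\<forall>w\<in>W. \<forall>x. i (w *v x) = i x)"
proof -
  have "\<exists>i. hpoly (k - (\<Sum>H\<in>A. int (disc_exponent H))) i \<and>
      (\<forall>x. g x = (\<Prod>H\<in>A. form H x ^ disc_exponent H) * i x)"
    if "finite A" "A \<subseteq> hyperplanes W" for A
    using that
  proof (induction A)
    case empty then show ?case using g by auto
  next
    case (insert H A)
    then obtain i where i: "hpoly (k - (\<Sum>H\<in>A. int (disc_exponent H))) i"
      "\<And>x. g x = (\<Prod>H\<in>A. form H x ^ disc_exponent H) * i x" by auto
    have H: "H \<in> hyperplanes W" and A: "A \<subseteq> hyperplanes W" using insert by auto
    obtain q where q: "hpoly (k - int (disc_exponent H)) q" "\<And>x. g x = form H x ^ disc_exponent H * q x"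
      using divide_form_power[OF H g skew[OF H] order.refl] by blast
    obtain j where j: "hpoly (k - (\<Sum>H\<in>A. int (disc_exponent H)) - int (disc_exponent H)) j"
      "\<And>x. i x = form H x ^ disc_exponent H * j x"
      using divide_forms_coprime[OF H A insert.hyps(2) i(1) q(1), of disc_exponent "disc_exponent H"]
      by (metis i(2) q(2))
    then show ?case using insert.hyps i(2)
      by (intro exI[of _ j]) (simp add: mult_ac diff_diff_eq add.commute)
  qed
  from this[OF finite_hyperplanes order.refl] obtain i where i: "hpoly (k - discr_degree) i"
    "\<And>x. g x = discr x * i x" by (auto simp: discr_def discr_degree_def)
  have inv: "i (s *v x) = i x" if H: "H \<in> hyperplanes W" and s: "s \<in> fixator W H" for H s x
  proof (rule cancel_forms[OF order.refl hpoly_matrix[OF i(1)] i(1)])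
    fix x
    have "det s * discr (s *v x) * i (s *v x) = discr x * i x"
      using skew[OF H s, of x] by (simp add: i(2) mult.assoc)
    then show "(\<Prod>K\<in>hyperplanes W. form K x ^ disc_exponent K) * i (s *v x) =
        (\<Prod>K\<in>hyperplanes W. form K x ^ disc_exponent K) * i x"
      by (simp add: discr_reflection[OF H s] flip: discr_def)
  qed
  have "\<forall>x. i (w *v x) = i x" if "w \<in> W" for w
    using that
  proof (induction rule: W_induct)
    case (mult a b) then show ?case by (simp flip: matrix_vector_mul_assoc)
  qed (use inv in auto)
  then show ?thesis using i by (intro exI[of _ i]) simp
qed

lemma skew_proj_divisible:
  assumes "hpoly k f"
  obtains i where "hpoly (k - discr_degree) i" "\<And>x. skew_proj f x = discr x * i x"
    "\<And>w x. w \<in> W \<Longrightarrow> i (w *v x) = i x"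
proof -
  have "\<exists>i. hpoly (k - discr_degree) i \<and> (\<forall>x. skew_proj f x = discr x * i x) \<and>
      (\<forall>w\<in>W. \<forall>x. i (w *v x) = i x)"
    by (rule skew_divisible[OF skew_proj_hpoly[OF assms]]) (rule skew_proj_skew[OF subsetD[OF fixator_subset]])
  then obtain i where
    "hpoly (k - discr_degree) i" "\<forall>x. skew_proj f x = discr x * i x" "\<forall>w\<in>W. \<forall>x. i (w *v x) = i x"
    by (elim exE conjE)
  then show ?thesis using that[of i] by simp
qed

text \<open>The quotient of the skew part by \<open>discr\<close> would have negative
  degree.\<close>

lemma skew_proj_low_degree: "lowdeg discr_degree F \<Longrightarrow> skew_proj F x = 0"
proof -
  have "lowdeg k F \<Longrightarrow> k = discr_degree \<Longrightarrow> skew_proj F x = 0" for k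
  proof (induction rule: lowdeg.induct)
    case (hpoly j f k)
    obtain i where "hpoly (j - discr_degree) i" "\<And>x. skew_proj f x = discr x * i x"
      by (rule skew_proj_divisible[OF hpoly(1)]) (rule that)
    then show ?case using hpoly hpoly_negative[of "j - discr_degree" i x] by simp
  next
    case (add k f g)
    then show ?case by (simp add: skew_proj_def distrib_left sum.distrib)
  qed (simp add: skew_proj_def)
  then show "lowdeg discr_degree F \<Longrightarrow> skew_proj F x = 0" by blast
qed

text \<open>Descending induction on the degree: modulo the ideal, the top form is a multiple of the
  discriminant polynomial, which does not vanish at \<open>v\<close>.\<close>

lemma top_form_in_ideal:
  assumes v: "v \<in> Vreg W"
  shows "hpoly k f \<Longrightarrow> lowdeg k F \<Longrightarrow> (\<And>w. w \<in> W \<Longrightarrow> f (w *v v) + F (w *v v) = 0) \<Longrightarrow> inv_ideal k f"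
proof (induction "nat (int (CARD('n) * card W) - k)" arbitrary: k f F rule: less_induct)
  case less
  show ?case
  proof (cases "k \<ge> int (CARD('n) * card W)")
    case True then show ?thesis using inv_ideal_high_degree less.prems(1) by blast
  next
    case False
    \<comment> \<open>Multiplication of \<open>f + F\<close> by a form raises the degree by one and
      keeps the zeros on the orbit, so the induction hypothesis applies.\<close>
    have af: "inv_ideal (k + 1) (\<lambda>x. form H x * f x)" if "H \<in> hyperplanes W" for H
    proof (rule less.hyps)
      show "hpoly (k + 1) (\<lambda>x. form H x * f x)"
        using hpoly_mult[OF form_hpoly less.prems(1)] by (simp add: add.commute)
      show "lowdeg (k + 1) (\<lambda>x. form H x * F x)"
        using lowdeg_mult_hpoly[OF less.prems(2) form_hpoly] by (simp add: add.commute)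
      show "form H (w *v v) * f (w *v v) + form H (w *v v) * F (w *v v) = 0" if "w \<in> W" for w
        using less.prems(3)[OF that] by (simp flip: distrib_left)
    qed (use False in simp)
    note diff = inv_ideal_skew_proj[OF less.prems(1) af]
    have "inv_ideal k (skew_proj f)"
    proof -
      obtain i where i: "hpoly (k - discr_degree) i" "\<And>x. skew_proj f x = discr x * i x"
        "\<And>w x. w \<in> W \<Longrightarrow> i (w *v x) = i x"
        by (rule skew_proj_divisible[OF less.prems(1)]) (rule that)
      consider "k - discr_degree > 0" | "k - discr_degree < 0" | "k = discr_degree" by linarith
      then show ?thesis
      proof cases
        case 1
        have "inv_ideal (k - discr_degree + discr_degree) (\<lambda>x. i x * discr x)"
          by (rule inv_ideal.gen[OF i(1) 1 i(3) discr_hpoly])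
        moreover have "skew_proj f = (\<lambda>x. i x * discr x)" by (simp add: fun_eq_iff i(2))
        ultimately show ?thesis by simp
      next
        case 2
        then have "skew_proj f = (\<lambda>x. 0)" using hpoly_negative[OF i(1)] i(2) by (simp add: fun_eq_iff)
        then show ?thesis by (simp add: inv_ideal.zero)
      next
        case 3
        \<comment> \<open>The critical degree, where the skew part of \<open>f\<close> is
          \<open>c\<close> times \<open>discr\<close>. The skew projection of \<open>f + F\<close>
          at \<open>v\<close> combines values on the orbit, all zero, and \<open>F\<close>
          contributes nothing since its degree is too small.\<close>
        obtain c where c: "\<And>x. i x = c" using hpoly_degree_0 i(1) 3 by fastforce
        have "skew_proj f v + skew_proj F v = (\<Sum>w\<in>W. det w * (f (w *v v) + F (w *v v)))"
          by (simp add: skew_proj_def distrib_left sum.distrib)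
        then have "skew_proj f v = 0"
          using less.prems(3) skew_proj_low_degree[of F v] less.prems(2) 3 by simp
        then have "c = 0" using c i(2)[of v] discr_Vreg[OF v] by simp
        then have "skew_proj f = (\<lambda>x. 0)" using c i(2) by (simp add: fun_eq_iff)
        then show ?thesis by (simp add: inv_ideal.zero)
      qed
    qed
    then have "inv_ideal k (\<lambda>x. inverse (of_nat (card W)) *
        ((of_nat (card W) * f x - skew_proj f x) + skew_proj f x))"
      by (intro inv_ideal_scale inv_ideal.add diff)
    moreover have "inverse (of_nat (card W)) * ((of_nat (card W) * f x - skew_proj f x) + skew_proj f x) = f x" for x
      using card_W_pos by simp
    ultimately show ?thesis by (simp only:)
  qed
qed

text \<open>The ideal of the orbit of \<open>v\<close> is generated by invariants vanishing at \<open>v\<close>; therefore the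
  differential at \<open>v\<close> of any of its elements is invariant under the stabilizer of \<open>v\<close>.\<close>

definition sym_diff :: "complex^'n^'n \<Rightarrow> complex^'n \<Rightarrow> complex^'n \<Rightarrow> (complex^'n \<Rightarrow> complex) \<Rightarrow> bool" where
  "sym_diff w v y F \<longleftrightarrow> ((\<lambda>t. F (v + t *s y) - F (v + t *s (w *v y))) has_field_derivative 0) (at 0)"

lemma sym_diff_add: "sym_diff w v y F \<Longrightarrow> sym_diff w v y G \<Longrightarrow> sym_diff w v y (\<lambda>x. F x + G x)"
  unfolding sym_diff_def
  by (drule (1) DERIV_add) (simp add: algebra_simps)

text \<open>A generator \<open>i * g\<close> is corrected by replacing \<open>i\<close> with
  \<open>i - i v\<close>, which makes it vanish on the orbit and alters only lower degrees.
  Invariance of \<open>i\<close> turns the difference between the directions \<open>y\<close> and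
  \<open>w *v y\<close> into a product of two factors that are both zero at
  \<open>t = 0\<close>.\<close>

lemma inv_ideal_sym_diff:
  assumes w: "w \<in> W" "w *v v = v"
  shows "inv_ideal k f \<Longrightarrow> \<exists>F. lowdeg k (\<lambda>x. f x - F x) \<and> (\<forall>u\<in>W. F (u *v v) = 0) \<and> sym_diff w v y F"
proof (induction rule: inv_ideal.induct)
  case (gen j i k g)
  let ?F = "\<lambda>x. (i x - i v) * g x"
  have "lowdeg (j + k) (\<lambda>x. i v * g x)" using gen by (intro lowdeg.hpoly[OF hpoly_scale]) auto
  moreover have "sym_diff w v y ?F"
  proof -
    have vt: "v + t *s (w *v y) = w *v (v + t *s y)" for t
      by (simp add: w matrix_vector_right_distrib vector_scalar_commute)
    have eq: "?F (v + t *s y) - ?F (v + t *s (w *v y)) =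
        (i (v + t *s y) - i v) * (g (v + t *s y) - g (v + t *s (w *v y)))" for t
      by (simp only: vt gen(3)[OF w(1)]) (simp only: right_diff_distrib)
    obtain a where a: "((\<lambda>t. i (v + t *s y) - i v) has_field_derivative a) (at 0)"
      using field_differentiable_diff[OF hpoly_differentiable[OF gen(1), of v y 0] field_differentiable_const[of "i v"]]
      unfolding field_differentiable_def by blast
    obtain b where b: "((\<lambda>t. g (v + t *s y) - g (v + t *s (w *v y))) has_field_derivative b) (at 0)"
      using field_differentiable_diff[OF hpoly_differentiable[OF gen(4), of v y 0]
          hpoly_differentiable[OF gen(4), of v "w *v y" 0]]
      unfolding field_differentiable_def by blast
    from DERIV_mult[OF a b] show ?thesis by (simp add: sym_diff_def eq)
  qed
  ultimately show ?case using gen(3)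
    by (intro exI[of _ ?F]) (simp add: algebra_simps)
next
  case zero show ?case by (intro exI[of _ "\<lambda>x. 0"]) (simp add: lowdeg.zero sym_diff_def)
next
  case (add k f g)
  then obtain F G where "lowdeg k (\<lambda>x. f x - F x)" "\<forall>u\<in>W. F (u *v v) = 0" "sym_diff w v y F"
    "lowdeg k (\<lambda>x. g x - G x)" "\<forall>u\<in>W. G (u *v v) = 0" "sym_diff w v y G" by blast
  then show ?case using lowdeg.add[of k "\<lambda>x. f x - F x" "\<lambda>x. g x - G x"]
    by (intro exI[of _ "\<lambda>x. F x + G x"]) (simp add: sym_diff_add algebra_simps)
qed

text \<open>Descent on the degree: the top form lies in the ideal and is replaced by a function
  \<open>F'\<close> of the same kind, after which the remainder has smaller degree and still
  vanishes on the orbit.\<close>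

lemma vanishing_sym_diff:
  assumes v: "v \<in> Vreg W" and w: "w \<in> W" "w *v v = v"
  shows "lowdeg k F \<Longrightarrow> (\<And>u. u \<in> W \<Longrightarrow> F (u *v v) = 0) \<Longrightarrow> sym_diff w v y F"
proof (induction "nat k" arbitrary: k F)
  case 0
  then have "F = (\<lambda>x. 0)" using lowdeg_nonpos by simp
  then show ?case by (simp add: sym_diff_def)
next
  case (Suc n)
  obtain f G where fG: "hpoly (k - 1) f" "lowdeg (k - 1) G" "F = (\<lambda>x. f x + G x)"
    using lowdeg_Suc[OF Suc.prems(1)] by blast
  then have "inv_ideal (k - 1) f" using top_form_in_ideal[OF v fG(1,2)] Suc.prems(2) by simp
  then obtain F' where F': "lowdeg (k - 1) (\<lambda>x. f x - F' x)" "\<forall>u\<in>W. F' (u *v v) = 0" "sym_diff w v y F'"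
    using inv_ideal_sym_diff[OF w] by blast
  have "sym_diff w v y (\<lambda>x. (f x - F' x) + G x)"
    using Suc.hyps(2) Suc.prems(2) F'(2) fG(3) by (intro Suc.hyps(1)[of "k - 1"] lowdeg.add F'(1) fG(2)) auto
  then have "sym_diff w v y (\<lambda>x. F' x + ((f x - F' x) + G x))" by (rule sym_diff_add[OF F'(3)])
  then show ?case by (simp add: fG(3))
qed

text \<open>Choose \<open>q\<close> zero on the orbit except at \<open>v\<close>. Then
  \<open>x $ i - v $ i\<close> times \<open>q\<close> vanishes on the orbit, and its differential at
  \<open>v\<close> is a nonzero multiple of the coordinate \<open>i\<close>; hence \<open>w\<close>
  preserves every coordinate.\<close>

theorem steinberg_free:
  assumes v: "v \<in> Vreg W" and w: "w \<in> W" "w *v v = v" shows "w = mat 1"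
proof -
  define O' where "O' = orbit W v - {v}"
  have fin: "finite O'" using finite_W by (simp add: O'_def orbit_def)
  have "\<forall>u\<in>O'. \<exists>j. u $ j \<noteq> v $ j" by (auto simp: O'_def vec_eq_iff)
  then obtain l where l: "\<And>u. u \<in> O' \<Longrightarrow> u $ l u \<noteq> v $ l u" by metis
  define q where "q x = (\<Prod>u\<in>O'. x $ l u - u $ l u)" for x :: "complex^'n"
  \<comment> \<open>The bound is 2 for a polynomial of degree 1 because \<open>lowdeg\<close> is
    strict.\<close>
  have low1: "lowdeg 2 (\<lambda>x. x $ i - a)" for i :: 'n and a
    using lowdeg.add[OF lowdeg.hpoly[OF hpoly_coord[of i], of 2] lowdeg.hpoly[OF hpoly.const[of "- a"], of 2]] by simp
  obtain k where k: "lowdeg k q" using lowdeg_prod[OF fin, of "\<lambda>u x. x $ l u - u $ l u"] low1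
    by (auto simp: q_def[abs_def])
  have "v $ l u - u $ l u \<noteq> 0" if "u \<in> O'" for u using l[OF that] by auto
  then have qv: "q v \<noteq> 0" using fin by (simp add: q_def)
  have "(w *v y) $ i = y $ i" for y i
  proof -
    define F where "F x = (x $ i - v $ i) * q x" for x
    have lowF: "lowdeg (2 + k) F" unfolding F_def by (rule lowdeg_mult[OF low1 k])
    have "F (u *v v) = 0" if u: "u \<in> W" for u
    proof (cases "u *v v = v")
      case False
      then have "u *v v \<in> O'" using u by (auto simp: O'_def orbit_def)
      then have "q (u *v v) = 0" using fin by (auto simp: q_def)
      then show ?thesis by (simp add: F_def)
    qed (simp add: F_def)
    then have sd: "sym_diff w v y F" by (rule vanishing_sym_diff[OF v w lowF])
    have dF: "((\<lambda>t. F (v + t *s z)) has_field_derivative z $ i * q v) (at 0)" for z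
    proof -
      have "(\<lambda>t. q (v + t *s z)) field_differentiable (at 0)"
      proof -
        have "lowdeg k r \<Longrightarrow> (\<lambda>t. r (v + t *s z)) field_differentiable (at 0)" for r k
          by (induction rule: lowdeg.induct) (auto intro: hpoly_differentiable field_differentiable_add)
        then show ?thesis using k by blast
      qed
      then obtain b where b: "((\<lambda>t. q (v + t *s z)) has_field_derivative b) (at 0)"
        by (auto simp: field_differentiable_def)
      have "((\<lambda>t. t * z $ i) has_field_derivative z $ i) (at 0)"
        by (auto intro!: derivative_eq_intros)
      from DERIV_mult[OF this b] show ?thesis by (simp add: F_def mult_ac)
    qed
    have "y $ i * q v - (w *v y) $ i * q v = 0"
      using DERIV_unique[OF DERIV_diff[OF dF[of y] dF[of "w *v y"]]] sd by (simp add: sym_diff_def)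
    then show ?thesis using qv by simp
  qed
  then show ?thesis by (intro matrix_eq[THEN iffD2]) (simp add: vec_eq_iff)
qed

end

section \<open>The covering of the orbit space\<close>

text \<open>A finite set is determined by its distance function; subtracting the norm makes the latter bounded,
  so that the orbit space embeds into a normed space (Kuratowski).\<close>

definition kuratowski :: "'a::real_normed_vector set \<Rightarrow> 'a \<Rightarrow>\<^sub>C real" where
  "kuratowski A = Bcontfun (\<lambda>x. infdist x A - infdist x {0})"

lemma infdist_Hausdorff:
  assumes "A \<noteq> {}" "\<And>a. a \<in> A \<Longrightarrow> infdist a B \<le> M"
  shows "infdist x B \<le> infdist x A + M"
proof -
  have "infdist x B - M \<le> (INF a\<in>A. dist x a)"
  proof (rule cINF_greatest[OF assms(1)])
    fix a assume "a \<in> A"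
    then show "infdist x B - M \<le> dist x a"
      using infdist_triangle[of x B a] assms(2)[of a] by simp
  qed
  then show ?thesis using assms(1) by (simp add: infdist_notempty)
qed

lemma kuratowski_apply:
  assumes "finite A" "A \<noteq> {}"
  shows "apply_bcontfun (kuratowski A) x = infdist x A - infdist x {0}"
proof -
  \<comment> \<open>A common bound for the two one-sided Hausdorff distances between
    \<open>A\<close> and \<open>{0}\<close>.\<close>
  define M where "M = (\<Sum>a\<in>A. norm a) + infdist 0 A"
  have M: "norm a \<le> M" if "a \<in> A" for a
    using member_le_sum[OF that, of norm] assms infdist_nonneg[of 0 A] by (simp add: M_def)
  have M0: "infdist 0 A \<le> M" by (simp add: M_def sum_nonneg)
  have "\<bar>infdist x A - infdist x {0}\<bar> \<le> M" for x
    using infdist_Hausdorff[OF assms(2), of "{0}" M x] infdist_Hausdorff[of "{0}" A M x] M M0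
    by (simp add: abs_le_iff)
  then have "bounded (range (\<lambda>x. infdist x A - infdist x {0}))"
    by (auto simp: bounded_iff intro!: exI[of _ M])
  then have "(\<lambda>x. infdist x A - infdist x {0}) \<in> bcontfun"
    by (auto simp: bcontfun_def intro!: continuous_intros)
  then show ?thesis by (simp add: kuratowski_def Bcontfun_inverse)
qed

lemma dist_kuratowski_le:
  assumes "finite A" "A \<noteq> {}" "finite B" "B \<noteq> {}"
    and "\<And>a. a \<in> A \<Longrightarrow> infdist a B \<le> M" "\<And>b. b \<in> B \<Longrightarrow> infdist b A \<le> M"
  shows "dist (kuratowski A) (kuratowski B) \<le> M"
proof (rule dist_bound)
  fix x show "dist (kuratowski A x) (kuratowski B x) \<le> M"
    using infdist_Hausdorff[of A B M x] infdist_Hausdorff[of B A M x] assms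
    by (simp add: kuratowski_apply dist_real_def abs_le_iff)
qed

text \<open>At a point of \<open>A\<close> the distance to \<open>A\<close> is zero and the norm
  terms cancel, so the two functions differ there by exactly the distance to
  \<open>B\<close>.\<close>

lemma infdist_le_dist_kuratowski:
  assumes "finite A" "finite B" "B \<noteq> {}" "a \<in> A"
  shows "infdist a B \<le> dist (kuratowski A) (kuratowski B)"
proof -
  have "A \<noteq> {}" using assms by blast
  then have "dist (kuratowski A a) (kuratowski B a) = infdist a B"
    using assms infdist_nonneg[of a B] by (simp add: kuratowski_apply dist_real_def)
  then show ?thesis using dist_bounded[of "kuratowski A" a "kuratowski B"] by simp
qed

lemma hpoly_continuous: "hpoly k f \<Longrightarrow> continuous_on A f"
  by (induction rule: hpoly.induct) (auto intro!: continuous_intros)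

context hermitian_reflection_group
begin

section \<open>A model of the orbit space in a normed space, and its covering\<close>

lemma orbit_finite: "finite (orbit W x)" "orbit W x \<noteq> {}"
  using finite_W W_one by (auto simp: orbit_def)

lemma orbit_act: "w \<in> W \<Longrightarrow> orbit W (w *v x) = orbit W x"
  using orbit_eq_iff by metis

lemma act_continuous: "continuous_on A (\<lambda>x. w *v x :: complex^'n)"
  by (rule linear_continuous_on[OF matrix_vector_mul_bounded_linear])

lemma open_Vreg: "open (Vreg W)"
proof -
  have "closed H" if "H \<in> hyperplanes W" for H
  proof -
    have "H = form H -` {0}" using form_iff[OF that] by auto
    moreover have "closed (form H -` {0})"
      by (rule continuous_closed_vimage) (use hpoly_continuous[OF form_hpoly, of UNIV H] in \<open>auto simp: continuous_on_eq_continuous_at\<close>)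
    ultimately show ?thesis by simp
  qed
  then have "closed (\<Union>(hyperplanes W))" using finite_hyperplanes by blast
  then show ?thesis by (simp add: Vreg_def open_Diff)
qed

definition orbit_emb :: "complex^'n \<Rightarrow> (complex^'n) \<Rightarrow>\<^sub>C real" where
  "orbit_emb x = kuratowski (orbit W x)"

lemma orbit_emb_eq_iff: "orbit_emb x = orbit_emb y \<longleftrightarrow> orbit W x = orbit W y"
proof
  assume "orbit_emb x = orbit_emb y"
  moreover have "x \<in> orbit W x" using W_one by (force simp: orbit_def)
  ultimately have "infdist x (orbit W y) \<le> 0"
    using infdist_le_dist_kuratowski[OF orbit_finite(1) orbit_finite(1) orbit_finite(2)]
    by (metis orbit_emb_def dist_self)
  then have "x \<in> orbit W y"
    using in_closed_iff_infdist_zero[OF finite_imp_closed[OF orbit_finite(1)] orbit_finite(2)] infdist_nonneg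
    by (metis order.antisym)
  then obtain w where "w \<in> W" "x = w *v y" by (auto simp: orbit_def)
  then show "orbit W x = orbit W y" by (simp add: orbit_act)
qed (simp add: orbit_emb_def)

lemma orbit_emb_continuous: "continuous_on A orbit_emb"
proof -
  \<comment> \<open>The sum dominates the operator norm of every element of \<open>W\<close> and
    serves as a Lipschitz constant.\<close>
  define K where "K = (\<Sum>w\<in>W. onorm ((*v) w :: complex^'n \<Rightarrow> complex^'n))"
  have bl: "bounded_linear ((*v) w :: complex^'n \<Rightarrow> complex^'n)" for w
    by (rule matrix_vector_mul_bounded_linear)
  have K: "onorm ((*v) w :: complex^'n \<Rightarrow> complex^'n) \<le> K" if "w \<in> W" for w
    unfolding K_def by (rule member_le_sum[OF that]) (auto simp: onorm_pos_le[OF bl] finite_W)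
  have d: "dist (w *v x) (w *v y) \<le> K * dist x y" if "w \<in> W" for w and x y :: "complex^'n"
  proof -
    have "dist (w *v x) (w *v y) \<le> onorm ((*v) w) * dist x y"
      using onorm[OF bl, of w "x - y"] by (simp add: dist_norm matrix_vector_mult_diff_distrib)
    also have "\<dots> \<le> K * dist x y" using K[OF that] by (intro mult_right_mono) auto
    finally show ?thesis .
  qed
  have inf: "infdist a (orbit W y) \<le> K * dist x y" if "a \<in> orbit W x" for a x y
    using that d by (auto simp: orbit_def intro: infdist_le2)
  have "dist (orbit_emb x) (orbit_emb y) \<le> K * dist x y" for x y
    unfolding orbit_emb_def
    by (rule dist_kuratowski_le) (use orbit_finite inf inf[of _ y x] in \<open>auto simp: dist_commute\<close>)
  moreover have "K \<ge> 0" unfolding K_def by (intro sum_nonneg onorm_pos_le bl)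
  ultimately have "K-lipschitz_on A orbit_emb" by (intro lipschitz_onI) auto
  then show ?thesis by (rule lipschitz_on_continuous_on)
qed

text \<open>An orbit whose image is close to that of \<open>u\<close> has a member close to
  \<open>u\<close>, hence in \<open>T\<close>, and all members of an orbit have the same
  image.\<close>

lemma orbit_emb_open:
  assumes "open T" "T \<subseteq> Vreg W"
  shows "openin (top_of_set (orbit_emb ` Vreg W)) (orbit_emb ` T)"
  unfolding openin_euclidean_subtopology_iff
proof (intro conjI ballI)
  show "orbit_emb ` T \<subseteq> orbit_emb ` Vreg W" using assms by blast
  fix y assume "y \<in> orbit_emb ` T"
  then obtain u where u: "u \<in> T" "y = orbit_emb u" by blast
  obtain e where e: "e > 0" "ball u e \<subseteq> T" using assms u open_contains_ball by blast
  show "\<exists>e>0. \<forall>x'\<in>orbit_emb ` Vreg W. dist x' y < e \<longrightarrow> x' \<in> orbit_emb ` T"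
  proof (intro exI[of _ e] conjI ballI impI)
    fix x' assume "x' \<in> orbit_emb ` Vreg W" and d: "dist x' y < e"
    then obtain x where x: "x' = orbit_emb x" by blast
    have "u \<in> orbit W u" using W_one by (force simp: orbit_def)
    then have "infdist u (orbit W x) < e"
      using infdist_le_dist_kuratowski[OF orbit_finite(1)[of u] orbit_finite(1)[of x] orbit_finite(2), of u] d
      by (simp add: x u(2) orbit_emb_def dist_commute)
    then obtain b where "b \<in> orbit W x" "dist u b < e"
      using infdist_attains_inf[OF finite_imp_closed[OF orbit_finite(1)] orbit_finite(2)] by metis
    then obtain w where "w \<in> W" "w *v x \<in> T" using e by (auto simp: orbit_def)
    then show "x' \<in> orbit_emb ` T"
      by (intro image_eqI[of _ _ "w *v x"]) (simp_all add: x orbit_emb_eq_iff orbit_act)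
  qed (use e in simp)
qed

lemma slice_exists:
  assumes v: "v \<in> Vreg W"
  obtains U where "open U" "v \<in> U" "U \<subseteq> Vreg W"
    "\<And>x y w. x \<in> U \<Longrightarrow> y \<in> U \<Longrightarrow> w \<in> W \<Longrightarrow> y = w *v x \<Longrightarrow> w = mat 1"
proof -
  \<comment> \<open>\<open>insert 1\<close> keeps the minimum meaningful when \<open>W\<close> is
    trivial.\<close>
  define D where "D = insert 1 ((\<lambda>w. dist (w *v v) v) ` (W - {mat 1}))"
  define e where "e = Min D / 2"
  have fin: "finite D" "D \<noteq> {}" using finite_W by (auto simp: D_def)
  have pos: "\<forall>d\<in>D. d > 0" using steinberg_free[OF v] by (auto simp: D_def)
  then have "Min D > 0" using Min_in[OF fin] by blast
  then have e: "e > 0" by (simp add: e_def)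
  have far: "dist (w *v v) v > e" if "w \<in> W" "w \<noteq> mat 1" for w
  proof -
    have "Min D \<le> dist (w *v v) v" using that fin by (intro Min_le) (auto simp: D_def)
    then show ?thesis using \<open>Min D > 0\<close> by (simp add: e_def)
  qed
  \<comment> \<open>Points closer than \<open>e\<close> to \<open>v\<close> whose nontrivial
    translates stay farther than \<open>e\<close> from \<open>v\<close>; so no nontrivial translate
    of such a point is again one.\<close>
  define U where "U = Vreg W \<inter> ball v e \<inter> (\<Inter>w\<in>W - {mat 1}. {x. dist (w *v x) v > e})"
  have "open {x. dist (w *v x) v > e}" for w
    by (intro open_Collect_less continuous_on_dist act_continuous continuous_on_const)
  then have oU: "open U" unfolding U_def using finite_W by (intro open_Int open_Vreg open_ball open_INT) auto
  have vU: "v \<in> U" using v e far by (auto simp: U_def)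
  have UV: "U \<subseteq> Vreg W" by (auto simp: U_def)
  have sep: "w = mat 1" if "x \<in> U" "y \<in> U" "w \<in> W" "y = w *v x" for x y w
    using that by (force simp: U_def dist_commute)
  show ?thesis by (rule that[OF oU vU UV sep])
qed

text \<open>Over the image of a slice \<open>U\<close> the sheets are the translates of
  \<open>U\<close>. The slice property makes different translates disjoint and the map injective on
  each.\<close>

lemma covering_orbit_emb: "covering_space (Vreg W) orbit_emb (orbit_emb ` Vreg W)"
proof
  show "continuous_on (Vreg W) orbit_emb" by (rule orbit_emb_continuous)
next
  fix y assume "y \<in> orbit_emb ` Vreg W"
  then obtain v where v: "v \<in> Vreg W" "y = orbit_emb v" by blast
  obtain U where U: "open U" "v \<in> U" "U \<subseteq> Vreg W"
    "\<And>x y w. x \<in> U \<Longrightarrow> y \<in> U \<Longrightarrow> w \<in> W \<Longrightarrow> y = w *v x \<Longrightarrow> w = mat 1"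
    using slice_exists[OF v(1)] by metis
  define sheet where "sheet w = (*v) w ` U" for w :: "complex^'n^'n"
  let ?T = "orbit_emb ` U" and ?V = "sheet ` W"
  have emb_sheet: "orbit_emb (w *v x) = orbit_emb x" if "w \<in> W" for w x
    using that by (simp add: orbit_emb_eq_iff orbit_act)
  have sheet_open: "open (sheet w)" if "w \<in> W" for w
  proof -
    obtain u where u: "u \<in> W" "w ** u = mat 1" "u ** w = mat 1" using W_inverse[OF \<open>w \<in> W\<close>] by blast
    have "sheet w = (\<lambda>x. u *v x) -` U"
    proof
      show "sheet w \<subseteq> (\<lambda>x. u *v x) -` U" using u by (auto simp: sheet_def matrix_vector_mul_assoc)
      show "(\<lambda>x. u *v x) -` U \<subseteq> sheet w"
      proof
        fix x assume "x \<in> (\<lambda>x. u *v x) -` U"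
        then show "x \<in> sheet w" unfolding sheet_def using u
          by (intro image_eqI[of _ _ "u *v x"]) (auto simp: matrix_vector_mul_assoc)
      qed
    qed
    then show ?thesis using open_vimage[OF U(1) act_continuous] by simp
  qed
  have sheet_sub: "sheet w \<subseteq> Vreg W" if "w \<in> W" for w
    using that U(3) Vreg_invariant by (auto simp: sheet_def)
  have uniq: "x = x' \<and> w = w'" if "w \<in> W" "w' \<in> W" "x \<in> U" "x' \<in> U" "w *v x = w' *v x'" for w w' x x'
  proof -
    obtain u where u: "u \<in> W" "w' ** u = mat 1" "u ** w' = mat 1" using W_inverse[OF \<open>w' \<in> W\<close>] by blast
    have "u *v (w *v x) = u *v (w' *v x')" using that by simp
    then have x': "x' = (u ** w) *v x" using u by (simp add: matrix_vector_mul_assoc)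
    then have "u ** w = mat 1" using U(4)[OF that(3,4)] W_mult u that by blast
    then have "w = (w' ** u) ** w" using u by simp
    also have "\<dots> = w'" using \<open>u ** w = mat 1\<close> by (simp flip: matrix_mul_assoc)
    finally show ?thesis using x' \<open>u ** w = mat 1\<close> by simp
  qed
  show "\<exists>T. y \<in> T \<and> openin (top_of_set (orbit_emb ` Vreg W)) T \<and>
      (\<exists>v. \<Union>v = Vreg W \<inter> orbit_emb -` T \<and> (\<forall>u\<in>v. openin (top_of_set (Vreg W)) u) \<and>
        pairwise disjnt v \<and> (\<forall>u\<in>v. \<exists>q. homeomorphism u T orbit_emb q))"
  proof (intro exI[of _ ?T] exI[of _ ?V] conjI ballI)
    show "y \<in> ?T" using v U by blast
    show op: "openin (top_of_set (orbit_emb ` Vreg W)) ?T" by (rule orbit_emb_open[OF U(1,3)])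
    show "\<Union>?V = Vreg W \<inter> orbit_emb -` ?T"
    proof
      show "\<Union>?V \<subseteq> Vreg W \<inter> orbit_emb -` ?T" using sheet_sub emb_sheet by (auto simp: sheet_def)
      show "Vreg W \<inter> orbit_emb -` ?T \<subseteq> \<Union>?V"
      proof
        fix x assume "x \<in> Vreg W \<inter> orbit_emb -` ?T"
        then obtain a where "a \<in> U" "orbit_emb a = orbit_emb x" by auto
        then obtain w where "w \<in> W" "x = w *v a" by (auto simp: orbit_emb_eq_iff orbit_eq_iff)
        then show "x \<in> \<Union>?V" using \<open>a \<in> U\<close> by (auto simp: sheet_def)
      qed
    qed
    show "openin (top_of_set (Vreg W)) u" if "u \<in> ?V" for u
      using that sheet_open sheet_sub by (auto intro: open_subset)
    show "pairwise disjnt ?V"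
    proof (rule pairwiseI)
      fix A B assume "A \<in> ?V" "B \<in> ?V" "A \<noteq> B"
      then obtain w w' where ww: "w \<in> W" "w' \<in> W" "A = sheet w" "B = sheet w'" "w \<noteq> w'" by blast
      have "x \<notin> B" if "x \<in> A" for x
        using that uniq[OF ww(1,2)] ww(3-5) by (auto simp: sheet_def)
      then show "disjnt A B" by (auto simp: disjnt_def)
    qed
    show "\<exists>q. homeomorphism u ?T orbit_emb q" if u: "u \<in> ?V" for u
    proof -
      obtain w where w: "w \<in> W" "u = sheet w" using u by blast
      have img: "orbit_emb ` u = ?T" by (simp add: w(2) sheet_def image_image emb_sheet[OF w(1)])
      have inj: "inj_on orbit_emb u"
      proof (rule inj_onI)
        fix a b assume "a \<in> u" "b \<in> u" and eq: "orbit_emb a = orbit_emb b"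
        then obtain a' b' where ab: "a' \<in> U" "b' \<in> U" "a = w *v a'" "b = w *v b'" by (auto simp: w(2) sheet_def)
        obtain w' where w': "w' \<in> W" "b' = w' *v a'"
          using eq ab emb_sheet[OF w(1)] by (auto simp: orbit_emb_eq_iff orbit_eq_iff)
        have "w' = mat 1" by (rule U(4)[OF ab(1,2) w'])
        then show "a = b" using w' ab by simp
      qed
      have "openin (top_of_set ?T) (orbit_emb ` S)" if "openin (top_of_set u) S" for S
      proof -
        have "open S" "S \<subseteq> u" using that sheet_open[OF w(1)] w(2) openin_open_eq[of u] by auto
        then have "openin (top_of_set (orbit_emb ` Vreg W)) (orbit_emb ` S)"
          using sheet_sub[OF w(1)] w(2) by (intro orbit_emb_open) auto
        moreover have "orbit_emb ` S \<subseteq> ?T" unfolding img[symmetric] by (rule image_mono[OF \<open>S \<subseteq> u\<close>])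
        ultimately show ?thesis using image_mono[OF U(3)] by (rule openin_subset_trans)
      qed
      from homeomorphism_injective_open_map[OF orbit_emb_continuous img inj this]
      show ?thesis by blast
    qed
  qed
qed simp

end

section \<open>The braid group through lifted paths\<close>

lemma pathin_top_of_set: "pathin (top_of_set S) g \<longleftrightarrow> path g \<and> path_image g \<subseteq> S"
  by (auto simp: pathin_def path_def path_image_def continuous_map_subtopology_eu)

lemma path_class_self: "pathin X f \<Longrightarrow> f \<in> path_class X f"
  by (simp add: path_class_def pathin_def)

lemma path_class_eqI:
  assumes "g \<in> path_class X f" shows "path_class X g = path_class X f"
proof -
  have h: "homotopic_with (\<lambda>r. r 0 = f 0 \<and> r 1 = f 1) (top_of_set {0..1}) X f g"
    using assms by (simp add: path_class_def)
  have e: "g 0 = f 0" "g 1 = f 1" using homotopic_with_imp_property[OF h] by blast+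
  show ?thesis
  proof
    show "path_class X g \<subseteq> path_class X f"
      unfolding path_class_def e using homotopic_with_trans[OF h] by blast
    show "path_class X f \<subseteq> path_class X g"
      unfolding path_class_def e using homotopic_with_trans[OF homotopic_with_symD[OF h]] by blast
  qed
qed

lemma path_class_cong:
  assumes "pathin X f" "\<And>t. t \<in> {0..1} \<Longrightarrow> f t = g t" shows "path_class X f = path_class X g"
proof -
  have "homotopic_with (\<lambda>r. r 0 = f 0 \<and> r 1 = f 1) (top_of_set {0..1}) X f g"
    using assms by (intro homotopic_with_equal) (auto simp: pathin_def)
  then show ?thesis using path_class_eqI[of g X f] by (simp add: path_class_def)
qed

locale braid_setup = hermitian_reflection_group W ip root
  for W :: "(complex^'n^'n) set" and ip and root :: "(complex^'n) set \<Rightarrow> complex^'n" +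
  fixes x0 :: "complex^'n"
  assumes x0: "x0 \<in> Vreg W"
begin

section \<open>Lifting from the quotient topology through the embedded model\<close>

lemma topspace_Vreg_mod: "topspace (Vreg_mod W) = orbit W ` Vreg W"
proof
  show "topspace (Vreg_mod W) \<subseteq> orbit W ` Vreg W"
    using openin_Vreg_mod[THEN iffD1, OF openin_topspace] by blast
  have "{v \<in> Vreg W. orbit W v \<in> orbit W ` Vreg W} = Vreg W" by blast
  then have "openin (Vreg_mod W) (orbit W ` Vreg W)" by (simp add: openin_Vreg_mod)
  then show "orbit W ` Vreg W \<subseteq> topspace (Vreg_mod W)" by (rule openin_subset)
qed

lemma continuous_orbit: "continuous_map (top_of_set (Vreg W)) (Vreg_mod W) (orbit W)"
  by (auto simp: continuous_map_def topspace_Vreg_mod openin_Vreg_mod)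

text \<open>An instance of the quotient property, since composition with \<open>orbit W\<close>
  gives \<open>orbit_emb\<close>. It carries paths and homotopies of the abstract quotient to the
  model, where they can be lifted.\<close>

lemma continuous_kuratowski:
  "continuous_map (Vreg_mod W) (top_of_set (orbit_emb ` Vreg W)) kuratowski"
  unfolding continuous_map_def
proof (intro conjI allI impI)
  show "kuratowski \<in> topspace (Vreg_mod W) \<rightarrow> topspace (top_of_set (orbit_emb ` Vreg W))"
    by (auto simp: topspace_Vreg_mod orbit_emb_def)
  fix U :: "((complex^'n) \<Rightarrow>\<^sub>C real) set" assume U: "openin (top_of_set (orbit_emb ` Vreg W)) U"
  have "{v \<in> Vreg W. orbit W v \<in> {A \<in> topspace (Vreg_mod W). kuratowski A \<in> U}} = Vreg W \<inter> orbit_emb -` U"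
    by (auto simp: topspace_Vreg_mod orbit_emb_def)
  moreover have "openin (top_of_set (Vreg W)) (Vreg W \<inter> orbit_emb -` U)"
    using orbit_emb_continuous U by (intro continuous_openin_preimage[where T = "orbit_emb ` Vreg W"]) auto
  ultimately show "openin (Vreg_mod W) {A \<in> topspace (Vreg_mod W). kuratowski A \<in> U}"
    by (auto simp: openin_Vreg_mod topspace_Vreg_mod)
qed

lemma pathin_orbit: "path g \<Longrightarrow> path_image g \<subseteq> Vreg W \<Longrightarrow> pathin (Vreg_mod W) (orbit W \<circ> g)"
  by (intro pathin_compose[OF _ continuous_orbit]) (simp add: pathin_top_of_set)

lemma lift_path:
  assumes f: "pathin (Vreg_mod W) f" and x: "x \<in> Vreg W" "f 0 = orbit W x"
  obtains h where "path h" "path_image h \<subseteq> Vreg W" "pathstart h = x"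
    "\<And>t. t \<in> {0..1} \<Longrightarrow> orbit W (h t) = f t"
proof -
  have p: "path (kuratowski \<circ> f)" "path_image (kuratowski \<circ> f) \<subseteq> orbit_emb ` Vreg W"
    using pathin_compose[OF f continuous_kuratowski] by (auto simp: pathin_top_of_set)
  have "pathstart (kuratowski \<circ> f) = orbit_emb x" by (simp add: pathstart_def x orbit_emb_def)
  then obtain h where h: "path h" "path_image h \<subseteq> Vreg W" "pathstart h = x"
    "\<And>t. t \<in> {0..1} \<Longrightarrow> orbit_emb (h t) = (kuratowski \<circ> f) t"
    using covering_space_lift_path_strong[OF covering_orbit_emb x(1) p] by metis
  have "orbit W (h t) = f t" if t: "t \<in> {0..1}" for t
  proof -
    obtain y where "f t = orbit W y"
      using funcset_mem[OF path_image_subset_topspace[OF f] t] by (auto simp: topspace_Vreg_mod)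
    then show ?thesis using h(4)[OF t] by (simp add: orbit_emb_eq_iff flip: orbit_emb_def)
  qed
  then show ?thesis using that h by blast
qed

lemma lift_homotopy:
  assumes g: "path g" "path_image g \<subseteq> Vreg W" and h: "path h" "path_image h \<subseteq> Vreg W"
    and st: "pathstart g = pathstart h"
    and hom: "orbit W \<circ> h \<in> path_class (Vreg_mod W) (orbit W \<circ> g)"
  shows "homotopic_paths (Vreg W) g h"
proof (rule covering_space_lift_homotopic_paths[OF covering_orbit_emb _ _ _ _ _ g _ h _ st])
  have "homotopic_with (\<lambda>r. r 0 = (orbit W \<circ> g) 0 \<and> r 1 = (orbit W \<circ> g) 1) (top_of_set {0..1}) (Vreg_mod W)
      (orbit W \<circ> g) (orbit W \<circ> h)"
    using hom by (simp add: path_class_def)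
  then have "homotopic_with (\<lambda>r. r 0 = orbit_emb (g 0) \<and> r 1 = orbit_emb (g 1)) (top_of_set {0..1})
      (top_of_set (orbit_emb ` Vreg W)) (kuratowski \<circ> (orbit W \<circ> g)) (kuratowski \<circ> (orbit W \<circ> h))"
    by (rule homotopic_with_compose_continuous_map_left[OF _ continuous_kuratowski]) (auto simp: orbit_emb_def)
  moreover have "kuratowski \<circ> (orbit W \<circ> g) = orbit_emb \<circ> g" for g :: "real \<Rightarrow> complex^'n"
    by (auto simp: orbit_emb_def)
  ultimately show "homotopic_paths (orbit_emb ` Vreg W) (orbit_emb \<circ> g) (orbit_emb \<circ> h)"
    by (simp add: homotopic_paths_def pathstart_def pathfinish_def)
  then show "path (orbit_emb \<circ> g)" "path_image (orbit_emb \<circ> g) \<subseteq> orbit_emb ` Vreg W"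
    "path (orbit_emb \<circ> h)" "path_image (orbit_emb \<circ> h) \<subseteq> orbit_emb ` Vreg W"
    using homotopic_paths_imp_path homotopic_paths_imp_subset by blast+
qed simp_all

section \<open>Braids as classes of lifted paths\<close>

abbreviation "B \<equiv> braid_group W x0"

text \<open>The group element is recorded with the path because the product of two braids translates
  the second lift by it.\<close>

definition is_lift :: "(real \<Rightarrow> complex^'n) \<Rightarrow> complex^'n^'n \<Rightarrow> bool" where
  "is_lift g w \<longleftrightarrow> path g \<and> path_image g \<subseteq> Vreg W \<and> pathstart g = x0 \<and> pathfinish g = w *v x0 \<and> w \<in> W"

definition braid :: "(real \<Rightarrow> complex^'n) \<Rightarrow> (real \<Rightarrow> (complex^'n) set) set" where
  "braid g = path_class (Vreg_mod W) (orbit W \<circ> g)"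

lemma braid_eqI: "homotopic_paths (Vreg W) g h \<Longrightarrow> braid g = braid h"
proof -
  assume "homotopic_paths (Vreg W) g h"
  then have "homotopic_with (\<lambda>r. r 0 = g 0 \<and> r 1 = g 1) (top_of_set {0..1}) (top_of_set (Vreg W)) g h"
    by (simp add: homotopic_paths_def pathstart_def pathfinish_def)
  then have "homotopic_with (\<lambda>r. r 0 = (orbit W \<circ> g) 0 \<and> r 1 = (orbit W \<circ> g) 1) (top_of_set {0..1}) (Vreg_mod W)
      (orbit W \<circ> g) (orbit W \<circ> h)"
    by (rule homotopic_with_compose_continuous_map_left[OF _ continuous_orbit]) auto
  then have "orbit W \<circ> h \<in> path_class (Vreg_mod W) (orbit W \<circ> g)" by (simp add: path_class_def)
  from path_class_eqI[OF this] show ?thesis by (simp add: braid_def)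
qed

lemma is_lift_unique: "is_lift g w \<Longrightarrow> is_lift g w' \<Longrightarrow> w = w'"
proof -
  assume a: "is_lift g w" "is_lift g w'"
  then obtain u where u: "u \<in> W" "w' ** u = mat 1" "u ** w' = mat 1" using W_inverse by (auto simp: is_lift_def)
  have "u *v (w *v x0) = u *v (w' *v x0)" using a by (simp add: is_lift_def)
  then have "(u ** w) *v x0 = x0" using u by (simp add: matrix_vector_mul_assoc)
  then have "u ** w = mat 1" using steinberg_free[OF x0] W_mult a u by (auto simp: is_lift_def)
  have "w = (w' ** u) ** w" using u by simp
  also have "\<dots> = w'" using \<open>u ** w = mat 1\<close> by (simp flip: matrix_mul_assoc)
  finally show ?thesis .
qed

lemma is_lift_homotopic: "is_lift g w \<Longrightarrow> homotopic_paths (Vreg W) g h \<Longrightarrow> is_lift h w"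
  using homotopic_paths_imp_path homotopic_paths_imp_subset homotopic_paths_imp_pathstart
    homotopic_paths_imp_pathfinish unfolding is_lift_def by metis

lemma is_lift_pathin: "is_lift g w \<Longrightarrow> pathin (Vreg_mod W) (orbit W \<circ> g)"
  by (simp add: is_lift_def pathin_orbit)

lemma orbit_mem_braid: "is_lift g w \<Longrightarrow> orbit W \<circ> g \<in> braid g"
  using path_class_self[OF is_lift_pathin] by (simp add: braid_def)

text \<open>The product in \<open>pi1\<close> ranges over all representatives, so an arbitrary one
  has to be lifted, not only those of the form \<open>orbit W \<circ> g\<close>.\<close>

lemma mem_braid:
  assumes g: "is_lift g w" and f: "f \<in> braid g"
  obtains h where "homotopic_paths (Vreg W) g h" "\<And>t. t \<in> {0..1} \<Longrightarrow> orbit W (h t) = f t"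
proof -
  have hom: "homotopic_with (\<lambda>r. r 0 = (orbit W \<circ> g) 0 \<and> r 1 = (orbit W \<circ> g) 1) (top_of_set {0..1}) (Vreg_mod W)
      (orbit W \<circ> g) f" using f by (simp add: braid_def path_class_def)
  then have fp: "pathin (Vreg_mod W) f" "f 0 = orbit W x0"
    using homotopic_with_imp_continuous_maps[OF hom] homotopic_with_imp_property[OF hom] g
    by (auto simp: pathin_def is_lift_def pathstart_def)
  obtain h where h: "path h" "path_image h \<subseteq> Vreg W" "pathstart h = x0"
    "\<And>t. t \<in> {0..1} \<Longrightarrow> orbit W (h t) = f t" using lift_path[OF fp(1) x0 fp(2)] by metis
  have "path_class (Vreg_mod W) f = path_class (Vreg_mod W) (orbit W \<circ> h)"
    using h by (intro path_class_cong[OF fp(1)]) auto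
  then have "orbit W \<circ> h \<in> braid g"
    using path_class_self[OF pathin_orbit[OF h(1,2)]] path_class_eqI[of f] f by (simp add: braid_def)
  then have "homotopic_paths (Vreg W) g h"
    using g h by (intro lift_homotopy) (auto simp: is_lift_def braid_def)
  then show ?thesis using that h by blast
qed

lemma braid_eq_iff:
  assumes "is_lift g w" "is_lift h w'" shows "braid g = braid h \<longleftrightarrow> homotopic_paths (Vreg W) g h"
proof
  assume "braid g = braid h"
  then have "orbit W \<circ> h \<in> braid g" using orbit_mem_braid[OF assms(2)] by simp
  then show "homotopic_paths (Vreg W) g h"
    using assms by (intro lift_homotopy) (auto simp: is_lift_def braid_def)
qed (rule braid_eqI)

lemma carrier_B: "carrier B = {braid g | g w. is_lift g w}"
proof
  show "carrier B \<subseteq> {braid g | g w. is_lift g w}"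
  proof
    fix b assume "b \<in> carrier B"
    then obtain f where f: "pathin (Vreg_mod W) f" "f 0 = orbit W x0" "f 1 = orbit W x0"
      "b = path_class (Vreg_mod W) f" by (auto simp: braid_group_def pi1_def)
    obtain h where h: "path h" "path_image h \<subseteq> Vreg W" "pathstart h = x0"
      "\<And>t. t \<in> {0..1} \<Longrightarrow> orbit W (h t) = f t" using lift_path[OF f(1) x0 f(2)] by metis
    have "orbit W x0 = orbit W (h 1)" using h(4)[of 1] f(3) by simp
    then obtain w where "w \<in> W" "h 1 = w *v x0" using orbit_eq_iff by blast
    then have "is_lift h w" using h by (simp add: is_lift_def pathfinish_def)
    moreover have "b = braid h" unfolding f(4) braid_def using h by (intro path_class_cong[OF f(1)]) auto
    ultimately show "b \<in> {braid g | g w. is_lift g w}" by blast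
  qed
  show "{braid g | g w. is_lift g w} \<subseteq> carrier B"
    using is_lift_pathin by (force simp: braid_group_def pi1_def braid_def is_lift_def pathstart_def pathfinish_def orbit_act)
qed

lemma carrierE:
  assumes "b \<in> carrier B" obtains g w where "is_lift g w" "b = braid g"
  using assms carrier_B by auto

lemma braid_carrier: "is_lift g w \<Longrightarrow> braid g \<in> carrier B"
  using carrier_B by auto

definition act_path :: "complex^'n^'n \<Rightarrow> (real \<Rightarrow> complex^'n) \<Rightarrow> real \<Rightarrow> complex^'n" where
  "act_path w g t = w *v g t"

lemma act_path_path:
  assumes "w \<in> W" "path g" "path_image g \<subseteq> Vreg W"
  shows "path (act_path w g)" "path_image (act_path w g) \<subseteq> Vreg W"
proof -
  have "act_path w g = (*v) w \<circ> g" by (auto simp: act_path_def)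
  then show "path (act_path w g)" "path_image (act_path w g) \<subseteq> Vreg W"
    using assms path_continuous_image[OF assms(2) act_continuous] Vreg_invariant
    by (auto simp: path_image_compose)
qed

lemma act_path_ends [simp]:
  "pathstart (act_path w g) = w *v pathstart g" "pathfinish (act_path w g) = w *v pathfinish g"
  by (simp_all add: act_path_def pathstart_def pathfinish_def)

lemma act_path_join: "act_path w (g +++ h) = act_path w g +++ act_path w h"
  by (auto simp: act_path_def joinpaths_def fun_eq_iff)

lemma act_path_act: "act_path w (act_path v g) = act_path (w ** v) g"
  by (simp add: act_path_def fun_eq_iff matrix_vector_mul_assoc)

lemma act_path_homotopic:
  assumes "w \<in> W" "homotopic_paths (Vreg W) g h"
  shows "homotopic_paths (Vreg W) (act_path w g) (act_path w h)"
proof -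
  have "act_path w g = (*v) w \<circ> g" for g by (auto simp: act_path_def)
  then show ?thesis using homotopic_paths_continuous_image[OF assms(2) act_continuous, of w "Vreg W"]
    Vreg_invariant assms(1) by auto
qed

text \<open>The first factor ends at \<open>w *v x0\<close>, so the lift of the second has to be
  moved there.\<close>

definition lift_mult where "lift_mult g w g' = g +++ act_path w g'"

lemma is_lift_mult: "is_lift g w \<Longrightarrow> is_lift g' w' \<Longrightarrow> is_lift (lift_mult g w g') (w ** w')"
  using act_path_path[of w g'] W_mult
  by (auto simp: is_lift_def lift_mult_def path_image_join matrix_vector_mul_assoc)

lemma braid_mult:
  assumes g: "is_lift g w" and g': "is_lift g' w'"
  shows "braid g \<otimes>\<^bsub>B\<^esub> braid g' = braid (lift_mult g w g')"
proof -
  have wW: "w \<in> W" using g by (simp add: is_lift_def)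
  have "path_class (Vreg_mod W) (join_path f f') = braid (lift_mult g w g')"
    if ff: "f \<in> braid g" "f' \<in> braid g'" for f f'
  proof -
    obtain h where h: "homotopic_paths (Vreg W) g h" "\<And>t. t \<in> {0..1} \<Longrightarrow> orbit W (h t) = f t"
      using mem_braid[OF g ff(1)] by metis
    obtain h' where h': "homotopic_paths (Vreg W) g' h'" "\<And>t. t \<in> {0..1} \<Longrightarrow> orbit W (h' t) = f' t"
      using mem_braid[OF g' ff(2)] by metis
    have lm: "homotopic_paths (Vreg W) (lift_mult g w g') (lift_mult h w h')"
      unfolding lift_mult_def using h(1) act_path_homotopic[OF wW h'(1)] g g'
      by (intro homotopic_paths_join) (auto simp: is_lift_def)
    have "is_lift (lift_mult h w h') (w ** w')"
      using is_lift_homotopic[OF is_lift_mult[OF g g'] lm] .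
    then have "path_class (Vreg_mod W) (orbit W \<circ> lift_mult h w h') = path_class (Vreg_mod W) (join_path f f')"
      using h(2) h'(2) orbit_act[OF wW]
      by (intro path_class_cong is_lift_pathin) (auto simp: join_path_def lift_mult_def joinpaths_def act_path_def)
    then show ?thesis using braid_eqI[OF lm] by (simp add: braid_def)
  qed
  then have "{path_class (Vreg_mod W) (join_path f f') | f f'. f \<in> braid g \<and> f' \<in> braid g'} = {braid (lift_mult g w g')}"
    using orbit_mem_braid[OF g] orbit_mem_braid[OF g'] by blast
  then show ?thesis by (simp add: braid_group_def pi1_def)
qed

lemma is_lift_one: "is_lift (linepath x0 x0) (mat 1)"
  using x0 W_one by (auto simp: is_lift_def)

lemma braid_one: "\<one>\<^bsub>B\<^esub> = braid (linepath x0 x0)"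
  by (simp add: braid_group_def pi1_def braid_def linepath_refl comp_def)

lemma braid_group_group: "group B"
proof (rule groupI)
  fix a b assume "a \<in> carrier B" "b \<in> carrier B"
  then show "a \<otimes>\<^bsub>B\<^esub> b \<in> carrier B"
    by (metis carrierE braid_mult is_lift_mult braid_carrier)
next
  show "\<one>\<^bsub>B\<^esub> \<in> carrier B" using braid_one is_lift_one braid_carrier by simp
next
  fix a b c assume "a \<in> carrier B" "b \<in> carrier B" "c \<in> carrier B"
  then obtain g u h v k w where l: "is_lift g u" "is_lift h v" "is_lift k w" and abc: "a = braid g" "b = braid h" "c = braid k"
    by (metis carrierE)
  have u: "u \<in> W" and v: "v \<in> W" using l by (auto simp: is_lift_def)
  have "homotopic_paths (Vreg W) (g +++ (act_path u h +++ act_path (u ** v) k)) ((g +++ act_path u h) +++ act_path (u ** v) k)"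
    using l act_path_path[OF u, of h] act_path_path[OF W_mult[OF u v], of k]
    by (intro homotopic_paths_assoc) (auto simp: is_lift_def matrix_vector_mul_assoc)
  then have "braid (lift_mult g u (lift_mult h v k)) = braid (lift_mult (lift_mult g u h) (u ** v) k)"
    by (intro braid_eqI) (simp add: lift_mult_def act_path_join act_path_act)
  then show "a \<otimes>\<^bsub>B\<^esub> b \<otimes>\<^bsub>B\<^esub> c = a \<otimes>\<^bsub>B\<^esub> (b \<otimes>\<^bsub>B\<^esub> c)"
    by (simp add: abc braid_mult[OF l(1,2)] braid_mult[OF l(2,3)] braid_mult[OF l(1) is_lift_mult[OF l(2,3)]]
        braid_mult[OF is_lift_mult[OF l(1,2)] l(3)])
next
  fix a assume "a \<in> carrier B"
  then obtain g w where g: "is_lift g w" "a = braid g" by (metis carrierE)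
  have "act_path (mat 1) g = g" by (simp add: act_path_def fun_eq_iff)
  then have "homotopic_paths (Vreg W) (lift_mult (linepath x0 x0) (mat 1) g) g"
    using g by (simp add: lift_mult_def is_lift_def homotopic_paths_lid')
  then show "\<one>\<^bsub>B\<^esub> \<otimes>\<^bsub>B\<^esub> a = a" using braid_mult[OF is_lift_one g(1)] braid_eqI by (simp add: braid_one g(2))
  obtain v where v: "v \<in> W" "v ** w = mat 1" using W_inverse g by (auto simp: is_lift_def)
  \<comment> \<open>The reversed path runs from \<open>w *v x0\<close> to \<open>x0\<close>;
    translation by the inverse \<open>v\<close> makes it start at \<open>x0\<close> and end at
    \<open>v *v x0\<close>.\<close>
  define h where "h = act_path v (reversepath g)"
  have "is_lift h v" unfolding is_lift_def h_def
    using g v act_path_path[OF v(1), of "reversepath g"]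
    by (auto simp: is_lift_def matrix_vector_mul_assoc)
  moreover have "homotopic_paths (Vreg W) (lift_mult h v g) (linepath x0 x0)"
  proof -
    have "homotopic_paths (Vreg W) (act_path v (reversepath g +++ g)) (act_path v (linepath (w *v x0) (w *v x0)))"
      using g homotopic_paths_linv[of g "Vreg W"] by (intro act_path_homotopic[OF v(1)]) (auto simp: is_lift_def)
    moreover have "act_path v (linepath (w *v x0) (w *v x0)) = linepath x0 x0"
      using v by (simp add: act_path_def fun_eq_iff linepath_refl matrix_vector_mul_assoc)
    ultimately show ?thesis by (simp add: lift_mult_def h_def act_path_join)
  qed
  ultimately have "braid h \<otimes>\<^bsub>B\<^esub> a = \<one>\<^bsub>B\<^esub>" "braid h \<in> carrier B"
    using braid_mult[of h v g w] g braid_eqI[of "lift_mult h v g" "linepath x0 x0"] braid_carrier[of h v]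
    by (simp_all add: braid_one)
  then show "\<exists>b\<in>carrier B. b \<otimes>\<^bsub>B\<^esub> a = \<one>\<^bsub>B\<^esub>" by blast
qed

section \<open>The projection to \<open>W\<close> and the pure braids\<close>

lemma braid_proj_braid:
  assumes g: "is_lift g w" shows "braid_proj W x0 (braid g) = w"
  unfolding braid_proj_def
proof (rule the_equality)
  show "w \<in> W \<and> (\<exists>g'. path g' \<and> path_image g' \<subseteq> Vreg W \<and> pathstart g' = x0 \<and> pathfinish g' = w *v x0 \<and>
      orbit W \<circ> g' \<in> braid g)"
    using g orbit_mem_braid[OF g] by (auto simp: is_lift_def)
next
  fix w' assume "w' \<in> W \<and> (\<exists>g'. path g' \<and> path_image g' \<subseteq> Vreg W \<and> pathstart g' = x0 \<and> pathfinish g' = w' *v x0 \<and>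
      orbit W \<circ> g' \<in> braid g)"
  then obtain g' where g': "is_lift g' w'" "orbit W \<circ> g' \<in> braid g" by (auto simp: is_lift_def)
  then have "homotopic_paths (Vreg W) g g'"
    using g by (intro lift_homotopy) (auto simp: is_lift_def braid_def)
  then show "w' = w" using is_lift_unique is_lift_homotopic g g' by blast
qed

lemma pure_braids_eq: "pure_braids W x0 = {braid g | g. is_lift g (mat 1)}"
proof -
  have "pi1_map (Vreg_mod W) (orbit W) (path_class (top_of_set (Vreg W)) g) = braid g"
    if g: "is_lift g (mat 1)" for g
  proof -
    have "braid f = braid g" if "f \<in> path_class (top_of_set (Vreg W)) g" for f
      using braid_eqI[of g f] that
      by (simp add: path_class_def homotopic_paths_def pathstart_def pathfinish_def)
    moreover have "g \<in> path_class (top_of_set (Vreg W)) g"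
      using g by (intro path_class_self) (simp add: pathin_top_of_set is_lift_def)
    ultimately have "(\<lambda>f. path_class (Vreg_mod W) (orbit W \<circ> f)) ` path_class (top_of_set (Vreg W)) g = {braid g}"
      unfolding braid_def by blast
    then show ?thesis by (simp add: pi1_map_def)
  qed
  moreover have "{f. pathin (top_of_set (Vreg W)) f \<and> f 0 = x0 \<and> f 1 = x0} = {g. is_lift g (mat 1)}"
    using W_one by (auto simp: pathin_top_of_set is_lift_def pathstart_def pathfinish_def)
  ultimately show ?thesis unfolding pure_braids_def pi1_def by (force simp: image_image)
qed

lemma braid_proj_hom: "braid_proj W x0 \<in> hom B (group_of W)"
proof (rule homI)
  fix a b assume "a \<in> carrier B" "b \<in> carrier B"
  then obtain g u h v where l: "is_lift g u" "is_lift h v" "a = braid g" "b = braid h" by (metis carrierE)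
  then show "braid_proj W x0 (a \<otimes>\<^bsub>B\<^esub> b) = braid_proj W x0 a \<otimes>\<^bsub>group_of W\<^esub> braid_proj W x0 b"
    by (simp add: braid_mult[OF l(1,2)] braid_proj_braid[OF l(1)] braid_proj_braid[OF l(2)]
        braid_proj_braid[OF is_lift_mult[OF l(1,2)]] GL_def)
next
  fix a assume "a \<in> carrier B"
  then obtain g u where g: "is_lift g u" "a = braid g" by (metis carrierE)
  then show "braid_proj W x0 a \<in> carrier (group_of W)" using braid_proj_braid[OF g(1)] by (simp add: is_lift_def)
qed

lemma pure_braids_normal: "pure_braids W x0 \<lhd> B"
proof -
  interpret group_hom B "group_of W" "braid_proj W x0"
    using braid_group_group group_W braid_proj_hom by (simp add: group_hom_def group_hom_axioms_def)
  have "kernel B (group_of W) (braid_proj W x0) = pure_braids W x0"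
    unfolding kernel_def pure_braids_eq carrier_B using braid_proj_braid by (force simp: GL_def)
  then show ?thesis using normal_kernel by simp
qed

end

section \<open>Winding numbers of braids\<close>

text \<open>Two continuous logarithms of one path differ by a continuous function with values in the
  integer multiples of 2 pi i, hence by a constant.\<close>

lemma winding_number_log:
  fixes p L :: "real \<Rightarrow> complex"
  assumes L: "continuous_on {0..1} L" and p: "\<And>t. t \<in> {0..1} \<Longrightarrow> p t = exp (L t)"
  shows "winding_number p 0 = (L 1 - L 0) / (2 * of_real pi * \<i>)"
proof -
  have "continuous_on {0..1} (\<lambda>t. exp (L t))" by (intro continuous_intros L)
  then have "path p" unfolding path_def by (rule continuous_on_eq) (simp add: p)
  moreover have "0 \<notin> path_image p" using p by (auto simp: path_image_def)
  ultimately obtain q where q: "path q"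
    "pathfinish q - pathstart q = 2 * of_real pi * \<i> * winding_number p 0"
    "\<And>t. t \<in> {0..1} \<Longrightarrow> p t = 0 + exp (q t)"
    using winding_number_as_continuous_log by metis
  define D where "D t = q t - L t" for t
  have D1: "exp (D t) = 1" if "t \<in> {0..1}" for t
    using p[OF that] q(3)[OF that] by (simp add: D_def exp_diff)
  have "D constant_on {0..1}"
  proof (rule continuous_discrete_range_constant)
    show "continuous_on {0..1} D" unfolding D_def using q(1) L by (intro continuous_intros) (auto simp: path_def)
    fix x :: real assume x: "x \<in> {0..1}"
    \<comment> \<open>Distinct values of \<open>D\<close> are at least 2 pi apart; 1 is a convenient
      smaller bound.\<close>
    show "\<exists>e>0. \<forall>y. y \<in> {0..1} \<and> D y \<noteq> D x \<longrightarrow> e \<le> norm (D y - D x)"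
    proof (intro exI[of _ 1] conjI allI impI)
      fix y assume y: "y \<in> {0..1} \<and> D y \<noteq> D x"
      have ex: "\<exists>n::int. z = of_int (2 * n) * pi * \<i>" if "exp z = 1" for z
        using that unfolding exp_eq_1 by (auto simp: complex_eq_iff)
      obtain m n :: int where mn: "D x = of_int (2 * m) * pi * \<i>" "D y = of_int (2 * n) * pi * \<i>"
        using ex[OF D1[OF x]] ex[OF D1[of y]] y by auto
      then have "n \<noteq> m" using y by auto
      define N where "N = 2 * (n - m)"
      have "D y - D x = of_int N * pi * \<i>" by (simp add: mn N_def algebra_simps)
      then have "norm (D y - D x) = of_int \<bar>N\<bar> * pi" by (simp add: norm_mult)
      also have "real_of_int \<bar>N\<bar> \<ge> 2" using \<open>n \<noteq> m\<close> by (simp add: N_def)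
      then have "of_int \<bar>N\<bar> * pi \<ge> 2 * 1" using pi_ge_two by (intro mult_mono) auto
      finally show "1 \<le> norm (D y - D x)" by simp
    qed simp
  qed simp
  then have "D 1 = D 0" by (auto simp: constant_on_def)
  then have "L 1 - L 0 = 2 * of_real pi * \<i> * winding_number p 0"
    using q(2) by (simp add: D_def pathfinish_def pathstart_def algebra_simps)
  then show ?thesis by simp
qed

lemma winding_number_scale:
  assumes p: "path p" "0 \<notin> path_image p" and c: "c \<noteq> 0"
  shows "winding_number (\<lambda>t. c * p t) 0 = winding_number p 0"
proof -
  obtain q where q: "path q"
    "pathfinish q - pathstart q = 2 * of_real pi * \<i> * winding_number p 0"
    "\<And>t. t \<in> {0..1} \<Longrightarrow> p t = 0 + exp (q t)"
    using winding_number_as_continuous_log[OF p] by metis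
  have "winding_number (\<lambda>t. c * p t) 0 = ((Ln c + q 1) - (Ln c + q 0)) / (2 * of_real pi * \<i>)"
    using q c by (intro winding_number_log) (auto simp: path_def exp_add intro!: continuous_intros)
  then show ?thesis using q(2) by (simp add: pathfinish_def pathstart_def)
qed

context braid_setup
begin

text \<open>Wider than the linear forms in order to be closed under composition with elements of
  \<open>W\<close>, which translated lifts bring in.\<close>

definition regular :: "(complex^'n \<Rightarrow> complex) \<Rightarrow> bool" where
  "regular \<beta> \<longleftrightarrow> continuous_on (Vreg W) \<beta> \<and> (\<forall>x\<in>Vreg W. \<beta> x \<noteq> 0)"

lemma regular_form: "H \<in> hyperplanes W \<Longrightarrow> regular (form H)"
  using hpoly_continuous[OF form_hpoly] by (simp add: regular_def form_Vreg)

lemma regular_act: "regular \<beta> \<Longrightarrow> w \<in> W \<Longrightarrow> regular (\<lambda>x. \<beta> (w *v x))"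
  unfolding regular_def using Vreg_invariant
  by (auto intro!: continuous_on_compose2[of "Vreg W" \<beta>] act_continuous)

lemma regular_path:
  assumes "regular \<beta>" "path g" "path_image g \<subseteq> Vreg W"
  shows "path (\<beta> \<circ> g)" "0 \<notin> path_image (\<beta> \<circ> g)"
  using assms path_continuous_image[of g \<beta>] continuous_on_subset[of "Vreg W" \<beta>]
  by (auto simp: regular_def path_image_compose)

text \<open>The lift is unique up to homotopy, which does not affect the winding number. Braids that
  are not pure lift to open paths, so the value need not be an integer.\<close>

definition theta :: "(complex^'n \<Rightarrow> complex) \<Rightarrow> (real \<Rightarrow> (complex^'n) set) set \<Rightarrow> complex" where
  "theta \<beta> b = winding_number (\<beta> \<circ> (SOME g. \<exists>w. is_lift g w \<and> b = braid g)) 0"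

lemma theta_braid:
  assumes \<beta>: "regular \<beta>" and g: "is_lift g w" shows "theta \<beta> (braid g) = winding_number (\<beta> \<circ> g) 0"
proof -
  define g' where "g' = (SOME g'. \<exists>w. is_lift g' w \<and> braid g = braid g')"
  have "\<exists>w. is_lift g' w \<and> braid g = braid g'"
    unfolding g'_def by (rule someI[of _ g]) (use g in blast)
  then have "homotopic_paths (Vreg W) g' g" using braid_eq_iff g by metis
  then have "homotopic_paths (-{0}) (\<beta> \<circ> g') (\<beta> \<circ> g)"
    by (rule homotopic_paths_continuous_image) (use \<beta> in \<open>auto simp: regular_def\<close>)
  then show ?thesis using winding_number_homotopic_paths by (simp add: theta_def g'_def)
qed

text \<open>Translating the second lift by \<open>w\<close> amounts to composing the function with
  \<open>w\<close>: a crossed homomorphism rule.\<close>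

lemma theta_mult:
  assumes \<beta>: "regular \<beta>" and g: "is_lift g w" and b: "b \<in> carrier B"
  shows "theta \<beta> (braid g \<otimes>\<^bsub>B\<^esub> b) = theta \<beta> (braid g) + theta (\<lambda>x. \<beta> (w *v x)) b"
proof -
  obtain h v where h: "is_lift h v" "b = braid h" using b by (rule carrierE)
  have w: "w \<in> W" using g by (simp add: is_lift_def)
  have "theta \<beta> (braid g \<otimes>\<^bsub>B\<^esub> b) = winding_number ((\<beta> \<circ> g) +++ (\<beta> \<circ> act_path w h)) 0"
    using theta_braid[OF \<beta> is_lift_mult[OF g h(1)]]
    by (simp add: h(2) braid_mult[OF g h(1)] lift_mult_def path_compose_join)
  also have "\<dots> = winding_number (\<beta> \<circ> g) 0 + winding_number (\<beta> \<circ> act_path w h) 0"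
    using g h(1) act_path_path[OF w, of h]
    by (intro winding_number_join regular_path[OF \<beta>]) (auto simp: is_lift_def pathfinish_compose pathstart_compose)
  also have "\<beta> \<circ> act_path w h = (\<lambda>x. \<beta> (w *v x)) \<circ> h" by (simp add: act_path_def fun_eq_iff)
  finally show ?thesis using theta_braid[OF \<beta> g] theta_braid[OF regular_act[OF \<beta> w] h(1)]
    by (simp add: h(2) comp_def)
qed

lemma theta_scale:
  assumes \<beta>: "regular \<beta>" and b: "b \<in> carrier B" and c: "c \<noteq> 0"
  shows "theta (\<lambda>x. c * \<beta> x) b = theta \<beta> b"
proof -
  obtain h v where h: "is_lift h v" "b = braid h" using b by (rule carrierE)
  have "regular (\<lambda>x. c * \<beta> x)" using \<beta> c by (auto simp: regular_def intro!: continuous_intros)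
  from theta_braid[OF this h(1)] have "theta (\<lambda>x. c * \<beta> x) b = winding_number (\<lambda>t. c * (\<beta> \<circ> h) t) 0"
    by (simp add: h(2) comp_def)
  also have "\<dots> = winding_number (\<beta> \<circ> h) 0"
    using h(1) by (intro winding_number_scale regular_path[OF \<beta>] c) (auto simp: is_lift_def)
  finally show ?thesis using theta_braid[OF \<beta> h(1)] by (simp add: h(2))
qed

lemma exp_theta:
  assumes \<beta>: "regular \<beta>" and g: "is_lift g w"
  shows "\<beta> (w *v x0) = exp (2 * \<i> * of_real pi * theta \<beta> (braid g)) * \<beta> x0"
proof -
  have "pathfinish (\<beta> \<circ> g) - 0 = exp (2 * pi * \<i> * winding_number (\<beta> \<circ> g) 0) * (pathstart (\<beta> \<circ> g) - 0)"
    using g by (intro winding_number_exp_2pi regular_path[OF \<beta>]) (auto simp: is_lift_def)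
  then show ?thesis using g theta_braid[OF \<beta> g]
    by (simp add: is_lift_def pathfinish_compose pathstart_compose mult_ac)
qed

abbreviation "P \<equiv> pure_braids W x0"
abbreviation "K \<equiv> pure_commutators W x0"

lemma P_subset: "P \<subseteq> carrier B" and P_subgroup: "subgroup P B"
  using pure_braids_normal by (auto simp: normal_def subgroup.subset subgroup.mem_carrier)

lemma theta_pure_mult:
  assumes \<beta>: "regular \<beta>" and p: "p \<in> P" and b: "b \<in> carrier B"
  shows "theta \<beta> (p \<otimes>\<^bsub>B\<^esub> b) = theta \<beta> p + theta \<beta> b"
proof -
  obtain g where "is_lift g (mat 1)" "p = braid g" using p by (auto simp: pure_braids_eq)
  then show ?thesis using theta_mult[OF \<beta> _ b] by simp
qed

lemma theta_one: assumes "regular \<beta>" shows "theta \<beta> \<one>\<^bsub>B\<^esub> = 0"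
  using theta_pure_mult[OF assms subgroup.one_closed[OF P_subgroup], of "\<one>\<^bsub>B\<^esub>"]
    group.is_monoid[OF braid_group_group] by (simp add: monoid.one_closed monoid.l_one)

lemma theta_pure_inv:
  assumes \<beta>: "regular \<beta>" and p: "p \<in> P" shows "theta \<beta> (inv\<^bsub>B\<^esub> p) = - theta \<beta> p"
proof -
  have pc: "p \<in> carrier B" using p P_subset by blast
  have "theta \<beta> (p \<otimes>\<^bsub>B\<^esub> inv\<^bsub>B\<^esub> p) = theta \<beta> p + theta \<beta> (inv\<^bsub>B\<^esub> p)"
    by (rule theta_pure_mult[OF \<beta> p group.inv_closed[OF braid_group_group pc]])
  then show ?thesis using theta_one[OF \<beta>] group.r_inv[OF braid_group_group pc] by (simp add: eq_neg_iff_add_eq_0 add.commute)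
qed

lemma K_normal: "K \<lhd> B" by (rule group.derived_is_normal[OF braid_group_group pure_braids_normal])

lemma K_subset_P: "K \<subseteq> P" by (rule group.derived_incl[OF braid_group_group order.refl P_subgroup])

text \<open>On \<open>P\<close> the winding number is a homomorphism to an abelian group, so its
  zero set is a subgroup that contains all commutators.\<close>

lemma theta_K: assumes \<beta>: "regular \<beta>" and k: "k \<in> K" shows "theta \<beta> k = 0"
proof -
  define Z where "Z = {p \<in> P. theta \<beta> p = 0}"
  note Pm = subgroup.m_closed[OF P_subgroup] and Pi = subgroup.m_inv_closed[OF P_subgroup]
  have mult: "theta \<beta> (a \<otimes>\<^bsub>B\<^esub> b) = theta \<beta> a + theta \<beta> b" if "a \<in> P" "b \<in> P" for a b
    using theta_pure_mult[OF \<beta> that(1)] that(2) P_subset by blast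
  have "subgroup Z B"
  proof (rule group.subgroupI[OF braid_group_group])
    show "Z \<subseteq> carrier B" using P_subset by (auto simp: Z_def)
    show "Z \<noteq> {}" using subgroup.one_closed[OF P_subgroup] theta_one[OF \<beta>] by (auto simp: Z_def)
  qed (auto simp: Z_def Pm Pi mult theta_pure_inv[OF \<beta>])
  moreover have "derived_set B P \<subseteq> Z" by (auto simp: Z_def Pm Pi mult theta_pure_inv[OF \<beta>])
  ultimately have "K \<subseteq> Z"
    unfolding derived_def by (intro group.generate_subgroup_incl[OF braid_group_group])
  then show ?thesis using k by (auto simp: Z_def)
qed

definition Theta :: "(complex^'n \<Rightarrow> complex) \<Rightarrow> (real \<Rightarrow> (complex^'n) set) set set \<Rightarrow> complex" where
  "Theta \<beta> X = the_elem (theta \<beta> ` X)"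

lemma K_nonempty: "\<one>\<^bsub>B\<^esub> \<in> K"
  using K_normal by (simp add: normal_def subgroup.one_closed)

lemma coset_image:
  assumes "\<And>k. k \<in> K \<Longrightarrow> f (k \<otimes>\<^bsub>B\<^esub> b) = c" shows "f ` (K #>\<^bsub>B\<^esub> b) = {c}"
  using assms K_nonempty unfolding r_coset_def by (auto simp: image_iff)

lemma Theta_coset: "regular \<beta> \<Longrightarrow> b \<in> carrier B \<Longrightarrow> Theta \<beta> (K #>\<^bsub>B\<^esub> b) = theta \<beta> b"
  unfolding Theta_def using theta_pure_mult theta_K K_subset_P
  by (subst coset_image[where c = "theta \<beta> b"]) auto

lemma braid_ab_proj_coset:
  assumes "b \<in> carrier B" shows "braid_ab_proj W x0 (K #>\<^bsub>B\<^esub> b) = braid_proj W x0 b"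
proof -
  have "braid_proj W x0 (k \<otimes>\<^bsub>B\<^esub> b) = braid_proj W x0 b" if "k \<in> K" for k
  proof -
    have "k \<in> P" using that K_subset_P by blast
    then obtain g where g: "is_lift g (mat 1)" "k = braid g" by (auto simp: pure_braids_eq)
    have "k \<in> carrier B" using g braid_carrier by blast
    then show ?thesis using hom_mult[OF braid_proj_hom _ assms, of k] braid_proj_braid[OF g(1)] g
      by (simp add: GL_def)
  qed
  then show ?thesis unfolding braid_ab_proj_def by (subst coset_image[where c = "braid_proj W x0 b"]) auto
qed

subsection \<open>The monodromy generators\<close>

text \<open>In the lift of the power, the copies of \<open>g\<close> are translated successively by
  the powers of \<open>s\<close>, starting with exponent 0.\<close>

lemma braid_power:
  assumes \<beta>: "regular \<beta>" and g: "is_lift g s"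
  shows "\<exists>h. is_lift h (s [^]\<^bsub>GL\<^esub> (k::nat)) \<and> braid g [^]\<^bsub>B\<^esub> k = braid h \<and>
    theta \<beta> (braid g [^]\<^bsub>B\<^esub> k) = (\<Sum>j<k. winding_number (\<lambda>t. \<beta> ((s [^]\<^bsub>GL\<^esub> j) *v g t)) 0)"
proof (induction k)
  case 0
  have "braid g [^]\<^bsub>B\<^esub> (0::nat) = \<one>\<^bsub>B\<^esub>" "s [^]\<^bsub>GL\<^esub> (0::nat) = mat 1" by (simp_all add: nat_pow_def GL_def)
  then show ?case using is_lift_one braid_one theta_one[OF \<beta>] by auto
next
  case (Suc k)
  then obtain h where h: "is_lift h (s [^]\<^bsub>GL\<^esub> k)" "braid g [^]\<^bsub>B\<^esub> k = braid h"
    "theta \<beta> (braid g [^]\<^bsub>B\<^esub> k) = (\<Sum>j<k. winding_number (\<lambda>t. \<beta> ((s [^]\<^bsub>GL\<^esub> j) *v g t)) 0)" by blast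
  have sW: "s [^]\<^bsub>GL\<^esub> k \<in> W" using h by (simp add: is_lift_def)
  have p: "braid g [^]\<^bsub>B\<^esub> Suc k = braid h \<otimes>\<^bsub>B\<^esub> braid g" 
    using monoid.nat_pow_Suc[OF group.is_monoid[OF braid_group_group]] h(2) by simp
  moreover have "s [^]\<^bsub>GL\<^esub> Suc k = (s [^]\<^bsub>GL\<^esub> k) ** s" by (simp add: nat_pow_def) (simp add: GL_def)
  moreover have "theta \<beta> (braid h \<otimes>\<^bsub>B\<^esub> braid g) = theta \<beta> (braid h) +
      winding_number (\<lambda>t. \<beta> ((s [^]\<^bsub>GL\<^esub> k) *v g t)) 0"
    using theta_mult[OF \<beta> h(1) braid_carrier[OF g]] theta_braid[OF regular_act[OF \<beta> sW] g] by (simp add: comp_def)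
  ultimately show ?case using is_lift_mult[OF h(1) g] braid_mult[OF h(1) g] h(2,3)
    by (intro exI[of _ "lift_mult h (s [^]\<^bsub>GL\<^esub> k) g"]) simp
qed

lemma s_H_power_one:
  assumes H: "H \<in> hyperplanes W" shows "s_H W H [^]\<^bsub>GL\<^esub> e_H W H = mat 1"
proof -
  interpret F: group "GL\<lparr>carrier := fixator W H\<rparr>"
    using subgroup.subgroup_is_group[OF fixator_subgroup GL_group] .
  show ?thesis
    using F.pow_order_eq_1[of "s_H W H"] s_H_props(1)[OF H]
      monoid.nat_pow_consistent[OF group.is_monoid[OF GL_group], of "s_H W H" "e_H W H" "fixator W H"]
    by (simp add: GL_def order_def e_H_def)
qed

context
  fixes H h d \<gamma>
  assumes H: "H \<in> hyperplanes W" and data: "monodromy_data W ip x0 H h d \<gamma>"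
begin

text \<open>Time is scaled so that one unit is the arc from a point to its image under the generator
  \<open>s_H\<close>; after \<open>e_H\<close> units the circle closes.\<close>

definition rot :: "real \<Rightarrow> complex" where
  "rot t = exp (2 * \<i> * of_real pi * of_real t / of_nat (e_H W H))"

definition arc_path :: "real \<Rightarrow> complex^'n" where "arc_path t = h + rot t *s d"

lemma data_simps: "h \<in> H" "d \<in> ortho ip H" "d \<noteq> 0" "path \<gamma>" "path_image \<gamma> \<subseteq> Vreg W" "pathstart \<gamma> = x0"
  "pathfinish \<gamma> = h + d" "\<And>L z. L \<in> hyperplanes W \<Longrightarrow> L \<noteq> H \<Longrightarrow> norm z \<le> 1 \<Longrightarrow> h + z *s d \<notin> L"
  using data by (auto simp: monodromy_data_def)

lemma s_H_d: "s_H W H *v d = rot 1 *s d"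
proof -
  obtain c where c: "d = c *s root H" using ortho_multiple[OF H data_simps(2)] by blast
  have s: "s_H W H \<in> fixator W H" "det (s_H W H) = rot 1" using s_H_props[OF H] by (auto simp: rot_def)
  then have "s_H W H *v root H = rot 1 *s root H"
    using natural_char_root[OF H fixator_stabilizer[OF s(1)]] det_fixator[OF H s(1)] by simp
  then show ?thesis by (simp add: c vector_scalar_commute vector_smult_assoc mult.commute)
qed

lemma form_d: "form H d \<noteq> 0"
proof -
  obtain c where c: "d = c *s root H" using ortho_multiple[OF H data_simps(2)] by blast
  then have "c \<noteq> 0" using data_simps(3) by auto
  then show ?thesis using form_root[OF H] by (simp add: c form_scale)
qed

lemma rot_add: "rot (a + b) = rot a * rot b"
  by (simp add: rot_def exp_add[symmetric] add_divide_distrib ring_distribs)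

lemma rot_norm: "norm (rot t) = 1"
proof -
  have "rot t = exp (\<i> * of_real (2 * pi * t / of_nat (e_H W H)))" by (simp add: rot_def mult_ac)
  then show ?thesis by simp
qed

lemma rot_0: "rot 0 = 1" by (simp add: rot_def)

lemma rot_e: "rot (of_nat (e_H W H)) = 1"
  using e_H_pos[of H] exp_two_pi_i by (simp add: rot_def mult_ac)

text \<open>The generator fixes \<open>h\<close> and rotates \<open>d\<close> by one arc, so the
  translated arcs in the power fit together into a circle.\<close>

lemma s_H_power_arc: "(s_H W H [^]\<^bsub>GL\<^esub> (k::nat)) *v (h + z *s d) = h + (rot (of_nat k) * z) *s d"
proof (induction k arbitrary: z)
  case 0 show ?case by (simp add: nat_pow_def GL_def rot_0)
next
  case (Suc k)
  have "s_H W H *v h = h" using s_H_props(1)[OF H] data_simps(1) by (simp add: fixator_def)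
  then have "s_H W H *v (h + z *s d) = h + (rot 1 * z) *s d"
    by (simp add: matrix_vector_right_distrib vector_scalar_commute s_H_d vector_smult_assoc mult.commute)
  moreover have "s_H W H [^]\<^bsub>GL\<^esub> Suc k = (s_H W H [^]\<^bsub>GL\<^esub> k) ** s_H W H" by (simp add: nat_pow_def) (simp add: GL_def)
  ultimately show ?case
    by (simp add: Suc matrix_vector_mul_assoc[symmetric] rot_add[symmetric] mult.assoc[symmetric] add.commute)
qed

text \<open>The other hyperplanes are excluded by the disc condition, \<open>H\<close> itself
  because its form is nonzero at \<open>d\<close>.\<close>

lemma arc_regular: "norm z = 1 \<Longrightarrow> h + z *s d \<in> Vreg W"
  unfolding Vreg_iff
proof
  fix L assume z: "norm z = 1" and L: "L \<in> hyperplanes W"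
  show "form L (h + z *s d) \<noteq> 0"
  proof (cases "L = H")
    case True
    then show ?thesis using z form_d form_on[OF H data_simps(1)] by (auto simp: form_add form_scale)
  next
    case False
    then show ?thesis using data_simps(8)[OF L False, of z] z form_iff[OF L] by simp
  qed
qed

lemma rot_continuous: "continuous_on A rot"
  unfolding rot_def by (intro continuous_intros) (use e_H_pos[of H] in auto)

lemma arc_path_path: "path arc_path" "path_image arc_path \<subseteq> Vreg W"
proof -
  have "continuous_on {0..1} (\<lambda>t. (\<chi> i. h $ i + rot t * d $ i))"
    by (intro continuous_intros rot_continuous)
  moreover have "arc_path = (\<lambda>t. (\<chi> i. h $ i + rot t * d $ i))"
    by (simp add: arc_path_def fun_eq_iff vec_eq_iff)
  ultimately show "path arc_path" by (simp add: path_def)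
  show "path_image arc_path \<subseteq> Vreg W" using arc_regular rot_norm by (auto simp: path_image_def arc_path_def)
qed

lemma monodromy_path_eq:
  "monodromy_path W H h d \<gamma> = \<gamma> +++ (arc_path +++ act_path (s_H W H) (reversepath \<gamma>))"
  by (simp add: monodromy_path_def arc_path_def[abs_def] rot_def act_path_def[abs_def])

lemma arc_ends: "pathstart arc_path = h + d" "pathfinish arc_path = s_H W H *v (h + d)"
proof -
  show "pathstart arc_path = h + d" by (simp add: arc_path_def pathstart_def rot_0)
  have "s_H W H [^]\<^bsub>GL\<^esub> (1::nat) = s_H W H" by (simp add: nat_pow_def GL_def)
  then show "pathfinish arc_path = s_H W H *v (h + d)"
    using s_H_power_arc[of 1 1] by (simp add: arc_path_def pathfinish_def)
qed

lemma s_H_W: "s_H W H \<in> W" using s_H_props(1)[OF H] fixator_subset by blast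

lemma monodromy_is_lift: "is_lift (monodromy_path W H h d \<gamma>) (s_H W H)"
  unfolding monodromy_path_eq is_lift_def
  using data_simps(4-7) arc_path_path arc_ends act_path_path[OF s_H_W, of "reversepath \<gamma>"] s_H_W
  by (simp add: path_image_join)

lemma monodromy_generator_eq: "monodromy_generator W H h d \<gamma> = braid (monodromy_path W H h d \<gamma>)"
  by (simp add: monodromy_generator_def braid_def)

text \<open>The contributions of \<open>\<gamma>\<close> to the winding number of the power telescope; only the arcs remain.\<close>

lemma theta_monodromy_arcs:
  assumes \<beta>: "regular \<beta>"
  shows "theta \<beta> (monodromy_generator W H h d \<gamma> [^]\<^bsub>B\<^esub> e_H W H) =
    (\<Sum>j<e_H W H. winding_number (\<lambda>t. \<beta> (h + rot (of_nat j + t) *s d)) 0)"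
proof -
  let ?s = "s_H W H" and ?e = "e_H W H"
  let ?m = "monodromy_path W H h d \<gamma>"
  define A where "A j = winding_number (\<lambda>t. \<beta> ((?s [^]\<^bsub>GL\<^esub> j) *v \<gamma> t)) 0" for j :: nat
  have "winding_number (\<lambda>t. \<beta> ((?s [^]\<^bsub>GL\<^esub> j) *v ?m t)) 0 =
      winding_number (\<lambda>t. \<beta> (h + rot (of_nat j + t) *s d)) 0 + (A j - A (Suc j))" for j :: nat
  proof -
    let ?p = "?s [^]\<^bsub>GL\<^esub> j"
    have pW: "?p \<in> W"
      using braid_power[OF \<beta> monodromy_is_lift, of j] by (auto simp: is_lift_def)
    define f where "f x = \<beta> (?p *v x)" for x
    have f: "regular f" unfolding f_def by (rule regular_act[OF \<beta> pW])
    note sr = act_path_path[OF s_H_W, of "reversepath \<gamma>"]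
    have "winding_number (f \<circ> ?m) 0 = winding_number (f \<circ> \<gamma>) 0 + (winding_number (f \<circ> arc_path) 0 +
        winding_number (f \<circ> act_path ?s (reversepath \<gamma>)) 0)"
      unfolding monodromy_path_eq path_compose_join
      using regular_path[OF f data_simps(4,5)] regular_path[OF f arc_path_path] regular_path[OF f sr]
        data_simps(4-7) arc_ends
      by (subst winding_number_join; (subst winding_number_join)?)
        (auto simp: path_image_join pathfinish_compose pathstart_compose)
    moreover have "f \<circ> act_path ?s (reversepath \<gamma>) = reversepath (\<lambda>t. \<beta> ((?s [^]\<^bsub>GL\<^esub> Suc j) *v \<gamma> t))"
      by (simp add: f_def fun_eq_iff act_path_def reversepath_def nat_pow_def)
        (simp add: GL_def matrix_vector_mul_assoc)
    moreover have "winding_number (reversepath (\<lambda>t. \<beta> ((?s [^]\<^bsub>GL\<^esub> Suc j) *v \<gamma> t))) 0 = - A (Suc j)"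
    proof -
      have "?s [^]\<^bsub>GL\<^esub> Suc j \<in> W"
        using braid_power[OF \<beta> monodromy_is_lift, of "Suc j"] by (auto simp: is_lift_def)
      from regular_path[OF regular_act[OF \<beta> this] data_simps(4,5)] show ?thesis
        unfolding A_def by (intro winding_number_reversepath) (auto simp: comp_def)
    qed
    moreover have "f \<circ> arc_path = (\<lambda>t. \<beta> (h + rot (of_nat j + t) *s d))"
      by (simp add: f_def fun_eq_iff arc_path_def s_H_power_arc rot_add)
    ultimately show ?thesis by (simp add: f_def comp_def A_def)
  qed
  \<comment> \<open>The telescoping sum is \<open>A 0 - A ?e\<close>, which vanishes because the
    power of the generator with exponent \<open>e_H\<close> is the identity.\<close>
  moreover have "A ?e = A 0" by (simp add: A_def s_H_power_one[OF H]) (simp add: nat_pow_def GL_def)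
  ultimately show ?thesis
    using braid_power[OF \<beta> monodromy_is_lift, of ?e]
    by (auto simp: monodromy_generator_eq sum.distrib sum_lessThan_telescope')
qed

text \<open>Along an arc the form is a constant times an exponential, so its logarithm is explicit;
  each of the \<open>e_H\<close> arcs contributes \<open>1 / e_H\<close>.\<close>

lemma theta_monodromy_same: "theta (form H) (monodromy_generator W H h d \<gamma> [^]\<^bsub>B\<^esub> e_H W H) = 1"
proof -
  have "winding_number (\<lambda>t. form H (h + rot (of_nat j + t) *s d)) 0 = 1 / of_nat (e_H W H)" for j :: nat
  proof -
    define L where "L t = 2 * \<i> * of_real pi * of_real (of_nat j + t) / of_nat (e_H W H) + Ln (form H d)" for t :: real
    have "winding_number (\<lambda>t. form H (h + rot (of_nat j + t) *s d)) 0 = (L 1 - L 0) / (2 * of_real pi * \<i>)"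
    proof (rule winding_number_log)
      show "continuous_on {0..1} L" unfolding L_def by (intro continuous_intros) (use e_H_pos[of H] in auto)
      show "form H (h + rot (of_nat j + t) *s d) = exp (L t)" for t
        using form_d form_on[OF H data_simps(1)] by (simp add: form_add form_scale L_def rot_def exp_add)
    qed
    also have "L 1 - L 0 = 2 * of_real pi * \<i> / of_nat (e_H W H)"
      by (simp add: L_def diff_divide_distrib[symmetric] algebra_simps)
    finally show ?thesis by simp
  qed
  then show ?thesis using theta_monodromy_arcs[OF regular_form[OF H]] e_H_pos[of H] by simp
qed

text \<open>On the disc the form of \<open>L\<close> is an affine function of \<open>z\<close>
  without zeros, so its constant term dominates. It then has a continuous logarithm on the unit
  circle, and the arcs, which close up, contribute zero in total.\<close>

lemma theta_monodromy_other:
  assumes L: "L \<in> hyperplanes W" "L \<noteq> H"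
  shows "theta (form L) (monodromy_generator W H h d \<gamma> [^]\<^bsub>B\<^esub> e_H W H) = 0"
proof -
  define a b where "a = form L h" and "b = form L d"
  have ne: "a + z * b \<noteq> 0" if "norm z \<le> 1" for z
    using data_simps(8)[OF L that] by (simp add: form_iff[OF L(1)] form_add form_scale a_def b_def)
  have a0: "a \<noteq> 0" using ne[of 0] by simp
  have ab: "norm b < norm a"
  proof (rule ccontr)
    assume "\<not> norm b < norm a"
    then have "b \<noteq> 0" "norm (- a / b) \<le> 1" using a0 by (auto simp: norm_divide divide_le_eq_1)
    then show False using ne[of "- a / b"] by simp
  qed
  \<comment> \<open>Factoring out \<open>a\<close> leaves values in the right half plane, where
    \<open>Ln\<close> is continuous.\<close>
  define l where "l z = Ln a + Ln (1 + z * (b / a))" for z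
  have re: "Re (1 + z * (b / a)) > 0" if "norm z = 1" for z
  proof -
    have "norm (z * (b / a)) < 1" using that ab a0 by (simp add: norm_mult norm_divide)
    then show ?thesis using abs_Re_le_cmod[of "z * (b / a)"] by simp
  qed
  have l: "exp (l z) = a + z * b" if "norm z = 1" for z
  proof -
    have "1 + z * (b / a) \<noteq> 0" using re[OF that] by (metis zero_complex.simps(1) less_irrefl)
    then show ?thesis using a0 by (simp add: l_def exp_add field_simps)
  qed
  have "winding_number (\<lambda>t. form L (h + rot (of_nat j + t) *s d)) 0 =
      (l (rot (of_nat (Suc j))) - l (rot (of_nat j))) / (2 * of_real pi * \<i>)" for j :: nat
  proof -
    have "winding_number (\<lambda>t. form L (h + rot (of_nat j + t) *s d)) 0 =
      (l (rot (of_nat j + 1)) - l (rot (of_nat j + 0))) / (2 * of_real pi * \<i>)"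
    proof (rule winding_number_log)
      have "continuous_on {0..1} (\<lambda>t. rot (of_nat j + t))"
        by (intro continuous_on_compose2[OF rot_continuous[of UNIV]] continuous_intros) auto
      then show "continuous_on {0..1} (\<lambda>t. l (rot (of_nat j + t)))"
        unfolding l_def using re[OF rot_norm] a0
        by (intro continuous_intros) (auto simp: complex_nonpos_Reals_iff not_le)
      show "form L (h + rot (of_nat j + t) *s d) = exp (l (rot (of_nat j + t)))" for t
        by (simp add: l[OF rot_norm] form_add form_scale a_def b_def)
    qed
    then show ?thesis by (simp add: add.commute)
  qed
  then show ?thesis
    using theta_monodromy_arcs[OF regular_form[OF L(1)]]
      sum_lessThan_telescope[of "\<lambda>j. l (rot (of_nat j))" "e_H W H"]
    by (simp add: rot_e rot_0 flip: sum_divide_distrib)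
qed

lemma monodromy_power_pure: "monodromy_generator W H h d \<gamma> [^]\<^bsub>B\<^esub> e_H W H \<in> P"
  using braid_power[OF regular_form[OF H] monodromy_is_lift, of "e_H W H"] s_H_power_one[OF H]
  by (auto simp: monodromy_generator_eq pure_braids_eq)

end

end

section \<open>The abelianised braid extension\<close>

context braid_setup
begin

abbreviation "Q \<equiv> pure_braid_ab W x0"
abbreviation "E \<equiv> braid_ab W x0"

lemma Q_comm_group: "comm_group Q"
proof -
  interpret PB: group "B\<lparr>carrier := P\<rparr>"
    using subgroup.subgroup_is_group[OF P_subgroup braid_group_group] .
  show ?thesis
    using PB.derived_quot_is_comm_group group.derived_consistent[OF braid_group_group order.refl P_subgroup]
    by (simp add: pure_braid_ab_def)
qed

lemma Q_carrier: "carrier Q = (\<lambda>p. K #>\<^bsub>B\<^esub> p) ` P"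
  by (auto simp: pure_braid_ab_def FactGroup_def RCOSETS_def r_coset_def)

lemma Q_mult:
  assumes "p \<in> P" "p' \<in> P"
  shows "(K #>\<^bsub>B\<^esub> p) \<otimes>\<^bsub>Q\<^esub> (K #>\<^bsub>B\<^esub> p') = K #>\<^bsub>B\<^esub> (p \<otimes>\<^bsub>B\<^esub> p')"
proof -
  have "(K #>\<^bsub>B\<^esub> p) <#>\<^bsub>B\<^esub> (K #>\<^bsub>B\<^esub> p') = K #>\<^bsub>B\<^esub> (p \<otimes>\<^bsub>B\<^esub> p')"
    using assms P_subset by (intro normal.rcos_sum[OF K_normal]) auto
  then show ?thesis by (simp add: pure_braid_ab_def FactGroup_def set_mult_def)
qed

lemma E_group: "group E"
  unfolding braid_ab_def by (rule normal.factorgroup_is_group[OF K_normal])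

lemma E_carrier: "carrier E = (\<lambda>b. K #>\<^bsub>B\<^esub> b) ` carrier B"
  by (auto simp: braid_ab_def FactGroup_def RCOSETS_def)

lemma E_mult:
  assumes "a \<in> carrier B" "b \<in> carrier B"
  shows "(K #>\<^bsub>B\<^esub> a) \<otimes>\<^bsub>E\<^esub> (K #>\<^bsub>B\<^esub> b) = K #>\<^bsub>B\<^esub> (a \<otimes>\<^bsub>B\<^esub> b)"
  using normal.rcos_sum[OF K_normal assms] by (simp add: braid_ab_def FactGroup_def)

lemma Theta_mult:
  assumes \<beta>: "regular \<beta>" and "X \<in> carrier Q" "Y \<in> carrier Q"
  shows "Theta \<beta> (X \<otimes>\<^bsub>Q\<^esub> Y) = Theta \<beta> X + Theta \<beta> Y"
proof -
  obtain p p' where p: "p \<in> P" "X = K #>\<^bsub>B\<^esub> p" "p' \<in> P" "Y = K #>\<^bsub>B\<^esub> p'" using assms by (auto simp: Q_carrier)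
  then have "p \<in> carrier B" "p' \<in> carrier B" "p \<otimes>\<^bsub>B\<^esub> p' \<in> carrier B"
    using P_subset subgroup.m_closed[OF P_subgroup] by blast+
  then show ?thesis using p theta_pure_mult[OF \<beta>] by (simp add: Q_mult Theta_coset[OF \<beta>])
qed

lemma Theta_one: assumes \<beta>: "regular \<beta>" shows "Theta \<beta> \<one>\<^bsub>Q\<^esub> = 0"
proof -
  interpret Q: comm_group Q by (rule Q_comm_group)
  show ?thesis using Theta_mult[OF \<beta> Q.one_closed Q.one_closed] by simp
qed

lemma Theta_int_pow:
  assumes \<beta>: "regular \<beta>" and X: "X \<in> carrier Q"
  shows "Theta \<beta> (X [^]\<^bsub>Q\<^esub> (n::int)) = of_int n * Theta \<beta> X"
proof -
  interpret Q: comm_group Q by (rule Q_comm_group)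
  have nat: "Theta \<beta> (X [^]\<^bsub>Q\<^esub> (k::nat)) = of_nat k * Theta \<beta> X" for k
    by (induction k) (simp_all add: Theta_one[OF \<beta>] Theta_mult[OF \<beta>] X algebra_simps)
  have inv: "Theta \<beta> (inv\<^bsub>Q\<^esub> Y) = - Theta \<beta> Y" if "Y \<in> carrier Q" for Y
    using Theta_mult[OF \<beta> that Q.inv_closed[OF that]] that
    by (simp add: Theta_one[OF \<beta>] eq_neg_iff_add_eq_0 add.commute)
  show ?thesis
  proof (cases "n \<ge> 0")
    case True
    then obtain k where "n = int k" using nonneg_int_cases by blast
    then show ?thesis using nat by (simp add: int_pow_int)
  next
    case False
    then obtain k where k: "n = - int k" by (metis linear neg_0_le_iff_le nonneg_int_cases minus_minus)
    then show ?thesis using nat inv[OF Q.nat_pow_closed[OF X]] Q.int_pow_neg[OF X, of "int k"]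
      by (simp add: int_pow_int)
  qed
qed

lemma Theta_finprod:
  assumes \<beta>: "regular \<beta>" and "finite A" "f \<in> A \<rightarrow> carrier Q"
  shows "Theta \<beta> (finprod Q f A) = (\<Sum>a\<in>A. Theta \<beta> (f a))"
  using assms(2,3)
proof (induction A)
  case empty
  interpret Q: comm_group Q by (rule Q_comm_group)
  show ?case by (simp add: Theta_one[OF \<beta>])
next
  case (insert a A)
  interpret Q: comm_group Q by (rule Q_comm_group)
  from insert show ?case by (simp add: Theta_mult[OF \<beta>] Q.finprod_closed)
qed

text \<open>By the two preceding winding computations the functionals \<open>Theta (form L)\<close>
  are dual to the meridians.\<close>

lemma meridian_map_props:
  assumes data: "\<And>H. H \<in> hyperplanes W \<Longrightarrow> monodromy_data W ip x0 H (h H) (d H) (\<gamma> H)"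
  shows "meridian_map W x0 h d \<gamma> c \<in> carrier Q"
    and "L \<in> hyperplanes W \<Longrightarrow> Theta (form L) (meridian_map W x0 h d \<gamma> c) = of_int (Poly_Mapping.lookup c L)"
proof -
  interpret Q: comm_group Q by (rule Q_comm_group)
  define m where "m H = K #>\<^bsub>B\<^esub> (monodromy_generator W H (h H) (d H) (\<gamma> H) [^]\<^bsub>B\<^esub> e_H W H)" for H
  have m: "m H \<in> carrier Q" if "H \<in> hyperplanes W" for H
    using monodromy_power_pure[OF that data[OF that]] by (auto simp: m_def Q_carrier)
  have eq: "meridian_map W x0 h d \<gamma> c = finprod Q (\<lambda>H. m H [^]\<^bsub>Q\<^esub> Poly_Mapping.lookup c H) (hyperplanes W)"
    by (simp add: meridian_map_def m_def)
  show "meridian_map W x0 h d \<gamma> c \<in> carrier Q"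
    unfolding eq using m by (intro Q.finprod_closed) auto
  assume L: "L \<in> hyperplanes W"
  have T: "Theta (form L) (m H) = (if H = L then 1 else 0)" if H: "H \<in> hyperplanes W" for H
  proof -
    have "Theta (form L) (m H) =
        theta (form L) (monodromy_generator W H (h H) (d H) (\<gamma> H) [^]\<^bsub>B\<^esub> e_H W H)"
      unfolding m_def
      by (rule Theta_coset[OF regular_form[OF L] subsetD[OF P_subset monodromy_power_pure[OF H data[OF H]]]])
    also have "\<dots> = (if H = L then 1 else 0)"
    proof (cases "H = L")
      case True then show ?thesis using theta_monodromy_same[OF H data[OF H]] by simp
    next
      case False then show ?thesis using theta_monodromy_other[OF H data[OF H] L] by simp
    qed
    finally show ?thesis .
  qed
  have "Theta (form L) (meridian_map W x0 h d \<gamma> c) =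
      (\<Sum>H\<in>hyperplanes W. of_int (Poly_Mapping.lookup c H) * (if H = L then 1 else 0))"
    unfolding eq using m T
    by (subst Theta_finprod[OF regular_form[OF L] finite_hyperplanes])
      (auto simp: Theta_int_pow[OF regular_form[OF L]] intro!: sum.cong)
  also have "\<dots> = of_int (Poly_Mapping.lookup c L)"
    using L finite_hyperplanes by (simp add: if_distrib sum.delta cong: if_cong)
  finally show "Theta (form L) (meridian_map W x0 h d \<gamma> c) = of_int (Poly_Mapping.lookup c L)" .
qed

lemma section_lift:
  assumes X: "X \<in> carrier E" and n: "braid_ab_proj W x0 X = n"
  obtains g where "is_lift g n" "X = K #>\<^bsub>B\<^esub> braid g"
proof -
  obtain b where b: "b \<in> carrier B" "X = K #>\<^bsub>B\<^esub> b" using X by (auto simp: E_carrier)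
  obtain g w where g: "is_lift g w" "b = braid g" using b(1) by (rule carrierE)
  have "w = n" using n braid_ab_proj_coset[OF b(1)] braid_proj_braid[OF g(1)] by (simp add: b(2) g(2))
  then show ?thesis using that g b by blast
qed

text \<open>The form changes along a lift from its value at \<open>x0\<close> to its value at
  \<open>n *v x0\<close>, and the ratio of the two is the natural character of
  \<open>n\<close>.\<close>

lemma Theta_section_exp:
  assumes H: "H \<in> hyperplanes W" and n: "n \<in> stabilizer W H"
    and X: "X \<in> carrier E" "braid_ab_proj W x0 X = n"
  shows "exp (2 * \<i> * of_real pi * Theta (form H) X) = natural_char ip H n"
proof -
  obtain g where g: "is_lift g n" "X = K #>\<^bsub>B\<^esub> braid g" using section_lift[OF X] .
  have "Theta (form H) X = theta (form H) (braid g)"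
    using Theta_coset[OF regular_form[OF H] braid_carrier[OF g(1)]] g(2) by simp
  then show ?thesis
    using exp_theta[OF regular_form[OF H] g(1)] form_char[OF H n] form_Vreg[OF H x0] by simp
qed

text \<open>The stabilizer of \<open>H\<close> scales the linear form of \<open>H\<close>, which does not change winding numbers.\<close>

lemma Theta_section_mult:
  assumes H: "H \<in> hyperplanes W" and n: "n \<in> stabilizer W H"
    and X: "X \<in> carrier E" "braid_ab_proj W x0 X = n" and Y: "Y \<in> carrier E"
  shows "Theta (form H) (X \<otimes>\<^bsub>E\<^esub> Y) = Theta (form H) X + Theta (form H) Y"
proof -
  obtain g where g: "is_lift g n" "X = K #>\<^bsub>B\<^esub> braid g" using section_lift[OF X] .
  obtain b where b: "b \<in> carrier B" "Y = K #>\<^bsub>B\<^esub> b" using Y by (auto simp: E_carrier)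
  note reg = regular_form[OF H] and gB = braid_carrier[OF g(1)]
  have "braid g \<otimes>\<^bsub>B\<^esub> b \<in> carrier B"
    using group.is_monoid[OF braid_group_group] gB b(1) by (simp add: monoid.m_closed)
  then have "Theta (form H) (X \<otimes>\<^bsub>E\<^esub> Y) = theta (form H) (braid g \<otimes>\<^bsub>B\<^esub> b)"
    by (simp add: g(2) b(2) E_mult[OF gB b(1)] Theta_coset[OF reg])
  also have "\<dots> = theta (form H) (braid g) + theta (\<lambda>x. natural_char ip H n * form H x) b"
    using theta_mult[OF reg g(1) b(1)] by (simp add: form_char[OF H n])
  also have "theta (\<lambda>x. natural_char ip H n * form H x) b = theta (form H) b"
    by (rule theta_scale[OF reg b(1) natural_char_nonzero[OF H n]])
  finally show ?thesis by (simp add: g(2) b(2) Theta_coset[OF reg] gB b(1))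
qed

lemma Q_subset_E: "X \<in> carrier Q \<Longrightarrow> X \<in> carrier E \<and> braid_ab_proj W x0 X = mat 1"
proof -
  assume "X \<in> carrier Q"
  then obtain p where p: "p \<in> P" "X = K #>\<^bsub>B\<^esub> p" by (auto simp: Q_carrier)
  then obtain g where g: "is_lift g (mat 1)" "p = braid g" by (auto simp: pure_braids_eq)
  then show ?thesis using p braid_carrier[OF g(1)] braid_ab_proj_coset[of p] braid_proj_braid[OF g(1)]
    by (auto simp: E_carrier)
qed

lemma Theta_extension_cocycle:
  assumes H: "H \<in> hyperplanes W" and n: "n \<in> stabilizer W H" and n': "n' \<in> stabilizer W H"
    and data: "\<And>H. H \<in> hyperplanes W \<Longrightarrow> monodromy_data W ip x0 H (h H) (d H) (\<gamma> H)"
    and s: "s \<in> W \<rightarrow> carrier E" "\<And>g. g \<in> W \<Longrightarrow> braid_ab_proj W x0 (s g) = g"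
    and c: "meridian_map W x0 h d \<gamma> c = s n \<otimes>\<^bsub>E\<^esub> s n' \<otimes>\<^bsub>E\<^esub> inv\<^bsub>E\<^esub> (s (n ** n'))"
  shows "of_int (Poly_Mapping.lookup c H) =
    Theta (form H) (s n') - Theta (form H) (s (n ** n')) + Theta (form H) (s n)"
proof -
  interpret E: group E by (rule E_group)
  have W: "n \<in> W" "n' \<in> W" "n ** n' \<in> W" using n n' W_mult by (auto simp: stabilizer_def)
  then have sE: "s n \<in> carrier E" "s n' \<in> carrier E" "s (n ** n') \<in> carrier E" using s(1) by auto
  note m = meridian_map_props[of h d \<gamma>, OF data]
  note mE = Q_subset_E[OF m(1)]
  \<comment> \<open>The inverse is moved to the other side because additivity of
    \<open>Theta\<close> is available for a left factor over the stabilizer; the meridian element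
    lies over \<open>mat 1\<close>.\<close>
  have "meridian_map W x0 h d \<gamma> c \<otimes>\<^bsub>E\<^esub> s (n ** n') = s n \<otimes>\<^bsub>E\<^esub> s n'"
    unfolding c using sE by (simp add: E.m_assoc)
  then have "Theta (form H) (meridian_map W x0 h d \<gamma> c) + Theta (form H) (s (n ** n')) =
      Theta (form H) (s n) + Theta (form H) (s n')"
    using Theta_section_mult[OF H stabilizer_one conjunct1[OF mE] conjunct2[OF mE] sE(3)]
      Theta_section_mult[OF H n sE(1) s(2)[OF W(1)] sE(2)] by metis
  then show ?thesis using m(2)[OF _ H] by (simp add: algebra_simps)
qed

end

section \<open>Second cohomology\<close>

definition coboundary ::
    "('g, 'a) monoid_scheme \<Rightarrow> ('m, 'b) monoid_scheme \<Rightarrow> ('g \<Rightarrow> 'm \<Rightarrow> 'm) \<Rightarrow> ('g \<Rightarrow> 'm) \<Rightarrow> 'g \<times> 'g \<Rightarrow> 'm" where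
  "coboundary G M act \<eta> =
     (\<lambda>(a, b)\<in>carrier G \<times> carrier G. act a (\<eta> b) \<otimes>\<^bsub>M\<^esub> inv\<^bsub>M\<^esub> (\<eta> (a \<otimes>\<^bsub>G\<^esub> b)) \<otimes>\<^bsub>M\<^esub> \<eta> a)"

lemma coboundaries2_eq: "coboundaries2 G M act = coboundary G M act ` (carrier G \<rightarrow> carrier M)"
  by (simp add: coboundaries2_def coboundary_def[abs_def])

locale group_module = G: group G + M: comm_group M
  for G :: "('g, 'a) monoid_scheme" and M :: "('m, 'b) monoid_scheme" and act :: "'g \<Rightarrow> 'm \<Rightarrow> 'm" +
  assumes act_hom: "\<And>g. g \<in> carrier G \<Longrightarrow> act g \<in> hom M M"
begin

abbreviation "C2 \<equiv> cochains2 G M"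

lemma C2_simps: "carrier C2 = (carrier G \<times> carrier G) \<rightarrow>\<^sub>E carrier M"
  "\<phi> \<otimes>\<^bsub>C2\<^esub> \<psi> = (\<lambda>x\<in>carrier G \<times> carrier G. \<phi> x \<otimes>\<^bsub>M\<^esub> \<psi> x)"
  "\<one>\<^bsub>C2\<^esub> = (\<lambda>x\<in>carrier G \<times> carrier G. \<one>\<^bsub>M\<^esub>)"
  by (simp_all add: cochains2_def)

lemma C2_group: "group C2"
proof (rule groupI)
  fix \<phi> assume p: "\<phi> \<in> carrier C2"
  show "\<one>\<^bsub>C2\<^esub> \<otimes>\<^bsub>C2\<^esub> \<phi> = \<phi>"
  proof
    fix x show "(\<one>\<^bsub>C2\<^esub> \<otimes>\<^bsub>C2\<^esub> \<phi>) x = \<phi> x"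
    proof (cases "x \<in> carrier G \<times> carrier G")
      case True
      then have "\<phi> x \<in> carrier M" using p by (auto simp: C2_simps PiE_iff)
      then show ?thesis using True by (auto simp: C2_simps)
    next
      case False
      then have "\<phi> x = undefined" using p PiE_arb[of \<phi> _ "\<lambda>_. carrier M" x] unfolding C2_simps by blast
      then show ?thesis using False by (simp add: C2_simps restrict_def)
    qed
  qed
  show "\<exists>\<psi>\<in>carrier C2. \<psi> \<otimes>\<^bsub>C2\<^esub> \<phi> = \<one>\<^bsub>C2\<^esub>"
  proof (rule bexI)
    show "(\<lambda>x\<in>carrier G \<times> carrier G. inv\<^bsub>M\<^esub> (\<phi> x)) \<otimes>\<^bsub>C2\<^esub> \<phi> = \<one>\<^bsub>C2\<^esub>"
      unfolding C2_simps by (rule restrict_ext) (use p in \<open>auto simp: C2_simps PiE_iff\<close>)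
    show "(\<lambda>x\<in>carrier G \<times> carrier G. inv\<^bsub>M\<^esub> (\<phi> x)) \<in> carrier C2"
      using p by (auto simp: C2_simps PiE_iff)
  qed
next
  fix \<phi> \<psi> \<omega> assume "\<phi> \<in> carrier C2" "\<psi> \<in> carrier C2" "\<omega> \<in> carrier C2"
  then show "\<phi> \<otimes>\<^bsub>C2\<^esub> \<psi> \<otimes>\<^bsub>C2\<^esub> \<omega> = \<phi> \<otimes>\<^bsub>C2\<^esub> (\<psi> \<otimes>\<^bsub>C2\<^esub> \<omega>)"
    unfolding C2_simps by (intro restrict_ext) (auto simp: M.m_assoc PiE_iff)
qed (auto simp: C2_simps PiE_iff)

abbreviation "cob \<equiv> coboundary G M act"

lemma cob_apply: "a \<in> carrier G \<Longrightarrow> b \<in> carrier G \<Longrightarrow>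
    cob \<eta> (a, b) = act a (\<eta> b) \<otimes>\<^bsub>M\<^esub> inv\<^bsub>M\<^esub> (\<eta> (a \<otimes>\<^bsub>G\<^esub> b)) \<otimes>\<^bsub>M\<^esub> \<eta> a"
  by (simp add: coboundary_def)

lemma act_closed: "g \<in> carrier G \<Longrightarrow> m \<in> carrier M \<Longrightarrow> act g m \<in> carrier M"
  using act_hom by (auto simp: hom_def)

lemma cob_closed: "\<eta> \<in> carrier G \<rightarrow> carrier M \<Longrightarrow> cob \<eta> \<in> carrier C2"
  by (auto simp: C2_simps coboundary_def PiE_iff extensional_def act_closed Pi_iff)

lemma cob_mult:
  assumes "\<eta> \<in> carrier G \<rightarrow> carrier M" "\<theta> \<in> carrier G \<rightarrow> carrier M"
  shows "cob \<eta> \<otimes>\<^bsub>C2\<^esub> cob \<theta> = cob (\<lambda>g. \<eta> g \<otimes>\<^bsub>M\<^esub> \<theta> g)"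
proof
  fix x show "(cob \<eta> \<otimes>\<^bsub>C2\<^esub> cob \<theta>) x = cob (\<lambda>g. \<eta> g \<otimes>\<^bsub>M\<^esub> \<theta> g) x"
  proof (cases "x \<in> carrier G \<times> carrier G")
    case True
    then obtain a b where ab: "a \<in> carrier G" "b \<in> carrier G" "x = (a, b)" by auto
    have ab': "a \<otimes>\<^bsub>G\<^esub> b \<in> carrier G" using ab by simp
    have cl: "\<And>g. g \<in> carrier G \<Longrightarrow> \<eta> g \<in> carrier M" "\<And>g. g \<in> carrier G \<Longrightarrow> \<theta> g \<in> carrier M" using assms by auto
    have "act a (\<eta> b \<otimes>\<^bsub>M\<^esub> \<theta> b) = act a (\<eta> b) \<otimes>\<^bsub>M\<^esub> act a (\<theta> b)"
      using hom_mult[OF act_hom[OF ab(1)]] cl ab by blast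
    then show ?thesis using ab ab' cl act_closed[OF ab(1)]
      by (simp add: C2_simps cob_apply M.inv_mult M.m_ac)
  qed (auto simp: C2_simps coboundary_def)
qed

lemma act_one: "g \<in> carrier G \<Longrightarrow> act g \<one>\<^bsub>M\<^esub> = \<one>\<^bsub>M\<^esub>"
  using hom_one[OF act_hom M.group_axioms M.group_axioms] .

lemma cob_one: "cob (\<lambda>_. \<one>\<^bsub>M\<^esub>) = \<one>\<^bsub>C2\<^esub>"
  by (auto simp: coboundary_def C2_simps act_one intro!: restrict_ext)

lemma coboundaries_subgroup: "subgroup (coboundaries2 G M act) C2"
proof (rule group.subgroupI[OF C2_group])
  show "coboundaries2 G M act \<subseteq> carrier C2" using cob_closed by (auto simp: coboundaries2_eq)
  show "coboundaries2 G M act \<noteq> {}" unfolding coboundaries2_eq by (auto intro!: exI[of _ "\<lambda>_. \<one>\<^bsub>M\<^esub>"])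
next
  fix \<phi> assume "\<phi> \<in> coboundaries2 G M act"
  then obtain \<eta> where \<eta>: "\<eta> \<in> carrier G \<rightarrow> carrier M" "\<phi> = cob \<eta>" by (auto simp: coboundaries2_eq)
  define \<theta> where "\<theta> g = (if g \<in> carrier G then inv\<^bsub>M\<^esub> (\<eta> g) else \<one>\<^bsub>M\<^esub>)" for g
  have \<theta>: "\<theta> \<in> carrier G \<rightarrow> carrier M" using funcset_mem[OF \<eta>(1)] by (auto simp: \<theta>_def)
  have "cob \<theta> \<otimes>\<^bsub>C2\<^esub> \<phi> = cob (\<lambda>g. \<theta> g \<otimes>\<^bsub>M\<^esub> \<eta> g)" using cob_mult[OF \<theta> \<eta>(1)] \<eta>(2) by simp
  also have "\<dots> = \<one>\<^bsub>C2\<^esub>"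
    unfolding cob_one[symmetric] using M.l_inv[OF funcset_mem[OF \<eta>(1)]]
    by (auto simp: coboundary_def \<theta>_def intro!: restrict_ext)
  finally have "inv\<^bsub>C2\<^esub> \<phi> = cob \<theta>"
    using group.inv_equality[OF C2_group _ cob_closed[OF \<eta>(1)] cob_closed[OF \<theta>]] \<eta>(2) by simp
  then show "inv\<^bsub>C2\<^esub> \<phi> \<in> coboundaries2 G M act" using \<theta> by (auto simp: coboundaries2_eq)
next
  fix \<phi> \<psi> assume "\<phi> \<in> coboundaries2 G M act" "\<psi> \<in> coboundaries2 G M act"
  then obtain \<eta> \<theta> where "\<eta> \<in> carrier G \<rightarrow> carrier M" "\<phi> = cob \<eta>" "\<theta> \<in> carrier G \<rightarrow> carrier M" "\<psi> = cob \<theta>"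
    by (auto simp: coboundaries2_eq)
  then show "\<phi> \<otimes>\<^bsub>C2\<^esub> \<psi> \<in> coboundaries2 G M act"
    using cob_mult[of \<eta> \<theta>] by (auto simp: coboundaries2_eq intro!: image_eqI[of _ _ "\<lambda>g. \<eta> g \<otimes>\<^bsub>M\<^esub> \<theta> g"])
qed

lemma H2_class_eqI:
  assumes "\<eta> \<in> carrier G \<rightarrow> carrier M" "\<phi> \<in> carrier C2" "\<psi> = cob \<eta> \<otimes>\<^bsub>C2\<^esub> \<phi>"
  shows "H2_class G M act \<psi> = H2_class G M act \<phi>"
  unfolding H2_class_def
proof (rule group.repr_independence[OF C2_group _ assms(2) coboundaries_subgroup, symmetric])
  show "\<psi> \<in> coboundaries2 G M act #>\<^bsub>C2\<^esub> \<phi>"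
    using assms(1,3) by (auto simp: r_coset_def coboundaries2_eq)
qed

lemma H2_class_eqD:
  assumes "\<phi> \<in> carrier C2" "\<psi> \<in> carrier C2" "H2_class G M act \<psi> = H2_class G M act \<phi>"
  shows "\<exists>\<eta>\<in>carrier G \<rightarrow> carrier M. \<psi> = cob \<eta> \<otimes>\<^bsub>C2\<^esub> \<phi>"
proof -
  have "\<psi> \<in> coboundaries2 G M act #>\<^bsub>C2\<^esub> \<phi>"
    using assms(3) group.rcos_self[OF C2_group assms(2) coboundaries_subgroup] by (simp add: H2_class_def)
  then show ?thesis by (auto simp: r_coset_def coboundaries2_eq)
qed

end

text \<open>\<open>the_elem\<close> is meaningful once the whole class has a single image. It
  suffices that \<open>F\<close> changes \<open>\<phi>\<close> by a coboundary only if its argument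
  changed by one, that is, coboundary shifts of \<open>\<phi>\<close> become coboundary shifts of
  \<open>F \<phi>\<close>.\<close>

lemma H2_induced_class:
  assumes "group_module G M act" "group_module G' M' act'"
    and \<phi>: "\<phi> \<in> carrier (cochains2 G M)" and F: "F \<phi> \<in> carrier (cochains2 G' M')"
    and cob: "\<And>\<eta>. \<eta> \<in> carrier G \<rightarrow> carrier M \<Longrightarrow> \<exists>\<theta>\<in>carrier G' \<rightarrow> carrier M'.
      F (coboundary G M act \<eta> \<otimes>\<^bsub>cochains2 G M\<^esub> \<phi>) = coboundary G' M' act' \<theta> \<otimes>\<^bsub>cochains2 G' M'\<^esub> F \<phi>"
  shows "H2_induced G' M' act' F (H2_class G M act \<phi>) = H2_class G' M' act' (F \<phi>)"
proof -
  interpret A: group_module G M act by fact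
  interpret A': group_module G' M' act' by fact
  have "H2_class G' M' act' (F \<psi>) = H2_class G' M' act' (F \<phi>)" if \<psi>: "\<psi> \<in> H2_class G M act \<phi>" for \<psi>
  proof -
    obtain \<eta> where \<eta>: "\<eta> \<in> carrier G \<rightarrow> carrier M" "\<psi> = coboundary G M act \<eta> \<otimes>\<^bsub>cochains2 G M\<^esub> \<phi>"
      using \<psi> by (auto simp: H2_class_def r_coset_def coboundaries2_eq)
    then obtain \<theta> where "\<theta> \<in> carrier G' \<rightarrow> carrier M'"
      "F \<psi> = coboundary G' M' act' \<theta> \<otimes>\<^bsub>cochains2 G' M'\<^esub> F \<phi>" using cob by blast
    then show ?thesis using A'.H2_class_eqI[OF _ F] by blast
  qed
  moreover have "\<phi> \<in> H2_class G M act \<phi>"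
    unfolding H2_class_def by (rule group.rcos_self[OF A.C2_group \<phi> A.coboundaries_subgroup])
  ultimately have "(\<lambda>\<psi>. H2_class G' M' act' (F \<psi>)) ` H2_class G M act \<phi> = {H2_class G' M' act' (F \<phi>)}" by blast
  then show ?thesis by (simp add: H2_induced_def)
qed

section \<open>The connecting homomorphism\<close>

definition rat_class :: "rat \<Rightarrow> rat set" where "rat_class q = \<int> #>\<^bsub>rat_group\<^esub> q"

lemma mem_rat_class: "x \<in> rat_class q \<longleftrightarrow> x - q \<in> \<int>"
proof
  assume "x - q \<in> \<int>"
  then show "x \<in> rat_class q" by (auto simp: rat_class_def r_coset_def rat_group_def intro!: bexI[of _ "x - q"])
qed (auto simp: rat_class_def r_coset_def rat_group_def)

lemma rat_class_eq_iff: "rat_class x = rat_class y \<longleftrightarrow> x - y \<in> \<int>"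
proof
  assume "rat_class x = rat_class y"
  then show "x - y \<in> \<int>" using mem_rat_class[of x x] mem_rat_class[of x y] by simp
next
  assume *: "x - y \<in> \<int>"
  have "z - x \<in> \<int> \<longleftrightarrow> z - y \<in> \<int>" for z
    using Ints_add[OF _ *, of "z - x"] Ints_diff[OF _ *, of "z - y"] by auto
  then show "rat_class x = rat_class y" by (auto simp: mem_rat_class)
qed

lemma carrier_rat_mod_int: "carrier rat_mod_int = range rat_class"
  by (auto simp: rat_mod_int_def FactGroup_def RCOSETS_def rat_class_def rat_group_def)

lemma mult_rat_mod_int: "rat_class x \<otimes>\<^bsub>rat_mod_int\<^esub> rat_class y = rat_class (x + y)"
proof -
  have "rat_class x \<otimes>\<^bsub>rat_mod_int\<^esub> rat_class y = {a + b | a b. a \<in> rat_class x \<and> b \<in> rat_class y}"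
    by (auto simp: rat_mod_int_def FactGroup_def set_mult_def rat_group_def)
  also have "\<dots> = rat_class (x + y)"
  proof
    show "{a + b | a b. a \<in> rat_class x \<and> b \<in> rat_class y} \<subseteq> rat_class (x + y)"
      using Ints_add by (force simp: mem_rat_class add_diff_add)
    show "rat_class (x + y) \<subseteq> {a + b | a b. a \<in> rat_class x \<and> b \<in> rat_class y}"
    proof
      fix z assume "z \<in> rat_class (x + y)"
      then have "z = (z - y) + y" "z - y \<in> rat_class x" "y \<in> rat_class y"
        by (auto simp: mem_rat_class algebra_simps)
      then show "z \<in> {a + b | a b. a \<in> rat_class x \<and> b \<in> rat_class y}" by blast
    qed
  qed
  finally show ?thesis .
qed

lemma group_module_integer: "group G \<Longrightarrow> group_module G integer_group trivial_act"
  by (simp add: group_module_def group_module_axioms_def abelian_integer_group hom_def trivial_act_def)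

lemma coboundary_integer:
  "coboundary G integer_group trivial_act m =
    (\<lambda>(a, b)\<in>carrier G \<times> carrier G. m b - m (a \<otimes>\<^bsub>G\<^esub> b) + m a)"
  by (auto simp: coboundary_def trivial_act_def intro!: restrict_ext)

lemma Ints_the: "x \<in> \<int> \<Longrightarrow> of_int (THE k. of_int k = x) = (x::rat)"
  by (rule theI') (auto elim!: Ints_cases)

text \<open>Names the choice made inside \<open>connecting_hom\<close>, so that it can be compared
  with other lifts.\<close>

definition rat_lift :: "('g \<Rightarrow> rat set) \<Rightarrow> 'g \<Rightarrow> rat" where
  "rat_lift f g = (SOME q. q \<in> f g)"

definition connecting_cocycle :: "('g, 'a) monoid_scheme \<Rightarrow> ('g \<Rightarrow> rat set) \<Rightarrow> 'g \<times> 'g \<Rightarrow> int" where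
  "connecting_cocycle G f = (\<lambda>(a, b)\<in>carrier G \<times> carrier G.
     THE k. of_int k = rat_lift f b - rat_lift f (a \<otimes>\<^bsub>G\<^esub> b) + rat_lift f a)"

lemma connecting_hom_eq: "connecting_hom G f = H2_class G integer_group trivial_act (connecting_cocycle G f)"
  by (simp add: connecting_hom_def Let_def connecting_cocycle_def rat_lift_def)

context
  fixes G :: "('g, 'a) monoid_scheme" (structure)
  assumes G: "group G"
begin

interpretation G: group G by (rule G)
interpretation Z: group_module G integer_group trivial_act by (rule group_module_integer[OF G])

lemma rat_lift_class:
  assumes "f \<in> Hom_gr G rat_mod_int" "g \<in> carrier G" shows "f g = rat_class (rat_lift f g)"
proof -
  have "f g \<in> carrier rat_mod_int" using assms by (auto simp: Hom_gr_def hom_def)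
  then obtain q where q: "f g = rat_class q" by (auto simp: carrier_rat_mod_int)
  then have "q \<in> f g" by (simp add: mem_rat_class)
  then have "rat_lift f g \<in> f g" unfolding rat_lift_def by (rule someI)
  then have "rat_class (rat_lift f g) = rat_class q"
    unfolding rat_class_eq_iff q by (simp only: mem_rat_class)
  then show ?thesis using q by simp
qed

lemma connecting_cocycle_apply:
  assumes f: "f \<in> Hom_gr G rat_mod_int" and ab: "a \<in> carrier G" "b \<in> carrier G"
  shows "of_int (connecting_cocycle G f (a, b)) = rat_lift f b - rat_lift f (a \<otimes> b) + rat_lift f a"
proof -
  have "rat_class (rat_lift f (a \<otimes> b)) = rat_class (rat_lift f a + rat_lift f b)"
    using f ab rat_lift_class[OF f] hom_mult[of f G rat_mod_int a b]
    by (simp add: Hom_gr_def mult_rat_mod_int[symmetric])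
  then have "rat_lift f (a \<otimes> b) - (rat_lift f a + rat_lift f b) \<in> \<int>" by (simp add: rat_class_eq_iff)
  from Ints_minus[OF this] have "rat_lift f b - rat_lift f (a \<otimes> b) + rat_lift f a \<in> \<int>"
    by (simp add: algebra_simps)
  from Ints_the[OF this] show ?thesis using ab by (simp add: connecting_cocycle_def)
qed

lemma integer_cochain: "\<phi> \<in> carrier (cochains2 G integer_group) \<longleftrightarrow> \<phi> \<in> extensional (carrier G \<times> carrier G)"
  by (auto simp: Z.C2_simps PiE_iff)

lemma connecting_cocycle_cochain: "connecting_cocycle G f \<in> carrier (cochains2 G integer_group)"
  unfolding integer_cochain by (auto simp: connecting_cocycle_def extensional_def)

text \<open>The chosen lift and \<open>L\<close> differ by an integer cochain \<open>m\<close>, so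
  their cocycles differ by the coboundary of \<open>m\<close>. This admits winding numbers as the
  lift.\<close>

lemma connecting_hom_lift:
  assumes f: "f \<in> Hom_gr G rat_mod_int" and L: "\<And>g. g \<in> carrier G \<Longrightarrow> f g = rat_class (L g)"
    and \<psi>: "\<psi> \<in> extensional (carrier G \<times> carrier G)"
      "\<And>a b. a \<in> carrier G \<Longrightarrow> b \<in> carrier G \<Longrightarrow> of_int (\<psi> (a, b)) = L b - L (a \<otimes> b) + L a"
  shows "connecting_hom G f = H2_class G integer_group trivial_act \<psi>"
proof -
  have "\<exists>m::int. rat_lift f g = L g + of_int m" if "g \<in> carrier G" for g
  proof -
    have "rat_lift f g - L g \<in> \<int>" using rat_lift_class[OF f that] L[OF that] rat_class_eq_iff[of "rat_lift f g" "L g"] by simp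
    then obtain m where "rat_lift f g - L g = of_int m" by (elim Ints_cases)
    then show ?thesis by (intro exI[of _ m]) (simp add: algebra_simps)
  qed
  then obtain m :: "'g \<Rightarrow> int" where m: "\<And>g. g \<in> carrier G \<Longrightarrow> rat_lift f g = L g + of_int (m g)" by metis
  have "connecting_cocycle G f (a, b) = (m b - m (a \<otimes> b) + m a) + \<psi> (a, b)" if "a \<in> carrier G" "b \<in> carrier G" for a b
  proof -
    have "of_int (connecting_cocycle G f (a, b)) = (of_int ((m b - m (a \<otimes> b) + m a) + \<psi> (a, b)) :: rat)"
      using connecting_cocycle_apply[OF f that] m that \<psi>(2)[OF that] by simp
    then show ?thesis by (simp only: of_int_eq_iff)
  qed
  then have "connecting_cocycle G f = coboundary G integer_group trivial_act m \<otimes>\<^bsub>cochains2 G integer_group\<^esub> \<psi>"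
    unfolding connecting_cocycle_def
    by (auto simp: Z.C2_simps coboundary_integer intro!: restrict_ext)
  then show ?thesis
    unfolding connecting_hom_eq using \<psi>(1) by (intro Z.H2_class_eqI[of m]) (simp_all add: integer_cochain)
qed

text \<open>A rational-valued homomorphism on a finite group vanishes.\<close>

lemma connecting_hom_inj:
  assumes fin: "finite (carrier G)"
  shows "inj_on (connecting_hom G) (Hom_gr G rat_mod_int)"
proof (rule inj_onI)
  fix f f' assume f: "f \<in> Hom_gr G rat_mod_int" and f': "f' \<in> Hom_gr G rat_mod_int"
    and eq: "connecting_hom G f = connecting_hom G f'"
  obtain m where m: "connecting_cocycle G f =
      coboundary G integer_group trivial_act m \<otimes>\<^bsub>cochains2 G integer_group\<^esub> connecting_cocycle G f'"
    using Z.H2_class_eqD[OF connecting_cocycle_cochain connecting_cocycle_cochain] eq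
    unfolding connecting_hom_eq by metis
  \<comment> \<open>The coboundaries of the two lifts differ by that of \<open>m\<close>, so the
    corrected difference \<open>D\<close> is a homomorphism to the rationals.\<close>
  define D where "D g = rat_lift f g - rat_lift f' g - of_int (m g)" for g
  have D: "D (a \<otimes> b) = D a + D b" if ab: "a \<in> carrier G" "b \<in> carrier G" for a b
  proof -
    have "connecting_cocycle G f (a, b) = (m b - m (a \<otimes> b) + m a) + connecting_cocycle G f' (a, b)"
      using ab by (simp add: m Z.C2_simps coboundary_integer)
    then have "(of_int (connecting_cocycle G f (a, b)) :: rat) =
        of_int ((m b - m (a \<otimes> b) + m a) + connecting_cocycle G f' (a, b))" by simp
    then show ?thesis
      using connecting_cocycle_apply[OF f ab] connecting_cocycle_apply[OF f' ab] by (simp add: D_def)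
  qed
  have D1: "D \<one> = 0" using D[of \<one> \<one>] by simp
  have "D g = 0" if g: "g \<in> carrier G" for g
  proof -
    have "D (g [^] k) = of_nat k * D g" for k :: nat
      by (induction k) (simp_all add: D1 D g algebra_simps)
    then have "of_nat (order G) * D g = 0" using G.pow_order_eq_1[OF g] D1 by metis
    then show ?thesis using fin G.one_closed by (auto simp: order_def card_eq_0_iff)
  qed
  then have "rat_lift f g - rat_lift f' g \<in> \<int>" if "g \<in> carrier G" for g
    using that by (metis D_def Ints_of_int right_minus_eq)
  then have "f g = f' g" if "g \<in> carrier G" for g
    using rat_lift_class[OF f that] rat_lift_class[OF f' that] that by (simp add: rat_class_eq_iff)
  moreover have "f \<in> extensional (carrier G)" "f' \<in> extensional (carrier G)" using f f' by (auto simp: Hom_gr_def)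
  ultimately show "f = f'" by (intro extensionalityI)
qed

end

lemma exp_rat_class: "exp_rat_mod_int (rat_class q) = exp (2 * \<i> * of_real pi * of_rat q)"
proof -
  have "exp (2 * \<i> * of_real pi * of_rat x) = exp (2 * \<i> * of_real pi * of_rat q)" if x: "x \<in> rat_class q" for x
  proof -
    obtain k where "x - q = of_int k" using x unfolding mem_rat_class by (rule Ints_cases)
    then have x: "x = q + of_int k" by (simp only: diff_eq_eq add.commute)
    have "2 * \<i> * of_real pi * of_rat x = 2 * \<i> * of_real pi * of_rat q + (2 * of_int k * of_real pi) * \<i>"
      unfolding x of_rat_add by (simp add: ring_distribs)
    then show ?thesis using exp_integer_2pi[of "of_int k"] by (simp add: exp_add)
  qed
  moreover have "q \<in> rat_class q" by (simp add: mem_rat_class)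
  ultimately have "(\<lambda>q. exp (2 * \<i> * of_real pi * of_rat q)) ` rat_class q = {exp (2 * \<i> * of_real pi * of_rat q)}"
    by blast
  then show ?thesis by (simp add: exp_rat_mod_int_def)
qed

lemma exp_rat_mod_int_inj: "inj_on exp_rat_mod_int (carrier rat_mod_int)"
proof (rule inj_onI)
  fix x y assume "x \<in> carrier rat_mod_int" "y \<in> carrier rat_mod_int" and eq: "exp_rat_mod_int x = exp_rat_mod_int y"
  then obtain p q where pq: "x = rat_class p" "y = rat_class q" by (auto simp: carrier_rat_mod_int)
  have "exp (2 * \<i> * of_real pi * of_rat p) = exp (2 * \<i> * of_real pi * of_rat q)"
    using eq by (simp add: pq exp_rat_class)
  then obtain n :: int where "2 * \<i> * of_real pi * of_rat p = 2 * \<i> * of_real pi * of_rat q + (of_int (2 * n) * pi) * \<i>"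
    unfolding exp_eq by blast
  then have "2 * \<i> * of_real pi * of_rat p = 2 * \<i> * of_real pi * (of_rat (q + of_int n) :: complex)"
    by (simp add: of_rat_add algebra_simps)
  then have "(of_rat p :: complex) = of_rat (q + of_int n)" by simp
  then have "p = q + of_int n" by (simp only: of_rat_eq_iff)
  then show "x = y" by (simp add: pq rat_class_eq_iff)
qed

section \<open>The permutation module and the class of the extension\<close>

lemma keys_perm_act:
  assumes "Poly_Mapping.keys c \<subseteq> S" "\<And>K. K \<in> S \<Longrightarrow> act_hyp w K \<in> S"
  shows "Poly_Mapping.keys (perm_act w c) \<subseteq> S"
  unfolding perm_act_def using keys_frag_extend[of "\<lambda>H. frag_of (act_hyp w H)" c] assms
  by (force simp: keys_frag_of)

lemma perm_act_add: "perm_act w (a + b) = perm_act w a + perm_act w b"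
  by (simp add: perm_act_def frag_extend_add)

lemma keys_orbit_projection: "Poly_Mapping.keys (orbit_projection C c) \<subseteq> C"
  unfolding orbit_projection_def using keys_frag_extend[of "\<lambda>H. if H \<in> C then frag_of H else 0" c]
  by (force simp: keys_frag_of split: if_splits)

lemma orbit_projection_perm_act:
  assumes "\<And>K. act_hyp w K \<in> C \<longleftrightarrow> K \<in> C"
  shows "orbit_projection C (perm_act w c) = perm_act w (orbit_projection C c)"
  using subset_UNIV[of "Poly_Mapping.keys c"] unfolding orbit_projection_def perm_act_def
  by (induction c rule: frag_induction) (simp_all add: assms frag_extend_diff)

lemma lookup_orbit_projection:
  assumes "H \<in> C" shows "Poly_Mapping.lookup (orbit_projection C c) H = Poly_Mapping.lookup c H"
  using subset_UNIV[of "Poly_Mapping.keys c"] unfolding orbit_projection_def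
  by (induction c rule: frag_induction) (use assms in \<open>auto simp: frag_extend_diff lookup_minus\<close>)

context hermitian_reflection_group
begin

lemma act_hyp_inj:
  assumes "w \<in> W" "act_hyp w K = act_hyp w L" shows "K = L"
proof -
  obtain v where "v ** w = mat 1" using W_inverse[OF assms(1)] by blast
  then show ?thesis using assms(2) by (metis act_hyp_mult act_hyp_one)
qed

text \<open>\<open>n\<close> acts injectively on hyperplanes and fixes \<open>H\<close>, so nothing
  else is sent to \<open>H\<close>. This is why the coefficient at \<open>H\<close> carries the
  trivial action of the stabilizer.\<close>

lemma lookup_perm_act:
  assumes "n \<in> stabilizer W H"
  shows "Poly_Mapping.lookup (perm_act n c) H = Poly_Mapping.lookup c H"
proof -
  have e: "H = act_hyp n K \<longleftrightarrow> H = K" for K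
    using assms act_hyp_inj[of n K H] by (auto simp: stabilizer_def)
  show ?thesis
    using subset_UNIV[of "Poly_Mapping.keys c"] unfolding perm_act_def
    by (induction c rule: frag_induction) (simp_all add: frag_extend_diff lookup_minus e)
qed

text \<open>Covers both the module on all hyperplanes and the one on a single orbit.\<close>

lemma group_module_perm:
  assumes "\<And>w K. w \<in> W \<Longrightarrow> K \<in> S \<Longrightarrow> act_hyp w K \<in> S"
  shows "group_module (group_of W) (free_Abelian_group S) perm_act"
proof -
  have "perm_act g \<in> hom (free_Abelian_group S) (free_Abelian_group S)" if "g \<in> W" for g
    using keys_perm_act[of _ S g] assms[OF that]
    by (simp add: hom_def Pi_iff perm_act_add)
  then show ?thesis
    using group_W abelian_free_Abelian_group by (simp add: group_module_def group_module_axioms_def)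
qed

lemma group_stabilizer: "group (group_of (stabilizer W H))"
  using subgroup.subgroup_is_group[OF stabilizer_subgroup GL_group] .

context
  fixes C :: "(complex^'n) set set"
  assumes C: "C \<in> hyperplane_orbits W"
begin

lemma orbit_subset: "C \<subseteq> hyperplanes W"
  using C act_hyp_hyperplanes by (auto simp: hyperplane_orbits_def)

lemma orbit_stable_iff: assumes w: "w \<in> W" shows "act_hyp w K \<in> C \<longleftrightarrow> K \<in> C"
proof -
  obtain H0 where H0: "C = (\<lambda>w. act_hyp w H0) ` W" using C by (auto simp: hyperplane_orbits_def)
  have stable: "act_hyp u L \<in> C" if "u \<in> W" "L \<in> C" for u L
    using that W_mult by (auto simp: H0 act_hyp_mult[symmetric])
  obtain v where v: "v \<in> W" "v ** w = mat 1" using W_inverse[OF w] by blast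
  show ?thesis using stable[OF w] stable[OF v(1), of "act_hyp w K"] v(2)
    by (auto simp: act_hyp_one simp flip: act_hyp_mult)
qed

text \<open>The projection is equivariant because the orbit is stable, so it sends the coboundary of
  a cochain to the coboundary of the projected cochain.\<close>

lemma H2_orbit_component_class:
  assumes \<phi>: "\<phi> \<in> carrier (cochains2 (group_of W) (free_Abelian_group (hyperplanes W)))"
  shows "H2_orbit_component W C (H2_class (group_of W) (free_Abelian_group (hyperplanes W)) perm_act \<phi>) =
    H2_class (group_of W) (free_Abelian_group C) perm_act (\<lambda>x\<in>W \<times> W. orbit_projection C (\<phi> x))"
  unfolding H2_orbit_component_def
proof (rule H2_induced_class)
  show "group_module (group_of W) (free_Abelian_group (hyperplanes W)) perm_act"
    using act_hyp_hyperplanes by (intro group_module_perm)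
  show "group_module (group_of W) (free_Abelian_group C) perm_act"
    using orbit_stable_iff by (intro group_module_perm) auto
  show "(\<lambda>x\<in>W \<times> W. orbit_projection C (\<phi> x)) \<in> carrier (cochains2 (group_of W) (free_Abelian_group C))"
    by (simp add: cochains2_def PiE_iff keys_orbit_projection)
  fix \<eta> assume \<eta>: "\<eta> \<in> carrier (group_of W) \<rightarrow> carrier (free_Abelian_group (hyperplanes W))"
  show "\<exists>\<theta>\<in>carrier (group_of W) \<rightarrow> carrier (free_Abelian_group C).
      (\<lambda>x\<in>W \<times> W. orbit_projection C ((coboundary (group_of W) (free_Abelian_group (hyperplanes W)) perm_act \<eta>
          \<otimes>\<^bsub>cochains2 (group_of W) (free_Abelian_group (hyperplanes W))\<^esub> \<phi>) x)) =
      coboundary (group_of W) (free_Abelian_group C) perm_act \<theta>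
        \<otimes>\<^bsub>cochains2 (group_of W) (free_Abelian_group C)\<^esub> (\<lambda>x\<in>W \<times> W. orbit_projection C (\<phi> x))"
    (is "\<exists>\<theta>\<in>_. ?L = ?R \<theta>")
  proof (rule bexI)
    let ?\<theta> = "\<lambda>g. orbit_projection C (\<eta> g)"
    show "?\<theta> \<in> carrier (group_of W) \<rightarrow> carrier (free_Abelian_group C)"
      by (simp add: Pi_iff keys_orbit_projection)
    have k: "Poly_Mapping.keys (\<eta> g) \<subseteq> hyperplanes W" if "g \<in> W" for g
      using funcset_mem[OF \<eta>, of g] that by simp
    have add: "orbit_projection C (x + y) = orbit_projection C x + orbit_projection C y"
      "orbit_projection C (- x) = - orbit_projection C x" for x y
      by (simp_all add: orbit_projection_def frag_extend_add frag_extend_minus)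
    have eq: "orbit_projection C (perm_act a (\<eta> b) + - \<eta> g + \<eta> a + c) =
        perm_act a (orbit_projection C (\<eta> b)) + - orbit_projection C (\<eta> g) + orbit_projection C (\<eta> a) +
        orbit_projection C c" if "a \<in> W" for a b g c
      using orbit_projection_perm_act[of a C "\<eta> b"] orbit_stable_iff[OF that] by (simp only: add)
    have gl: "a \<otimes>\<^bsub>GL\<^esub> b \<in> W" if "a \<in> W" "b \<in> W" for a b using W_mult[OF that] by (simp add: GL_def)
    show "?L = ?R ?\<theta>"
      unfolding coboundary_def cochains2_def
      using k gl eq by (auto simp: keys_orbit_projection intro!: restrict_ext)
  qed
qed (rule \<phi>)

text \<open>On the stabilizer, reading the coefficient at \<open>H\<close> is equivariant for the
  trivial action, so coboundaries restrict to coboundaries.\<close>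

lemma shapiro_class:
  assumes H: "H \<in> C"
    and \<phi>: "\<phi> \<in> carrier (cochains2 (group_of W) (free_Abelian_group C))"
  shows "shapiro W H (H2_class (group_of W) (free_Abelian_group C) perm_act \<phi>) =
    H2_class (group_of (stabilizer W H)) integer_group trivial_act
      (\<lambda>x\<in>stabilizer W H \<times> stabilizer W H. Poly_Mapping.lookup (\<phi> x) H)"
  unfolding shapiro_def
proof (rule H2_induced_class)
  let ?N = "stabilizer W H"
  have NW: "n \<in> W" if "n \<in> ?N" for n using that by (simp add: stabilizer_def)
  show "group_module (group_of W) (free_Abelian_group C) perm_act"
    using orbit_stable_iff by (intro group_module_perm) auto
  show "group_module (group_of ?N) integer_group trivial_act"
    by (rule group_module_integer[OF group_stabilizer])
  show "(\<lambda>x\<in>?N \<times> ?N. Poly_Mapping.lookup (\<phi> x) H) \<in> carrier (cochains2 (group_of ?N) integer_group)"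
    by (auto simp: cochains2_def PiE_iff)
  fix \<eta> assume \<eta>: "\<eta> \<in> carrier (group_of W) \<rightarrow> carrier (free_Abelian_group C)"
  show "\<exists>\<theta>\<in>carrier (group_of ?N) \<rightarrow> carrier integer_group.
      (\<lambda>x\<in>?N \<times> ?N. Poly_Mapping.lookup ((coboundary (group_of W) (free_Abelian_group C) perm_act \<eta>
          \<otimes>\<^bsub>cochains2 (group_of W) (free_Abelian_group C)\<^esub> \<phi>) x) H) =
      coboundary (group_of ?N) integer_group trivial_act \<theta>
        \<otimes>\<^bsub>cochains2 (group_of ?N) integer_group\<^esub> (\<lambda>x\<in>?N \<times> ?N. Poly_Mapping.lookup (\<phi> x) H)"
    (is "\<exists>\<theta>\<in>_. ?L = ?R \<theta>")
  proof (rule bexI)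
    let ?\<theta> = "\<lambda>g. Poly_Mapping.lookup (\<eta> g) H"
    have k: "Poly_Mapping.keys (\<eta> g) \<subseteq> C" if "g \<in> W" for g
      using funcset_mem[OF \<eta>, of g] that by simp
    have gl: "a \<otimes>\<^bsub>GL\<^esub> b \<in> W" if "a \<in> W" "b \<in> W" for a b using W_mult[OF that] by (simp add: GL_def)
    show "?L = ?R ?\<theta>"
      unfolding coboundary_def cochains2_def trivial_act_def
      using k gl NW lookup_perm_act[of _ H] by (auto simp: lookup_add lookup_minus intro!: restrict_ext)
  qed simp
qed (rule \<phi>)

end

lemma natural_char_rat_value:
  assumes n: "n \<in> stabilizer W H"
    and q: "exp (2 * \<i> * of_real pi * of_rat q) = natural_char ip H n"
  shows "natural_char_rat W ip H n = rat_class q"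
proof -
  have "natural_char ip H n = exp_rat_mod_int (rat_class q)" by (simp add: exp_rat_class q)
  then show ?thesis
    using n inv_into_f_f[OF exp_rat_mod_int_inj, of "rat_class q"]
    by (simp add: natural_char_rat_def carrier_rat_mod_int)
qed

text \<open>The character value is a root of unity whose order divides the size \<open>m\<close> of
  the stabilizer, so \<open>m\<close> times \<open>z\<close> is an integer.\<close>

lemma natural_char_rational:
  assumes H: "H \<in> hyperplanes W" and n: "n \<in> stabilizer W H"
    and z: "exp (2 * \<i> * of_real pi * z) = natural_char ip H n"
  shows "\<exists>q. z = of_rat q"
proof -
  define m where "m = card (stabilizer W H)"
  have m: "m > 0"
    using finite_W stabilizer_one by (auto simp: m_def stabilizer_def card_gt_0_iff)
  have "exp (of_nat m * (2 * \<i> * of_real pi * z)) = 1"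
    unfolding exp_of_nat_mult z m_def by (rule natural_char_root_of_unity[OF H n])
  then obtain k :: int where k: "of_nat m * (2 * \<i> * of_real pi * z) = of_int (2 * k) * of_real pi * \<i>"
    unfolding exp_eq_1 by (auto simp: complex_eq_iff)
  then have "of_nat m * z = of_int k" by simp
  then have "z = of_rat (of_int k / of_nat m)" using m by (simp add: of_rat_divide field_simps)
  then show ?thesis by blast
qed

text \<open>The rational logarithms \<open>L\<close> witness that \<open>inv_into\<close> is applied
  inside the range of the exponential map.\<close>

lemma natural_char_rat_hom:
  assumes H: "H \<in> hyperplanes W"
    and L: "\<And>n. n \<in> stabilizer W H \<Longrightarrow> exp (2 * \<i> * of_real pi * of_rat (L n)) = natural_char ip H n"
  shows "natural_char_rat W ip H \<in> Hom_gr (group_of (stabilizer W H)) rat_mod_int"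
proof -
  have v: "natural_char_rat W ip H n = rat_class (L n)" if "n \<in> stabilizer W H" for n
    by (rule natural_char_rat_value[OF that L[OF that]])
  have "natural_char_rat W ip H (a \<otimes>\<^bsub>GL\<^esub> b) = rat_class (L a + L b)"
    if ab: "a \<in> stabilizer W H" "b \<in> stabilizer W H" for a b
  proof (rule natural_char_rat_value)
    show "a \<otimes>\<^bsub>GL\<^esub> b \<in> stabilizer W H" using stabilizer_mult[OF ab] by (simp add: GL_def)
    show "exp (2 * \<i> * of_real pi * of_rat (L a + L b)) = natural_char ip H (a \<otimes>\<^bsub>GL\<^esub> b)"
      using natural_char_mult[OF H ab] L[OF ab(1)] L[OF ab(2)]
      by (simp add: GL_def of_rat_add ring_distribs exp_add)
  qed
  moreover have "natural_char_rat W ip H \<in> extensional (stabilizer W H)" by (simp add: natural_char_rat_def)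
  ultimately show ?thesis
    by (auto simp: Hom_gr_def hom_def v mult_rat_mod_int carrier_rat_mod_int)
qed

end

theorem proposition19:
  fixes W :: "(complex^'n^'n) set"
    and ip :: "complex^'n \<Rightarrow> complex^'n \<Rightarrow> complex"
    and x0 :: "complex^'n"
    and HC :: "(complex^'n) set set \<Rightarrow> (complex^'n) set"
    and h d :: "(complex^'n) set \<Rightarrow> complex^'n"
    and \<gamma> :: "(complex^'n) set \<Rightarrow> real \<Rightarrow> complex^'n"
  assumes "reflection_group W"
    and "invariant_hermitian_product W ip"
    and "x0 \<in> Vreg W"
    and "\<forall>C\<in>hyperplane_orbits W. HC C \<in> C"
    and "\<forall>H\<in>hyperplanes W. monodromy_data W ip x0 H (h H) (d H) (\<gamma> H)"
    and "extension_class (group_of W) (free_Abelian_group (hyperplanes W)) perm_act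
           (braid_ab W x0) (meridian_map W x0 h d \<gamma>) (braid_ab_proj W x0) \<kappa>"
  shows "cohomology_iso W HC \<kappa> =
           (\<lambda>C\<in>hyperplane_orbits W. natural_char_rat W ip (HC C))"
proof -
  \<comment> \<open>The vectors \<open>d\<close> serve as roots; the monodromy data make them
    nonzero and orthogonal to their hyperplanes.\<close>
  interpret braid_setup W ip d x0
    using assms(1-3,5) by unfold_locales (auto simp: monodromy_data_def)
  obtain s \<phi> where s: "s \<in> W \<rightarrow> carrier (braid_ab W x0)" "\<And>g. g \<in> W \<Longrightarrow> braid_ab_proj W x0 (s g) = g"
    and \<phi>: "\<phi> \<in> carrier (cochains2 (group_of W) (free_Abelian_group (hyperplanes W)))"
    and u: "\<And>g g'. g \<in> W \<Longrightarrow> g' \<in> W \<Longrightarrow> meridian_map W x0 h d \<gamma> (\<phi> (g, g')) =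
      s g \<otimes>\<^bsub>braid_ab W x0\<^esub> s g' \<otimes>\<^bsub>braid_ab W x0\<^esub> inv\<^bsub>braid_ab W x0\<^esub> (s (g ** g'))"
    and \<kappa>: "\<kappa> = H2_class (group_of W) (free_Abelian_group (hyperplanes W)) perm_act \<phi>"
    using assms(6) unfolding extension_class_def cocycles2_def by (auto simp: GL_def)
  show ?thesis
    unfolding cohomology_iso_def
  proof (rule restrict_ext)
    fix C assume C: "C \<in> hyperplane_orbits W"
    define H where "H = HC C"
    have HC: "H \<in> C" using assms(4) C by (simp add: H_def)
    have H: "H \<in> hyperplanes W" using HC orbit_subset[OF C] by blast
    let ?N = "stabilizer W H" and ?r = "natural_char_rat W ip H"
    have NW: "n \<in> W" if "n \<in> ?N" for n using that by (simp add: stabilizer_def)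
    have exp_s: "exp (2 * \<i> * of_real pi * Theta (form H) (s n)) = natural_char ip H n" if n: "n \<in> ?N" for n
      using s NW[OF n] by (intro Theta_section_exp[OF H n]) auto
    then have "\<forall>n\<in>?N. \<exists>q. Theta (form H) (s n) = of_rat q" using natural_char_rational[OF H] by blast
    then obtain L where L: "\<And>n. n \<in> ?N \<Longrightarrow> Theta (form H) (s n) = of_rat (L n)" by metis
    have exp_L: "exp (2 * \<i> * of_real pi * of_rat (L n)) = natural_char ip H n" if "n \<in> ?N" for n
      using exp_s[OF that] L[OF that] by simp
    define \<phi>1 where "\<phi>1 = (\<lambda>x\<in>W \<times> W. orbit_projection C (\<phi> x))"
    define \<psi> where "\<psi> = (\<lambda>x\<in>?N \<times> ?N. Poly_Mapping.lookup (\<phi>1 x) H)"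
    have \<phi>1: "\<phi>1 \<in> carrier (cochains2 (group_of W) (free_Abelian_group C))"
      by (simp add: cochains2_def PiE_iff \<phi>1_def keys_orbit_projection)
    have cls: "shapiro W H (H2_orbit_component W C \<kappa>) = H2_class (group_of ?N) integer_group trivial_act \<psi>"
      unfolding \<kappa> H2_orbit_component_class[OF C \<phi>] \<psi>_def
      using shapiro_class[OF C HC \<phi>1] by (simp add: \<phi>1_def)
    have coc: "of_int (\<psi> (a, b)) = L b - L (a ** b) + L a" if ab: "a \<in> ?N" "b \<in> ?N" for a b
    proof -
      have \<psi>: "\<psi> (a, b) = Poly_Mapping.lookup (\<phi> (a, b)) H"
        using ab NW by (simp add: \<psi>_def \<phi>1_def lookup_orbit_projection[OF HC])
      \<comment> \<open>The identity is proved among complex numbers, where winding numbers live,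
        and pulled back by injectivity of \<open>of_rat\<close>.\<close>
      have "of_int (\<psi> (a, b)) = (of_rat (L b - L (a ** b) + L a) :: complex)"
        using Theta_extension_cocycle[OF H ab _ s u[OF NW[OF ab(1)] NW[OF ab(2)]]] assms(5)
          L[OF ab(1)] L[OF ab(2)] L[OF stabilizer_mult[OF ab]]
        by (simp add: \<psi> of_rat_add of_rat_diff)
      then have "(of_rat (of_int (\<psi> (a, b))) :: complex) = of_rat (L b - L (a ** b) + L a)" by simp
      then show ?thesis by (simp only: of_rat_eq_iff)
    qed
    note r = natural_char_rat_hom[OF H exp_L]
    have "connecting_hom (group_of ?N) ?r = H2_class (group_of ?N) integer_group trivial_act \<psi>"
    proof (rule connecting_hom_lift[OF group_stabilizer r])
      show "?r n = rat_class (L n)" if "n \<in> carrier (group_of ?N)" for n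
        using that natural_char_rat_value[OF _ exp_L] by simp
      show "of_int (\<psi> (a, b)) = L b - L (a \<otimes>\<^bsub>group_of ?N\<^esub> b) + L a"
        if "a \<in> carrier (group_of ?N)" "b \<in> carrier (group_of ?N)" for a b
        using coc that by (simp add: GL_def)
    qed (auto simp: \<psi>_def)
    moreover have "finite (carrier (group_of ?N))" using finite_W by (simp add: stabilizer_def)
    \<comment> \<open>The argument of \<open>inv_into\<close> is the image of the natural character,
      so injectivity of the connecting map recovers it.\<close>
    ultimately show "inv_into (Hom_gr (group_of (stabilizer W (HC C))) rat_mod_int)
        (connecting_hom (group_of (stabilizer W (HC C)))) (shapiro W (HC C) (H2_orbit_component W C \<kappa>)) =
        natural_char_rat W ip (HC C)"
      using inv_into_f_f[OF connecting_hom_inj[OF group_stabilizer] r] cls by (simp add: H_def)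
  qed
qed

end
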